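(* Let $n,d\in\mathbb{N}$, $m\in\{0,\dots,n-1\}$, let $k\ge 0$ be an integer, $0\le\alpha\le 1$, $k+\alpha\ge 1$, $d>m$, and $v\in C^{k,\alpha}(\mathbb{R}^n,\mathbb{R}^d)$. Then for any real $q\in(m,\infty)$ the equality $$\mathcal{H}^{\mu_q}\bigl(Z_{v,m}\cap v^{-1}(y)\bigr)=0\qquad\text{for }\mathcal{H}^q\text{-almost all }y\in\mathbb{R}^d$$ holds, where $$\mu_q=n-m-(k+\alpha)(q-m),$$ and $Z_{v,m}=\{x\in\mathbb{R}^n:\operatorname{rank}\nabla v(x)\le m\}$ is the set of $m$-critical points of $v$.
   Context: For $0<\alpha\le 1$, $v\in C^{k,\alpha}(\mathbb{R}^n,\mathbb{R}^d)$ means that $v$ is $k$ times continuously differentiable and there is a constant $L\ge0$ with $|\nabla^k v(x)-\nabla^k v(y)|\le L|x-y|^\alpha$ for all $x,y\in\mathbb{R}^n$, where $\nabla^k v$ is the vector-valued function consisting of all $k$-th order partial derivatives of $v$ (and $\nabla^0v=v$). For $\alpha=0$, $C^{k,0}$ is identified with the usual space $C^k$ of $k$ times continuously differentiable mappings. When $k=0$ (so $\alpha=1$ and $v$ is Lipschitz), $Z_{v,m}$ consists of those points $x$ at which $v$ is differentiable and $\operatorname{rank}\nabla v(x)\le m$. For $\beta>0$, $\mathcal{H}^\beta$ is the $\beta$-dimensional Hausdorff measure, $\mathcal{H}^\beta(S)=\lim_{t\searrow0}\inf\{\sum_i(\operatorname{diam}S_i)^\beta:\operatorname{diam}S_i\le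 t,\ S\subset\bigcup_i S_i\}$. For $\beta\le 0$, $\mathcal{H}^\beta$ is interpreted as the counting measure. *)

theory Defs
  imports "HOL-Analysis.Analysis"
begin

section \<open>Mappings of class $C^{k,\alpha}$\<close>

definition partial_deriv ::
    "'n::finite \<Rightarrow> (real^'n \<Rightarrow> real^'d) \<Rightarrow> real^'n \<Rightarrow> real^'d" where
  "partial_deriv i v x = vector_derivative (\<lambda>t. v (x + t *\<^sub>R axis i 1)) (at 0)"

definition iter_partial ::
    "'n::finite list \<Rightarrow> (real^'n \<Rightarrow> real^'d) \<Rightarrow> real^'n \<Rightarrow> real^'d" where
  "iter_partial is v = foldr partial_deriv is v"

primrec C_k :: "nat \<Rightarrow> (real^'n::finite \<Rightarrow> real^'d) \<Rightarrow> bool" where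
  "C_k 0 v \<longleftrightarrow> continuous_on UNIV v"
| "C_k (Suc k) v \<longleftrightarrow> v differentiable_on UNIV \<and> (\<forall>i. C_k k (partial_deriv i v))"

text \<open>
  The $k$-th order partial derivatives are indexed by the lists of directions of length \<open>k\<close>
  (the empty list gives \<open>v\<close> itself), and the \<open>L2_set\<close> below is the Euclidean norm
  $|\nabla^k v(x) - \nabla^k v(y)|$. Note that the Hoelder condition is global and concerns only
  the top order derivatives, and that it is void for \<open>\<alpha> = 0\<close>.
\<close>

definition C_k_alpha :: "nat \<Rightarrow> real \<Rightarrow> (real^'n::finite \<Rightarrow> real^'d) \<Rightarrow> bool" where
  "C_k_alpha k \<alpha> v \<longleftrightarrow>
     C_k k v \<and>
     (\<alpha> > 0 \<longrightarrow>
       (\<exists>L\<ge>0. \<forall>x y.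
          L2_set (\<lambda>is. norm (iter_partial is v x - iter_partial is v y)) {is. length is = k}
            \<le> L * norm (x - y) powr \<alpha>))"

section \<open>Critical sets\<close>

text \<open>Differentiability is only a restriction for \<open>k = 0\<close>; for \<open>k \<ge> 1\<close> it holds everywhere.\<close>

definition critical_set :: "(real^'n::finite \<Rightarrow> real^'d::finite) \<Rightarrow> nat \<Rightarrow> (real^'n) set" where
  "critical_set v m = {x. v differentiable (at x) \<and> rank (jacobian v (at x)) \<le> m}"

section \<open>Hausdorff measure\<close>

text \<open>
  These are outer measures, defined on arbitrary sets and without normalising constant.
  Boundedness of the covering sets is required explicitly because \<open>diameter\<close> is real-valued
  and has no meaningful value on unbounded sets.
\<close>

definition hausdorff_pre :: "real \<Rightarrow> real \<Rightarrow> 'a::metric_space set \<Rightarrow> ennreal" where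
  "hausdorff_pre \<beta> t S =
     (INF C\<in>{C :: nat \<Rightarrow> 'a set. (\<forall>i. bounded (C i) \<and> diameter (C i) \<le> t) \<and> S \<subseteq> (\<Union>i. C i)}.
        \<Sum>i. ennreal (diameter (C i) powr \<beta>))"

definition hausdorff :: "real \<Rightarrow> 'a::metric_space set \<Rightarrow> ennreal" where
  "hausdorff \<beta> S =
     (if \<beta> > 0 then Lim (at_right 0) (\<lambda>t. hausdorff_pre \<beta> t S)
      else emeasure (count_space UNIV) S)"

text \<open>The limit exists, so that \<open>Lim\<close> is meaningful in this definition.\<close>

lemma hausdorff_pre_antimono: "s \<le> t \<Longrightarrow> hausdorff_pre \<beta> t S \<le> hausdorff_pre \<beta> s S"
  unfolding hausdorff_pre_def by (rule INF_superset_mono) (auto intro: order_trans)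

lemma hausdorff_pre_tendsto_SUP:
  "((\<lambda>t. hausdorff_pre \<beta> t S) \<longlongrightarrow> (SUP t\<in>{0<..}. hausdorff_pre \<beta> t S)) (at_right 0)"
proof (rule increasing_tendsto)
  show "\<forall>\<^sub>F t in at_right 0. hausdorff_pre \<beta> t S \<le> (SUP t\<in>{0<..}. hausdorff_pre \<beta> t S)"
    by (intro eventually_at_rightI[of 0 1]) (auto intro!: SUP_upper)
next
  fix x assume "x < (SUP t\<in>{0<..}. hausdorff_pre \<beta> t S)"
  then obtain t where t: "0 < t" "x < hausdorff_pre \<beta> t S"
    by (auto simp: less_SUP_iff)
  then show "\<forall>\<^sub>F s in at_right 0. x < hausdorff_pre \<beta> s S"
    by (intro eventually_at_rightI[of 0 t])
       (auto intro: less_le_trans hausdorff_pre_antimono less_imp_le)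
qed

lemma hausdorff_eq_SUP:
  "\<beta> > 0 \<Longrightarrow> hausdorff \<beta> S = (SUP t\<in>{0<..}. hausdorff_pre \<beta> t S)"
  unfolding hausdorff_def by (simp add: tendsto_Lim hausdorff_pre_tendsto_SUP)

end

theory Submission
  imports Defs
begin

text \<open>
Write $s = k + \alpha$ and $n$ for the dimension of the domain. Everything is expressed through one
outer measure. For a map $f$ and a set $A$ the mixed content of $A$ is the infimum of
$\sum_i r_i^\mu \rho_i^q$ over all countable covers of $A$ by sets $C_i$ of diameter at most $r_i$
whose images $f(C_i)$ have diameter at most $\rho_i$. The theorem splits into two facts about it.

\<^item> If $\mu > 0$ and the mixed content of $A$ vanishes, then $\mathcal{H}^\mu(A \cap f^{-1}(y)) = 0$ for
  $\mathcal{H}^q$-almost all $y$ (\<open>hausdorff_fibres_null\<close>). This is an inequality of Eilenberg type: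
  a point $y$ with a large fibre lies in many of the sets $f(C_i)$, counted with the weights
  $r_i^\mu$, and a set that is covered heavily can be covered once at proportionally smaller cost
  (\<open>weighted_cover_content_le\<close>).

\<^item> For $\mu = \mu_q$ the mixed content of the critical set vanishes
  (\<open>mixed_content_critical_set\<close>). If $\mu_q \le 0$, the fact is used with $\mu = 0$ and the smaller
  exponent $q' \le q$ for which $\mu_{q'} = 0$; it then says that the whole image of the critical set
  is $\mathcal{H}^{q'}$-null.

The reason for the second fact is the exponent count in \<open>mixed_content_scaled_box_count\<close>. Suppose
that on the part of $A$ in a cube of side $r$ the value of $f$ is determined, up to an error
$b r^s$, by at most $m$ coordinates. Cutting these coordinates into pieces of length about $b r^s$
gives about $(r^{1-s}/b)^m$ sets of diameter $r$ with images of diameter $b r^s$, of total cost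
$b^{q-m} r^n$. So a cube costs at most a multiple of its volume, and since $q > m$ the cost is a
small multiple of the volume once $b$ is small.

For $k \ge 1$ the required estimate comes from a Morse-type argument in which coordinates are
exchanged one at a time (\<open>coordinate_change_exists\<close>). As long as a component of the map has a
non-vanishing derivative in a coordinate that has not been treated yet, this component becomes the
coordinate; the rank condition allows at most $m$ such exchanges
(\<open>mixed_content_null_of_low_rank\<close>). Where this stops, all derivatives in the remaining, free
coordinates vanish on $A$. These derivatives are functions of class $C^{k-1,\alpha}$ vanishing on $A$,
and one repeats the question for them (\<open>mixed_content_null_of_vanishing_chain\<close>): either all free
derivatives of these functions vanish too, and one gains an order, or one of the functions cuts out
a hypersurface containing $A$ and can be made a coordinate, which is then constant on $A$ and
no longer free. In the end a chain of $k$ generations of functions vanishing on $A$ is left, the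
last one Hoelder continuous with exponent $\alpha$, and integrating $k$ times along the free
directions gives $|f(x) - f(y)| \le C (|x_P - y_P| + r^{k+\alpha})$, where $x_P$ collects the at
most $m$ coordinates that are neither free nor constant.

The step from a constant $C$ to a small factor $b$ rests on a dichotomy
(\<open>mixed_content_cube_null\<close>). Cut a cube into $N^n$ subcubes. If $A$ misses one of them, the
part of $A$ in the cube is covered by the other subcubes, whose total volume is smaller by a fixed
factor. If $A$ meets all of them, each point of the cube is within $n r/N$ of a zero of the
last functions of the chain, and Hoelder continuity (uniform continuity if $\alpha = 0$) makes these
functions small. Iterating, the
cost of a cube is at most any multiple of its volume.

For $k = 0$ the map is Lipschitz, $s = 1$, and near a point of differentiability of low rank the
image of a cube is close to a piece of an at most $m$-dimensional plane
(\<open>mixed_content_null_of_lipschitz\<close>).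
\<close>

section \<open>The mixed content of a map\<close>

text \<open>
The radii $r_i$ are strictly positive so that $r_i^0 = 1$ in the case $\mu = 0$, where the content
only measures the image (\<open>0 powr 0\<close> is \<open>0\<close>). The bound $\rho_i \le 1$ makes larger
exponents cheaper and lets the dyadic scales of the target be indexed by natural numbers.
\<close>
definition mixed_cover ::
  "('a::metric_space \<Rightarrow> 'b::metric_space) \<Rightarrow> 'a set \<Rightarrow> (nat \<Rightarrow> 'a set) \<Rightarrow> (nat \<Rightarrow> real) \<Rightarrow> (nat \<Rightarrow> real) \<Rightarrow> bool"
  where
  "mixed_cover f A C r \<rho> \<longleftrightarrow> A \<subseteq> (\<Union>i. C i) \<and>
     (\<forall>i. 0 < r i \<and> 0 < \<rho> i \<and> \<rho> i \<le> 1 \<and>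
          (\<forall>x\<in>C i. \<forall>y\<in>C i. dist x y \<le> r i \<and> dist (f x) (f y) \<le> \<rho> i))"

text \<open>
For $\mu = 0$ and $f$ the identity this is the Hausdorff content of dimension $q$ obtained from
covers by sets of diameter at most $1$.
\<close>
definition mixed_content ::
  "real \<Rightarrow> real \<Rightarrow> ('a::metric_space \<Rightarrow> 'b::metric_space) \<Rightarrow> 'a set \<Rightarrow> ennreal" where
  "mixed_content \<mu> q f A =
     Inf {(\<Sum>i. ennreal (r i powr \<mu> * \<rho> i powr q)) |C r \<rho>. mixed_cover f A C r \<rho>}"

lemma mixed_content_le:
  "mixed_cover f A C r \<rho> \<Longrightarrow> mixed_content \<mu> q f A \<le> (\<Sum>i. ennreal (r i powr \<mu> * \<rho> i powr q))"
  unfolding mixed_content_def by (rule Inf_lower) blast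

lemma mixed_content_lessE:
  assumes "mixed_content \<mu> q f A < c"
  obtains C r \<rho> where "mixed_cover f A C r \<rho>" "(\<Sum>i. ennreal (r i powr \<mu> * \<rho> i powr q)) < c"
  using assms unfolding mixed_content_def Inf_less_iff by blast

lemma mixed_content_mono: "A \<subseteq> B \<Longrightarrow> mixed_content \<mu> q f A \<le> mixed_content \<mu> q f B"
  unfolding mixed_content_def by (rule Inf_superset_mono) (auto simp: mixed_cover_def, blast)

lemma mixed_content_UN_le:
  fixes A :: "nat \<Rightarrow> 'a::metric_space set"
  shows "mixed_content \<mu> q f (\<Union>i. A i) \<le> (\<Sum>i. mixed_content \<mu> q f (A i))"
proof (cases "(\<Sum>i. mixed_content \<mu> q f (A i)) < top")
  case False
  then show ?thesis by (metis top.not_eq_extremum top_greatest)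
next
  case True
  have fin: "mixed_content \<mu> q f (A i) < top" for i
    using True by (metis ennreal_suminf_lessD less_top)
  show ?thesis
  proof (rule ennreal_le_epsilon)
    fix e :: real assume e: "0 < e"
    have "\<forall>i. \<exists>C r \<rho>. mixed_cover f (A i) C r \<rho> \<and>
       (\<Sum>j. ennreal (r j powr \<mu> * \<rho> j powr q)) \<le> mixed_content \<mu> q f (A i) + ennreal (e * (1/2)^Suc i)"
    proof
      fix i
      have "mixed_content \<mu> q f (A i) < mixed_content \<mu> q f (A i) + ennreal (e * (1/2)^Suc i)"
        using fin[of i] e by (simp add: ennreal_zero_less_mult_iff less_top)
      then show "\<exists>C r \<rho>. mixed_cover f (A i) C r \<rho> \<and>
       (\<Sum>j. ennreal (r j powr \<mu> * \<rho> j powr q)) \<le> mixed_content \<mu> q f (A i) + ennreal (e * (1/2)^Suc i)"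
        by (elim mixed_content_lessE) (meson less_imp_le)
    qed
    then obtain C r \<rho> where cov: "\<And>i. mixed_cover f (A i) (C i) (r i) (\<rho> i)" and
      cost: "\<And>i. (\<Sum>j. ennreal (r i j powr \<mu> * \<rho> i j powr q))
          \<le> mixed_content \<mu> q f (A i) + ennreal (e * (1/2)^Suc i)"
      unfolding choice_iff by blast
    define p where "p k = fst (prod_decode k)" for k
    define p' where "p' k = snd (prod_decode k)" for k
    have surj: "\<exists>k. p k = i \<and> p' k = j" for i j
      by (rule exI[of _ "prod_encode (i,j)"]) (simp add: p_def p'_def)
    have "mixed_cover f (\<Union>i. A i) (\<lambda>k. C (p k) (p' k)) (\<lambda>k. r (p k) (p' k)) (\<lambda>k. \<rho> (p k) (p' k))"
      unfolding mixed_cover_def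
    proof (intro conjI allI)
      show "(\<Union>i. A i) \<subseteq> (\<Union>k. C (p k) (p' k))"
      proof
        fix x assume "x \<in> (\<Union>i. A i)"
        then obtain i where "x \<in> A i" by auto
        then obtain j where "x \<in> C i j" using cov[of i] by (auto simp: mixed_cover_def)
        then show "x \<in> (\<Union>k. C (p k) (p' k))" using surj[of i j] by auto
      qed
    qed (use cov in \<open>simp_all add: mixed_cover_def\<close>)
    then have "mixed_content \<mu> q f (\<Union>i. A i)
        \<le> (\<Sum>k. ennreal (r (p k) (p' k) powr \<mu> * \<rho> (p k) (p' k) powr q))"
      by (rule mixed_content_le)
    also have "\<dots> = (\<Sum>k. (\<lambda>(i,j). ennreal (r i j powr \<mu> * \<rho> i j powr q)) (prod_decode k))"
      by (simp add: p_def p'_def case_prod_beta)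
    also have "\<dots> = (\<Sum>i. \<Sum>j. ennreal (r i j powr \<mu> * \<rho> i j powr q))"
      by (rule suminf_ennreal_2dimen) simp
    also have "\<dots> \<le> (\<Sum>i. mixed_content \<mu> q f (A i) + ennreal (e * (1/2)^Suc i))"
      by (intro suminf_le cost) auto
    also have "\<dots> = (\<Sum>i. mixed_content \<mu> q f (A i)) + (\<Sum>i. ennreal (e * (1/2)^Suc i))"
      by (rule suminf_add[symmetric]) auto
    also have "(\<Sum>i. ennreal (e * (1/2)^Suc i)) = ennreal e"
    proof -
      have "(\<lambda>i. e * (1/2)^Suc i) sums (e * 1)"
        by (intro sums_mult power_half_series)
      then show ?thesis using e by (intro suminf_ennreal_eq) auto
    qed
    finally show "mixed_content \<mu> q f (\<Union>i. A i) \<le> (\<Sum>i. mixed_content \<mu> q f (A i)) + ennreal e" .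
  qed
qed

text \<open>
A single set is turned into a sequence of sets by appending empty sets, whose radii are positive
but can be chosen with arbitrarily small total cost.
\<close>
lemma mixed_content_single:
  assumes q: "q > 0" and r: "0 < r" and \<rho>: "0 < \<rho>" "\<rho> \<le> 1"
    and d: "\<And>x y. x \<in> S \<Longrightarrow> y \<in> S \<Longrightarrow> dist x y \<le> r"
       "\<And>x y. x \<in> S \<Longrightarrow> y \<in> S \<Longrightarrow> dist (f x) (f y) \<le> \<rho>"
  shows "mixed_content \<mu> q f S \<le> ennreal (r powr \<mu> * \<rho> powr q)"
proof (rule ennreal_le_epsilon)
  fix e' :: real assume e': "0 < e'"
  \<comment> \<open>the radii $\rho_i$ of the appended empty sets must be at most $1$, hence the truncation\<close>
  define e where "e = min e' 1"
  have e: "0 < e" "e \<le> 1" "e \<le> e'" using e' by (auto simp: e_def)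
  define \<rho>' where "\<rho>' i = (if i = 0 then \<rho> else (e * (1/2)^i) powr (1/q))" for i :: nat
  define r' where "r' i = (if i = 0 then r else 1)" for i :: nat
  have le1: "e * (1/2)^i \<le> 1" for i
    using e by (intro mult_le_one) (auto simp: power_le_one)
  have "mixed_cover f S (\<lambda>i. if i = 0 then S else {}) r' \<rho>'"
    unfolding mixed_cover_def r'_def \<rho>'_def
    using r \<rho> d e le1 q by (auto intro!: powr_le1 split: if_splits)
  then have "mixed_content \<mu> q f S \<le> (\<Sum>i. ennreal (r' i powr \<mu> * \<rho>' i powr q))"
    by (rule mixed_content_le)
  also have "\<dots> = (\<Sum>i. (if i = 0 then ennreal (r powr \<mu> * \<rho> powr q) else 0) +
                     (if i = 0 then 0 else ennreal (e * (1/2)^i)))"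
    using q e by (intro suminf_cong) (auto simp: r'_def \<rho>'_def powr_powr)
  also have "\<dots> = (\<Sum>i::nat. (if i = 0 then ennreal (r powr \<mu> * \<rho> powr q) else 0)) +
                  (\<Sum>i::nat. (if i = 0 then 0 else ennreal (e * (1/2)^i)))"
    by (rule suminf_add[symmetric]) auto
  also have "(\<Sum>i::nat. (if i = 0 then ennreal (r powr \<mu> * \<rho> powr q) else 0)) = ennreal (r powr \<mu> * \<rho> powr q)"
    using suminf_finite[of "{0::nat}" "\<lambda>i. (if i = 0 then ennreal (r powr \<mu> * \<rho> powr q) else 0)"] by simp
  also have "(\<Sum>i::nat. (if i = 0 then 0 else ennreal (e * (1/2)^i))) \<le> ennreal e"
  proof -
    have "(\<Sum>i::nat. (if i = 0 then 0 else ennreal (e * (1/2)^i)))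
        = (\<Sum>i. (if Suc i = 0 then 0 else ennreal (e * (1/2)^Suc i))) + (\<Sum>i<1. (if i = 0 then 0 else ennreal (e * (1/2)^i)))"
      using suminf_offset[of "\<lambda>i. (if i = 0 then 0 else ennreal (e * (1/2)^i))" 1] by simp
    also have "\<dots> = (\<Sum>i. ennreal (e * (1/2)^Suc i))" by simp
    also have "\<dots> = ennreal e"
    proof -
      have "(\<lambda>i. e * (1/2)^Suc i) sums (e * 1)"
        by (intro sums_mult power_half_series)
      then show ?thesis using e by (intro suminf_ennreal_eq) auto
    qed
    finally show ?thesis by simp
  qed
  also have "ennreal e \<le> ennreal e'" using e by (simp add: ennreal_leI)
  finally show "mixed_content \<mu> q f S \<le> ennreal (r powr \<mu> * \<rho> powr q) + ennreal e'"
    by (simp add: add_left_mono)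
qed

lemma mixed_content_empty [simp]:
  assumes "q > 0" shows "mixed_content \<mu> q f {} = 0"
proof -
  have "mixed_content \<mu> q f {} \<le> 0 + ennreal e" if e: "0 < e" for e
  proof -
    define \<rho> where "\<rho> = (min e 1) powr (1/q)"
    have "mixed_content \<mu> q f {} \<le> ennreal (1 powr \<mu> * \<rho> powr q)"
      using assms e by (intro mixed_content_single) (auto simp: \<rho>_def intro!: powr_le1)
    also have "\<dots> \<le> ennreal e" using assms e by (auto simp: \<rho>_def powr_powr intro!: ennreal_leI)
    finally show ?thesis by simp
  qed
  then have "mixed_content \<mu> q f {} \<le> 0"
    by (rule ennreal_le_epsilon)
  then show ?thesis by simp
qed

lemma mixed_content_Un_le:
  assumes "q > 0"
  shows "mixed_content \<mu> q f (A \<union> B) \<le> mixed_content \<mu> q f A + mixed_content \<mu> q f B"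
proof -
  define D where "D i = (if i = 0 then A else if i = 1 then B else {})" for i :: nat
  have "A \<union> B = (\<Union>i. D i)"
    unfolding D_def by (auto split: if_splits intro: exI[of _ "0::nat"] exI[of _ "1::nat"])
  then have "mixed_content \<mu> q f (A \<union> B) \<le> (\<Sum>i. mixed_content \<mu> q f (D i))"
    using mixed_content_UN_le[of \<mu> q f D] by simp
  also have "\<dots> = (\<Sum>i\<in>{0,1}. mixed_content \<mu> q f (D i))"
    using assms by (intro suminf_finite) (auto simp: D_def)
  finally show ?thesis by (simp add: D_def)
qed

lemma mixed_content_UN_finite_le:
  assumes "q > 0" "finite I"
  shows "mixed_content \<mu> q f (\<Union>i\<in>I. A i) \<le> (\<Sum>i\<in>I. mixed_content \<mu> q f (A i))"
  using assms(2)
proof induction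
  case (insert i I)
  have "mixed_content \<mu> q f (\<Union>i\<in>insert i I. A i)
      \<le> mixed_content \<mu> q f (A i) + mixed_content \<mu> q f (\<Union>i\<in>I. A i)"
    using mixed_content_Un_le[OF assms(1), of \<mu> f "A i" "\<Union>i\<in>I. A i"] by (simp only: UN_insert)
  also have "\<dots> \<le> mixed_content \<mu> q f (A i) + (\<Sum>i\<in>I. mixed_content \<mu> q f (A i))"
    by (rule add_left_mono[OF insert.IH])
  finally show ?case using insert.hyps by simp
qed (use assms in simp)

lemma mixed_content_null_UN:
  assumes "q > 0" "countable I" "\<And>i. i \<in> I \<Longrightarrow> mixed_content \<mu> q f (A i) = 0"
  shows "mixed_content \<mu> q f (\<Union>i\<in>I. A i) = 0"
proof (cases "I = {}")
  case False
  have "(\<Union>i\<in>I. A i) = (\<Union>n. A (from_nat_into I n))"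
  proof -
    have "(\<Union>i\<in>range (from_nat_into I). A i) = (\<Union>n. A (from_nat_into I n))" by simp
    then show ?thesis by (simp only: range_from_nat_into[OF False assms(2)])
  qed
  moreover have "mixed_content \<mu> q f (A (from_nat_into I n)) = 0" for n
    using False assms(3) by (simp add: from_nat_into)
  ultimately show ?thesis
    using mixed_content_UN_le[of \<mu> q f "\<lambda>n. A (from_nat_into I n)"] by simp
qed (use assms in simp)

lemma mixed_content_null_Un:
  assumes "q > 0" "mixed_content \<mu> q f A = 0" "mixed_content \<mu> q f B = 0"
  shows "mixed_content \<mu> q f (A \<union> B) = 0"
  using mixed_content_Un_le[of q \<mu> f A B] assms by simp

text \<open>
By the Lindeloef property countably many of the neighbourhoods suffice. All later arguments
are therefore local.
\<close>
lemma mixed_content_null_local: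
  fixes A :: "'a::{metric_space,second_countable_topology} set"
  assumes "q > 0"
    and loc: "\<And>x. x \<in> A \<Longrightarrow> \<exists>U. open U \<and> x \<in> U \<and> mixed_content \<mu> q f (A \<inter> U) = 0"
  shows "mixed_content \<mu> q f A = 0"
proof -
  obtain U where U: "\<And>x. x \<in> A \<Longrightarrow> open (U x) \<and> x \<in> U x \<and> mixed_content \<mu> q f (A \<inter> U x) = 0"
    using loc by metis
  obtain F where F: "F \<subseteq> U ` A" "countable F" "\<Union>F = \<Union>(U ` A)"
    using Lindelof[of "U ` A"] U by (metis imageE)
  have "mixed_content \<mu> q f (\<Union>V\<in>F. A \<inter> V) = 0"
    using F U by (intro mixed_content_null_UN assms) auto
  moreover have "A \<subseteq> (\<Union>V\<in>F. A \<inter> V)"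
    using F(3) U by blast
  ultimately show ?thesis using mixed_content_mono by (metis le_zero_eq)
qed

text \<open>
This makes the vanishing of the content invariant under Lipschitz changes of variables in the
domain: a cover is pushed forward by $g$, which multiplies the $r_i$ by $K$ and keeps the images.
\<close>
lemma mixed_content_null_image:
  assumes K: "K > 0" and lip: "\<And>x y. x \<in> B \<Longrightarrow> y \<in> B \<Longrightarrow> dist (g x) (g y) \<le> K * dist x y"
    and null: "mixed_content \<mu> q (f \<circ> g) B = 0"
  shows "mixed_content \<mu> q f (g ` B) = 0"
proof -
  have "mixed_content \<mu> q f (g ` B) \<le> 0 + ennreal e" if e: "0 < e" for e
  proof -
    have "mixed_content \<mu> q (f \<circ> g) B < ennreal (e / K powr \<mu>)"
      using e K null by simp
    then obtain C r \<rho> where C: "mixed_cover (f \<circ> g) B C r \<rho>" and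
      less: "(\<Sum>i. ennreal (r i powr \<mu> * \<rho> i powr q)) < ennreal (e / K powr \<mu>)"
      by (rule mixed_content_lessE)
    have "mixed_cover f (g ` B) (\<lambda>i. g ` (C i \<inter> B)) (\<lambda>i. K * r i) \<rho>"
      unfolding mixed_cover_def
    proof (intro conjI allI ballI)
      have "B \<subseteq> (\<Union>i. C i)" using C by (simp add: mixed_cover_def)
      then have "B = (\<Union>i. C i \<inter> B)" by auto
      then show "g ` B \<subseteq> (\<Union>i. g ` (C i \<inter> B))" by (metis image_UN order_refl)
      fix i
      show "dist x y \<le> K * r i" if "x \<in> g ` (C i \<inter> B)" "y \<in> g ` (C i \<inter> B)" for x y
      proof -
        obtain x' where x': "x = g x'" "x' \<in> C i" "x' \<in> B" using \<open>x \<in> g ` (C i \<inter> B)\<close> by auto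
        obtain y' where y': "y = g y'" "y' \<in> C i" "y' \<in> B" using \<open>y \<in> g ` (C i \<inter> B)\<close> by auto
        have "dist x' y' \<le> r i" using C x' y' by (auto simp: mixed_cover_def)
        then have "K * dist x' y' \<le> K * r i" using K by simp
        then show ?thesis using lip[OF x'(3) y'(3)] x' y' by simp
      qed
    qed (use C K in \<open>auto simp: mixed_cover_def\<close>)
    then have "mixed_content \<mu> q f (g ` B) \<le> (\<Sum>i. ennreal ((K * r i) powr \<mu> * \<rho> i powr q))"
      by (rule mixed_content_le)
    also have "\<dots> = (\<Sum>i. ennreal (K powr \<mu>) * ennreal (r i powr \<mu> * \<rho> i powr q))"
      using C K by (intro suminf_cong) (simp add: mixed_cover_def powr_mult less_imp_le ennreal_mult'[symmetric] mult.assoc)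
    also have "\<dots> = ennreal (K powr \<mu>) * (\<Sum>i. ennreal (r i powr \<mu> * \<rho> i powr q))"
      by (rule ennreal_suminf_cmult)
    also have "\<dots> \<le> ennreal (K powr \<mu>) * ennreal (e / K powr \<mu>)"
      using less by (intro mult_left_mono) auto
    also have "\<dots> = ennreal e" using K e by (simp add: ennreal_mult'[symmetric])
    finally show ?thesis by simp
  qed
  then have "mixed_content \<mu> q f (g ` B) \<le> 0" by (rule ennreal_le_epsilon)
  then show ?thesis by simp
qed

section \<open>Counting boxes and subdividing cubes\<close>

text \<open>
The interval $[0,W]$ is the union of $M$ closed slabs of width $W/M$; for $t = W$ the last one
has to be taken.
\<close>
lemma slab_exists:
  fixes t W :: real
  assumes "0 \<le> t" "t \<le> W" "1 \<le> M"
  shows "\<exists>k<M. real k * (W / M) \<le> t \<and> t \<le> (real k + 1) * (W / M)"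
proof (cases "t = W")
  case True
  have "real (M - 1) * (W / M) \<le> t"
    using assms True by (simp add: of_nat_diff field_simps)
  moreover have "(real (M - 1) + 1) * (W / M) = W"
    using assms by (simp add: of_nat_diff)
  ultimately show ?thesis using assms True by (intro exI[of _ "M - 1"]) auto
next
  case False
  then have W: "0 < W" "t < W" using assms by auto
  define h where "h = W / M"
  have h: "0 < h" "M * h = W" using W assms by (auto simp: h_def)
  define k where "k = nat \<lfloor>t / h\<rfloor>"
  have k: "real k = of_int \<lfloor>t / h\<rfloor>" using h assms by (simp add: k_def)
  have "real k \<le> t / h" "t / h < real k + 1" unfolding k by linarith+
  then have *: "real k * h \<le> t" "t < (real k + 1) * h" using h by (auto simp: field_simps)
  have "real k * h < real M * h" using *(1) W(2) unfolding h(2) by linarith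
  then have "real k < real M" unfolding mult_less_cancel_right using h by linarith
  then have "k < M" by simp
  then show ?thesis using * by (auto simp: h_def intro!: exI[of _ k])
qed

text \<open>
If $f$ is controlled by finitely many real functions $u_b$ of range $W$, slicing the range of each
of them into $M$ slabs produces $M^{|B|}$ pieces on which $f$ varies by at most $\rho$.
\<close>
lemma mixed_content_box_count:
  fixes u :: "'b \<Rightarrow> 'a::metric_space \<Rightarrow> real"
  assumes q: "q > 0" and B: "finite B" and M: "1 \<le> M"
    and r: "0 < r" and \<rho>: "0 < \<rho>" "\<rho> \<le> 1"
    and rng: "\<And>b x. b \<in> B \<Longrightarrow> x \<in> S \<Longrightarrow> c b \<le> u b x \<and> u b x \<le> c b + W"
    and diam: "\<And>x y. x \<in> S \<Longrightarrow> y \<in> S \<Longrightarrow> dist x y \<le> r"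
    and small: "\<And>x y. x \<in> S \<Longrightarrow> y \<in> S \<Longrightarrow> (\<And>b. b \<in> B \<Longrightarrow> \<bar>u b x - u b y\<bar> \<le> W / M) \<Longrightarrow> dist (f x) (f y) \<le> \<rho>"
  shows "mixed_content \<mu> q f S \<le> ennreal (real M ^ card B * (r powr \<mu> * \<rho> powr q))"
proof -
  let ?G = "PiE B (\<lambda>_. {..<M})"
  define slab where "slab \<kappa> = {x\<in>S. \<forall>b\<in>B. real (\<kappa> b) * (W / M) \<le> u b x - c b \<and>
    u b x - c b \<le> (real (\<kappa> b) + 1) * (W / M)}" for \<kappa> :: "'b \<Rightarrow> nat"
  have fin: "finite ?G" using B by (intro finite_PiE) auto
  have "S \<subseteq> (\<Union>\<kappa>\<in>?G. slab \<kappa>)"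
  proof
    fix x assume x: "x \<in> S"
    have "\<forall>b\<in>B. \<exists>k<M. real k * (W / M) \<le> u b x - c b \<and> u b x - c b \<le> (real k + 1) * (W / M)"
      using rng x M by (intro ballI slab_exists) force+
    then obtain \<kappa> where "\<forall>b\<in>B. \<kappa> b < M \<and> real (\<kappa> b) * (W / M) \<le> u b x - c b \<and>
      u b x - c b \<le> (real (\<kappa> b) + 1) * (W / M)"
      unfolding bchoice_iff by blast
    then have "restrict \<kappa> B \<in> ?G" "x \<in> slab (restrict \<kappa> B)"
      using x by (auto simp: slab_def)
    then show "x \<in> (\<Union>\<kappa>\<in>?G. slab \<kappa>)" by blast
  qed
  then have "mixed_content \<mu> q f S \<le> mixed_content \<mu> q f (\<Union>\<kappa>\<in>?G. slab \<kappa>)"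
    by (rule mixed_content_mono)
  also have "\<dots> \<le> (\<Sum>\<kappa>\<in>?G. mixed_content \<mu> q f (slab \<kappa>))"
    by (rule mixed_content_UN_finite_le[OF q fin])
  also have "\<dots> \<le> (\<Sum>\<kappa>\<in>?G. ennreal (r powr \<mu> * \<rho> powr q))"
  proof (intro sum_mono mixed_content_single q r \<rho>)
    fix \<kappa> x y assume xy: "x \<in> slab \<kappa>" "y \<in> slab \<kappa>"
    then have S: "x \<in> S" "y \<in> S" by (auto simp: slab_def)
    show "dist x y \<le> r" by (rule diam[OF S])
    show "dist (f x) (f y) \<le> \<rho>"
    proof (rule small[OF S])
      fix b assume "b \<in> B"
      then have "real (\<kappa> b) * (W / M) \<le> u b x - c b" "u b x - c b \<le> (real (\<kappa> b) + 1) * (W / M)"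
        "real (\<kappa> b) * (W / M) \<le> u b y - c b" "u b y - c b \<le> (real (\<kappa> b) + 1) * (W / M)"
        using xy by (auto simp: slab_def)
      then show "\<bar>u b x - u b y\<bar> \<le> W / M"
        unfolding distrib_right by linarith
    qed
  qed
  also have "\<dots> = ennreal (real M ^ card B * (r powr \<mu> * \<rho> powr q))"
    using B by (simp add: card_PiE ennreal_of_nat_eq_real_of_nat ennreal_mult' ennreal_power)
  finally show ?thesis .
qed

text \<open>
The exponent count of the whole proof. At scale $r$ the controlling functions have range of order
$r$ and $f$ is determined by them up to $b r^s$; taking slabs of width about $b r^s$ the powers of
$r$ add up to $r^N$ exactly when there are $m$ controlling functions, and fewer functions only help
because $s \ge 1$. What remains is the gain $b^{q-m}$.
\<close>
lemma mixed_content_scaled_box_count: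
  fixes u :: "'b \<Rightarrow> 'a::metric_space \<Rightarrow> real" and N m :: nat
  assumes q: "q > real m" and s: "s \<ge> 1" and B: "finite B" "card B \<le> m"
    and \<mu>: "\<mu> = real N - real m - s * (q - real m)"
    and r: "0 < r" "r \<le> 1" and b: "0 < b" "b \<le> 1" and pos: "0 < D" "0 < K" "0 < C"
    and le1: "C * (K + 1) * r \<le> 1"
    and rng: "\<And>b x. b \<in> B \<Longrightarrow> x \<in> S \<Longrightarrow> c b \<le> u b x \<and> u b x \<le> c b + K * r"
    and diam: "\<And>x y. x \<in> S \<Longrightarrow> y \<in> S \<Longrightarrow> dist x y \<le> D * r"
    and small: "\<And>x y \<delta>. x \<in> S \<Longrightarrow> y \<in> S \<Longrightarrow> (\<And>b. b \<in> B \<Longrightarrow> \<bar>u b x - u b y\<bar> \<le> \<delta>) \<Longrightarrow> 0 \<le> \<delta>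
        \<Longrightarrow> dist (f x) (f y) \<le> C * (\<delta> + b * r powr s)"
  shows "mixed_content \<mu> q f S
     \<le> ennreal (2 ^ m * D powr \<mu> * (C * (K + 1)) powr q * b powr (q - real m) * r ^ N)"
proof -
  \<comment> \<open>the number of slabs is about \<open>t\<close>, so that the width of a slab is about $K r / t = K b r^s$\<close>
  define t where "t = r powr (1 - s) / b"
  have rs: "r powr s \<le> r" using r s powr_mono'[of 1 s r] by simp
  have t1: "1 \<le> t"
  proof -
    have "1 \<le> r powr (1 - s)" using r s by (metis powr_mono' powr_zero_eq_one diff_le_0_iff_le less_imp_le not_less_iff_gr_or_eq)
    then show ?thesis using b by (simp add: t_def)
  qed
  define M where "M = nat \<lceil>t\<rceil>"
  have M: "t \<le> real M" "real M \<le> 2 * t" "1 \<le> M" "0 < real M"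
    using t1 unfolding M_def by linarith+
  define \<rho> where "\<rho> = C * (K + 1) * (b * r powr s)"
  have \<rho>: "0 < \<rho>" using pos b r by (simp add: \<rho>_def)
  have "b * r powr s \<le> r" using b r rs by (meson mult_left_le_one_le order_trans less_imp_le powr_ge_zero)
  then have \<rho>1: "\<rho> \<le> 1"
    unfolding \<rho>_def using le1 pos by (meson mult_left_mono order_trans less_imp_le mult_pos_pos add_pos_pos zero_less_one)
  have rt: "r / t = b * r powr s"
    using r b by (simp add: t_def powr_diff field_simps)
  have "K * r / M \<le> K * (r / t)"
    using M t1 pos r by (simp add: frac_le)
  then have KM: "K * r / M \<le> K * (b * r powr s)" by (simp add: rt)
  have "mixed_content \<mu> q f S \<le> ennreal (real M ^ card B * ((D * r) powr \<mu> * \<rho> powr q))"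
  proof (rule mixed_content_box_count[where u = u and c = c and W = "K * r"])
    fix x y assume xy: "x \<in> S" "y \<in> S" "\<And>b. b \<in> B \<Longrightarrow> \<bar>u b x - u b y\<bar> \<le> K * r / M"
    have "dist (f x) (f y) \<le> C * (K * (b * r powr s) + b * r powr s)"
      using xy KM pos b r by (intro small) (auto intro: order_trans)
    also have "\<dots> = \<rho>" by (simp add: \<rho>_def algebra_simps)
    finally show "dist (f x) (f y) \<le> \<rho>" .
  qed (use q B M r pos \<rho> \<rho>1 rng diam in auto)
  also have "\<dots> \<le> ennreal (2 ^ m * D powr \<mu> * (C * (K + 1)) powr q * b powr (q - real m) * r ^ N)"
  proof (rule ennreal_leI)
    have "real M ^ card B \<le> real M ^ m"
      using M B by (intro power_increasing) auto
    also have "\<dots> \<le> (2 * t) ^ m" using M by (intro power_mono) auto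
    also have "\<dots> = 2 ^ m * (r powr (m * (1 - s)) * b powr (- real m))"
    proof -
      have "t powr m = r powr (m * (1 - s)) * b powr (- real m)"
      proof -
        have t: "t = r powr (1 - s) * b powr (-1)" using b by (simp add: t_def powr_minus divide_inverse)
        show ?thesis unfolding t by (simp only: powr_mult powr_powr) (simp add: mult.commute)
      qed
      then show ?thesis using t1 by (simp add: power_mult_distrib powr_realpow)
    qed
    finally have "real M ^ card B * ((D * r) powr \<mu> * \<rho> powr q)
       \<le> 2 ^ m * (r powr (m * (1 - s)) * b powr (- real m)) * ((D * r) powr \<mu> * \<rho> powr q)"
      by (intro mult_right_mono) auto
    also have "\<dots> = 2 ^ m * D powr \<mu> * (C * (K + 1)) powr q * (b powr (- real m) * b powr q) *
        (r powr (m * (1 - s)) * r powr \<mu> * r powr (s * q))"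
      using pos b r by (simp add: \<rho>_def powr_mult powr_powr mult_ac)
    also have "b powr (- real m) * b powr q = b powr (q - real m)"
      by (simp add: powr_add[symmetric])
    also have "r powr (m * (1 - s)) * r powr \<mu> * r powr (s * q) = r powr (real N)"
      by (simp add: powr_add[symmetric] \<mu> algebra_simps)
    also have "\<dots> = r ^ N" using r by (simp add: powr_realpow)
    finally show "real M ^ card B * ((D * r) powr \<mu> * \<rho> powr q)
      \<le> 2 ^ m * D powr \<mu> * (C * (K + 1)) powr q * b powr (q - real m) * r ^ N" .
  qed
  finally show ?thesis .
qed

lemma dist_vec_le_sum: "dist (x :: real^'n) y \<le> (\<Sum>i\<in>UNIV. \<bar>x $ i - y $ i\<bar>)"
  using norm_le_l1_cart[of "x - y"] by (simp add: dist_norm)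

definition cube :: "real^'n \<Rightarrow> real \<Rightarrow> (real^'n) set" where
  "cube c r = {x. \<forall>i. c $ i \<le> x $ i \<and> x $ i \<le> c $ i + r}"

definition subcube :: "real^'n \<Rightarrow> real \<Rightarrow> nat \<Rightarrow> ('n \<Rightarrow> nat) \<Rightarrow> (real^'n) set" where
  "subcube c r N \<kappa> = cube (\<chi> i. c $ i + real (\<kappa> i) * (r / N)) (r / N)"

abbreviation grid :: "nat \<Rightarrow> ('n::finite \<Rightarrow> nat) set" where
  "grid N \<equiv> PiE UNIV (\<lambda>_. {..<N})"

lemma finite_grid: "finite (grid N)"
  by (intro finite_PiE) auto

lemma card_grid: "card (grid N :: ('n::finite \<Rightarrow> nat) set) = N ^ CARD('n)"
  by (simp add: card_PiE)

lemma cube_subset_subcubes: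
  assumes "1 \<le> N" shows "cube c r \<subseteq> (\<Union>\<kappa>\<in>grid N. subcube c r N \<kappa>)"
proof
  fix x assume x: "x \<in> cube c r"
  have "\<forall>i. \<exists>k<N. real k * (r / N) \<le> x $ i - c $ i \<and> x $ i - c $ i \<le> (real k + 1) * (r / N)"
    using x assms by (intro allI slab_exists) (auto simp: cube_def algebra_simps)
  then obtain \<kappa> where "\<forall>i. \<kappa> i < N \<and> real (\<kappa> i) * (r / N) \<le> x $ i - c $ i \<and> x $ i - c $ i \<le> (real (\<kappa> i) + 1) * (r / N)"
    unfolding choice_iff by blast
  then have "\<kappa> \<in> grid N" "x \<in> subcube c r N \<kappa>"
    by (auto simp: subcube_def cube_def algebra_simps)
  then show "x \<in> (\<Union>\<kappa>\<in>grid N. subcube c r N \<kappa>)" by blast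
qed

lemma subcube_subset_cube:
  assumes "\<kappa> \<in> grid N" "0 \<le> r" shows "subcube c r N \<kappa> \<subseteq> cube c r"
proof
  fix x assume x: "x \<in> subcube c r N \<kappa>"
  have "c $ i \<le> x $ i \<and> x $ i \<le> c $ i + r" for i
  proof -
    have "\<kappa> i < N" using assms by auto
    then have k: "real (\<kappa> i) + 1 \<le> N" by linarith
    have "(real (\<kappa> i) + 1) * (r / N) \<le> N * (r / N)"
      using k assms by (intro mult_right_mono) auto
    also have "\<dots> \<le> r" using assms by auto
    finally have "real (\<kappa> i) * (r / N) + r / N \<le> r" by (simp add: algebra_simps)
    moreover have "0 \<le> real (\<kappa> i) * (r / N)" using assms by simp
    moreover have "c $ i + real (\<kappa> i) * (r / N) \<le> x $ i" "x $ i \<le> c $ i + real (\<kappa> i) * (r / N) + r / N"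
      using x by (auto simp: subcube_def cube_def)
    ultimately show ?thesis by linarith
  qed
  then show "x \<in> cube c r" by (simp add: cube_def)
qed

lemma cube_eq_cbox: "cube c r = cbox c (\<chi> i. c $ i + r)"
  by (auto simp: cube_def mem_box_cart)

lemma ball_subset_cube: "ball x (r / 2) \<subseteq> cube (\<chi> i. x $ i - r / 2) r"
proof
  fix p assume "p \<in> ball x (r / 2)"
  then have "norm (p - x) < r / 2" by (simp add: dist_norm norm_minus_commute)
  then have "\<bar>(p - x) $ i\<bar> < r / 2" for i using component_le_norm_cart[of "p - x" i] by linarith
  then have *: "\<bar>p $ i - x $ i\<bar> < r / 2" for i by simp
  have "x $ i - r / 2 \<le> p $ i \<and> p $ i \<le> x $ i - r / 2 + r" for i using *[of i] by linarith
  then show "p \<in> cube (\<chi> i. x $ i - r / 2) r" by (simp add: cube_def)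
qed

lemma convex_cube: "convex (cube c r)"
  by (simp add: cube_eq_cbox convex_box)

lemma compact_cube: "compact (cube c r)"
  by (simp add: cube_eq_cbox)

lemma dist_cube_le:
  fixes x y :: "real^'n"
  assumes "x \<in> cube c r" "y \<in> cube c r" shows "dist x y \<le> real CARD('n) * r"
proof -
  have "norm (x - y) \<le> (\<Sum>i\<in>UNIV. \<bar>(x - y) $ i\<bar>)" by (rule norm_le_l1_cart)
  also have "\<dots> \<le> (\<Sum>i\<in>(UNIV::'n set). r)"
  proof (rule sum_mono)
    fix i
    have "c $ i \<le> x $ i \<and> x $ i \<le> c $ i + r" "c $ i \<le> y $ i \<and> y $ i \<le> c $ i + r"
      using assms by (auto simp: cube_def)
    then show "\<bar>(x - y) $ i\<bar> \<le> r" by (simp add: abs_le_iff)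
  qed
  finally show ?thesis by (simp add: dist_norm)
qed

text \<open>
Let $\theta |Q|$ bound the content of the part of $A$ in any sufficiently small subcube $Q$. If $A$
misses one of the $N^n$ pieces of $Q$, adding the bounds for the other pieces gives the bound
$(1 - N^{-n}) \theta |Q|$; otherwise the content is at most $\epsilon |Q|$ by assumption. Hence $\theta$ can be
replaced by $\max(\epsilon, (1 - N^{-n}) \theta)$, and after finitely many steps by $\epsilon$.
\<close>
lemma mixed_content_cube_null:
  fixes A :: "(real^'n) set"
  assumes q: "q > 0" and r0: "0 < r0"
    and bound: "\<And>c r. 0 < r \<Longrightarrow> cube c r \<subseteq> cube c0 r0 \<Longrightarrow>
        mixed_content \<mu> q f (A \<inter> cube c r) \<le> ennreal (K * r ^ CARD('n))"
    and step: "\<And>\<epsilon>. 0 < \<epsilon> \<Longrightarrow> \<exists>N\<ge>1. \<exists>t>0. \<forall>c r. 0 < r \<longrightarrow> r \<le> t \<longrightarrow> cube c r \<subseteq> cube c0 r0 \<longrightarrow>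
        (\<exists>\<kappa>\<in>grid N. A \<inter> subcube c r N \<kappa> = {}) \<or>
        mixed_content \<mu> q f (A \<inter> cube c r) \<le> ennreal (\<epsilon> * r ^ CARD('n))"
  shows "mixed_content \<mu> q f (A \<inter> cube c0 r0) = 0"
proof -
  let ?n = "CARD('n)"
  have "mixed_content \<mu> q f (A \<inter> cube c0 r0) \<le> 0 + ennreal e" if e: "0 < e" for e
  proof -
    define \<epsilon> where "\<epsilon> = e / r0 ^ ?n"
    have \<epsilon>: "0 < \<epsilon>" using e r0 by (simp add: \<epsilon>_def)
    obtain N t where N: "N \<ge> 1" and t: "t > 0" and
      alt: "\<And>c r. 0 < r \<Longrightarrow> r \<le> t \<Longrightarrow> cube c r \<subseteq> cube c0 r0 \<Longrightarrow>
        (\<exists>\<kappa>\<in>grid N. A \<inter> subcube c r N \<kappa> = {}) \<or>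
        mixed_content \<mu> q f (A \<inter> cube c r) \<le> ennreal (\<epsilon> * r ^ ?n)"
      using step[OF \<epsilon>] by blast
    define K' where "K' = max K 0"
    define \<eta> where "\<eta> = 1 - 1 / real N ^ ?n"
    have N1: "1 / real N ^ ?n \<le> 1" using N by (simp add: divide_le_eq)
    have \<eta>: "0 \<le> \<eta>" "\<eta> < 1" using N1 N by (auto simp: \<eta>_def)
    define P where "P \<theta> \<longleftrightarrow> (\<forall>c r. 0 < r \<longrightarrow> r \<le> t \<longrightarrow> cube c r \<subseteq> cube c0 r0 \<longrightarrow>
        mixed_content \<mu> q f (A \<inter> cube c r) \<le> ennreal (\<theta> * r ^ ?n))" for \<theta>
    have P_step: "P (max \<epsilon> (\<eta> * \<theta>))" if "P \<theta>" "0 \<le> \<theta>" for \<theta>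
      unfolding P_def
    proof (intro allI impI)
      fix c r assume r: "0 < r" "r \<le> t" and sub: "cube c r \<subseteq> cube c0 r0"
      consider (a) "mixed_content \<mu> q f (A \<inter> cube c r) \<le> ennreal (\<epsilon> * r ^ ?n)"
        | (b) \<kappa>0 where "\<kappa>0 \<in> grid N" "A \<inter> subcube c r N \<kappa>0 = {}" using alt[OF r sub] by blast
      then show "mixed_content \<mu> q f (A \<inter> cube c r) \<le> ennreal (max \<epsilon> (\<eta> * \<theta>) * r ^ ?n)"
      proof cases
        case a
        also have "ennreal (\<epsilon> * r ^ ?n) \<le> ennreal (max \<epsilon> (\<eta> * \<theta>) * r ^ ?n)"
          using r by (intro ennreal_leI mult_right_mono) auto
        finally show ?thesis .
      next
        case b
        let ?J = "grid N - {\<kappa>0}"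
        have fJ: "finite ?J" using finite_grid by blast
        have "A \<inter> cube c r \<subseteq> (\<Union>\<kappa>\<in>?J. A \<inter> subcube c r N \<kappa>)"
          using cube_subset_subcubes[OF N, of c r] b(2) by blast
        then have "mixed_content \<mu> q f (A \<inter> cube c r) \<le> mixed_content \<mu> q f (\<Union>\<kappa>\<in>?J. A \<inter> subcube c r N \<kappa>)"
          by (rule mixed_content_mono)
        also have "\<dots> \<le> (\<Sum>\<kappa>\<in>?J. mixed_content \<mu> q f (A \<inter> subcube c r N \<kappa>))"
          by (rule mixed_content_UN_finite_le[OF q fJ])
        also have "\<dots> \<le> (\<Sum>\<kappa>\<in>?J. ennreal (\<theta> * (r / N) ^ ?n))"
        proof (rule sum_mono)
          fix \<kappa> assume \<kappa>: "\<kappa> \<in> ?J"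
          have "r / N \<le> r" using r N by (simp add: divide_le_eq)
          then have "r / N \<le> t" using r by linarith
          moreover have "subcube c r N \<kappa> \<subseteq> cube c0 r0"
            using subcube_subset_cube[of \<kappa> N r c] \<kappa> r sub by auto
          ultimately show "mixed_content \<mu> q f (A \<inter> subcube c r N \<kappa>) \<le> ennreal (\<theta> * (r / N) ^ ?n)"
            using that(1) r N unfolding P_def subcube_def by auto
        qed
        also have "\<dots> = ennreal (real (N ^ ?n - 1) * (\<theta> * (r / N) ^ ?n))"
          using b(1) finite_grid[of N] by (simp add: card_grid ennreal_of_nat_eq_real_of_nat ennreal_mult'[symmetric])
        also have "real (N ^ ?n - 1) * (\<theta> * (r / N) ^ ?n) = \<eta> * \<theta> * r ^ ?n"
          using N by (simp add: \<eta>_def of_nat_diff power_divide field_simps)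
        also have "ennreal (\<eta> * \<theta> * r ^ ?n) \<le> ennreal (max \<epsilon> (\<eta> * \<theta>) * r ^ ?n)"
          using r by (intro ennreal_leI mult_right_mono) auto
        finally show ?thesis .
      qed
    qed
    have P_iter: "P (max \<epsilon> (\<eta> ^ j * K'))" for j
    proof (induction j)
      case 0
      have "mixed_content \<mu> q f (A \<inter> cube c r) \<le> ennreal (max \<epsilon> K' * r ^ ?n)"
        if "0 < r" "cube c r \<subseteq> cube c0 r0" for c r
        using bound[OF that] by (rule order_trans) (use that in \<open>auto simp: K'_def intro!: ennreal_leI mult_right_mono\<close>)
      then show ?case by (auto simp: P_def)
    next
      case (Suc j)
      have "P (max \<epsilon> (\<eta> * max \<epsilon> (\<eta> ^ j * K')))"
        using \<epsilon> by (intro P_step Suc) auto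
      moreover have "\<eta> * \<epsilon> \<le> \<epsilon>" using \<eta> \<epsilon> by (simp add: mult_le_cancel_right1)
      then have "max \<epsilon> (\<eta> * \<epsilon>) = \<epsilon>" by simp
      then have "max \<epsilon> (\<eta> * max \<epsilon> (\<eta> ^ j * K')) = max \<epsilon> (\<eta> ^ Suc j * K')"
        using \<eta> by (simp add: max_mult_distrib_left mult.assoc max.assoc[symmetric])
      ultimately show ?case by simp
    qed
    have "(\<lambda>j. \<eta> ^ j * K') \<longlonglongrightarrow> 0 * K'"
      using \<eta> by (intro tendsto_mult tendsto_const LIMSEQ_power_zero) auto
    then have "\<forall>\<^sub>F j in sequentially. \<eta> ^ j * K' < \<epsilon>"
      using \<epsilon> by (intro order_tendstoD(2)) auto
    then obtain j where "\<eta> ^ j * K' < \<epsilon>" unfolding eventually_sequentially by blast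
    then have Pe: "P \<epsilon>" using P_iter[of j] by (simp add: max_def split: if_splits)
    \<comment> \<open>the improved bound only holds for cubes of side at most \<open>t\<close>, so \<open>cube c0 r0\<close> has to be cut up\<close>
    define L where "L = max 1 (nat \<lceil>r0 / t\<rceil>)"
    have L: "r0 / t \<le> real L" "1 \<le> L" unfolding L_def by linarith+
    have Lt: "r0 / L \<le> t" using L t by (simp add: field_simps)
    have "A \<inter> cube c0 r0 \<subseteq> (\<Union>\<kappa>\<in>grid L. A \<inter> subcube c0 r0 L \<kappa>)"
      using cube_subset_subcubes[OF L(2), of c0 r0] by blast
    then have "mixed_content \<mu> q f (A \<inter> cube c0 r0) \<le> mixed_content \<mu> q f (\<Union>\<kappa>\<in>grid L. A \<inter> subcube c0 r0 L \<kappa>)"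
      by (rule mixed_content_mono)
    also have "\<dots> \<le> (\<Sum>\<kappa>\<in>grid L. mixed_content \<mu> q f (A \<inter> subcube c0 r0 L \<kappa>))"
      by (rule mixed_content_UN_finite_le[OF q finite_grid])
    also have "\<dots> \<le> (\<Sum>\<kappa>\<in>(grid L :: ('n \<Rightarrow> nat) set). ennreal (\<epsilon> * (r0 / L) ^ ?n))"
    proof (rule sum_mono)
      fix \<kappa> :: "'n \<Rightarrow> nat" assume "\<kappa> \<in> grid L"
      then have "subcube c0 r0 L \<kappa> \<subseteq> cube c0 r0"
        using subcube_subset_cube[of \<kappa> L r0 c0] r0 by auto
      then show "mixed_content \<mu> q f (A \<inter> subcube c0 r0 L \<kappa>) \<le> ennreal (\<epsilon> * (r0 / L) ^ ?n)"
        using Pe Lt r0 L unfolding P_def subcube_def by auto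
    qed
    also have "\<dots> = ennreal (real (L ^ ?n) * (\<epsilon> * (r0 / L) ^ ?n))"
      by (simp add: card_grid ennreal_of_nat_eq_real_of_nat ennreal_mult' ennreal_power)
    also have "real (L ^ ?n) * (\<epsilon> * (r0 / L) ^ ?n) = e"
      using L r0 by (simp add: \<epsilon>_def power_divide)
    finally show ?thesis by simp
  qed
  then have "mixed_content \<mu> q f (A \<inter> cube c0 r0) \<le> 0" by (rule ennreal_le_epsilon)
  then show ?thesis by simp
qed

section \<open>Local Hoelder classes\<close>

definition has_gradient :: "(real^'n \<Rightarrow> real) \<Rightarrow> ('n \<Rightarrow> real) \<Rightarrow> real^'n \<Rightarrow> bool" where
  "has_gradient g G x \<longleftrightarrow> (g has_derivative (\<lambda>h. \<Sum>i\<in>UNIV. h $ i * G i)) (at x)"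

text \<open>
Membership in the local class $C^{j,\alpha}$ on an open set, given by the existence of partial
derivatives in the class of order $j - 1$. Asking only for some family \<open>G\<close> on \<open>U\<close>, rather than fixing
a derivative operator, makes closure properties a matter of exhibiting a formula for the gradient.
For $\alpha = 0$ the Hoelder condition at the lowest level says no more than local boundedness.
\<close>
primrec C_loc :: "nat \<Rightarrow> real \<Rightarrow> (real^'n) set \<Rightarrow> (real^'n \<Rightarrow> real) \<Rightarrow> bool" where
  "C_loc 0 \<alpha> U g \<longleftrightarrow> continuous_on U g \<and>
     (\<forall>x\<in>U. \<exists>r>0. \<exists>L\<ge>0. \<forall>y\<in>ball x r \<inter> U. \<forall>z\<in>ball x r \<inter> U. \<bar>g y - g z\<bar> \<le> L * dist y z powr \<alpha>)"
| "C_loc (Suc j) \<alpha> U g \<longleftrightarrow>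
     (\<exists>G. (\<forall>x\<in>U. has_gradient g (\<lambda>i. G i x) x) \<and> (\<forall>i. C_loc j \<alpha> U (G i)))"

lemma C_loc_0E:
  assumes "C_loc 0 \<alpha> U g" "x \<in> U"
  obtains r L where "r > 0" "L \<ge> 0"
    "\<forall>y\<in>ball x r \<inter> U. \<forall>z\<in>ball x r \<inter> U. \<bar>g y - g z\<bar> \<le> L * dist y z powr \<alpha>"
  using assms unfolding C_loc.simps by meson

lemma C_loc_subset: "C_loc j \<alpha> U g \<Longrightarrow> V \<subseteq> U \<Longrightarrow> C_loc j \<alpha> V g"
proof (induction j arbitrary: g)
  case 0
  have "\<exists>r>0. \<exists>L\<ge>0. \<forall>y\<in>ball x r \<inter> V. \<forall>z\<in>ball x r \<inter> V. \<bar>g y - g z\<bar> \<le> L * dist y z powr \<alpha>"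
    if xU: "x \<in> V" for x
  proof -
    have "x \<in> U" using xU 0 by auto
    then obtain r L where "r > 0" "L \<ge> 0"
      "\<forall>y\<in>ball x r \<inter> U. \<forall>z\<in>ball x r \<inter> U. \<bar>g y - g z\<bar> \<le> L * dist y z powr \<alpha>"
      using 0(1) by auto
    then show ?thesis using 0(2) by (intro exI[of _ r] conjI exI[of _ L]) auto
  qed
  then show ?case using 0 by (auto intro: continuous_on_subset)
next
  case (Suc j)
  obtain G where "\<forall>x\<in>U. has_gradient g (\<lambda>i. G i x) x" "\<forall>i. C_loc j \<alpha> U (G i)"
    using Suc.prems by auto
  then show ?case unfolding C_loc.simps using Suc.prems(2) Suc.IH
    by (intro exI[of _ G]) blast
qed

lemma has_gradient_continuous: "has_gradient g G x \<Longrightarrow> continuous (at x) g"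
  unfolding has_gradient_def by (rule has_derivative_continuous)

lemma C_loc_continuous: "C_loc j \<alpha> U g \<Longrightarrow> continuous_on U g"
  by (cases j) (auto intro!: continuous_at_imp_continuous_on dest: has_gradient_continuous)

lemma has_gradient_norm_le:
  assumes "\<And>i. \<bar>G i\<bar> \<le> M"
  shows "\<bar>\<Sum>i\<in>UNIV. (h::real^'n) $ i * G i\<bar> \<le> real CARD('n) * M * norm h"
proof -
  have M: "0 \<le> M" using assms[of undefined] by linarith
  have "\<bar>\<Sum>i\<in>UNIV. h $ i * G i\<bar> \<le> (\<Sum>i\<in>UNIV. \<bar>h $ i * G i\<bar>)" by (rule sum_abs)
  also have "\<dots> \<le> (\<Sum>i\<in>(UNIV::'n set). norm h * M)"
    using assms M by (intro sum_mono) (auto simp: abs_mult intro!: mult_mono component_le_norm_cart)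
  finally show ?thesis by (simp add: mult_ac)
qed

lemma continuous_on_locally_bounded:
  fixes g :: "real^'n \<Rightarrow> real"
  assumes "continuous_on U g" "x \<in> U"
  shows "\<exists>r>0. \<exists>M>0. \<forall>y\<in>ball x r \<inter> U. \<bar>g y\<bar> \<le> M"
proof -
  obtain r where r: "r > 0" "\<And>y. y \<in> U \<Longrightarrow> dist y x < r \<Longrightarrow> dist (g y) (g x) < 1"
    using assms unfolding continuous_on_iff by (metis zero_less_one)
  have "\<bar>g y\<bar> \<le> \<bar>g x\<bar> + 1" if "y \<in> ball x r \<inter> U" for y
    using r(2)[of y] that by (auto simp: dist_commute dist_real_def)
  then show ?thesis using r(1) by (intro exI[of _ r] conjI exI[of _ "\<bar>g x\<bar> + 1"]) auto
qed

lemma C_loc_Suc_locally_lipschitz: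
  assumes U: "open U" and g: "C_loc (Suc j) \<alpha> U g" and x: "x \<in> U"
  shows "\<exists>r>0. ball x r \<subseteq> U \<and> (\<exists>K\<ge>0. \<forall>y\<in>ball x r. \<forall>z\<in>ball x r. \<bar>g y - g z\<bar> \<le> K * dist y z)"
proof -
  obtain G where G: "\<forall>x\<in>U. has_gradient g (\<lambda>i. G i x) x" "\<forall>i. C_loc j \<alpha> U (G i)"
    using g by auto
  have "\<forall>i. \<exists>r>0. \<exists>M>0. \<forall>y\<in>ball x r \<inter> U. \<bar>G i y\<bar> \<le> M"
    using G(2) x by (blast intro: continuous_on_locally_bounded C_loc_continuous)
  then obtain \<rho> M where \<rho>: "\<And>i. \<rho> i > 0" and M: "\<And>i y. y \<in> ball x (\<rho> i) \<inter> U \<Longrightarrow> \<bar>G i y\<bar> \<le> M i"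
    by metis
  obtain r0 where r0: "r0 > 0" "ball x r0 \<subseteq> U" using U x open_contains_ball by blast
  define r where "r = Min (insert r0 (range \<rho>))"
  have r: "r > 0" "r \<le> r0" "\<And>i. r \<le> \<rho> i" using r0 \<rho> by (auto simp: r_def intro!: min.coboundedI2)
  define B where "B = Max (range M)"
  have B: "\<bar>G i y\<bar> \<le> B" if "y \<in> ball x r" for i y
  proof -
    have "\<bar>G i y\<bar> \<le> M i" using that r(2) r(3)[of i] r0 by (intro M) auto
    also have "\<dots> \<le> B" by (simp add: B_def)
    finally show ?thesis .
  qed
  have "\<bar>g y - g z\<bar> \<le> (real CARD('a) * B) * dist y z" if "y \<in> ball x r" "z \<in> ball x r" for y z
  proof -
    have "norm (g y - g z) \<le> (real CARD('a) * B) * norm (y - z)"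
    proof (rule differentiable_bound)
      show "convex (ball x r)" by simp
      fix w assume w: "w \<in> ball x r"
      then have "w \<in> U" using r r0 by auto
      then show "(g has_derivative (\<lambda>h. \<Sum>i\<in>UNIV. h $ i * G i w)) (at w within ball x r)"
        using G(1) unfolding has_gradient_def by (blast intro: has_derivative_at_withinI)
      show "onorm (\<lambda>h. \<Sum>i\<in>UNIV. h $ i * G i w) \<le> real CARD('a) * B"
        using has_gradient_norm_le[of "\<lambda>i. G i w" B] B[OF w] by (intro onorm_le) auto
    qed (use that in auto)
    then show ?thesis by (simp add: dist_norm)
  qed
  moreover have "0 \<le> real CARD('a) * B"
    using B[of x undefined] r by (intro mult_nonneg_nonneg) auto
  moreover have "ball x r \<subseteq> U" using r r0 by auto
  ultimately have "0 < r \<and> ball x r \<subseteq> U \<and> 0 \<le> real CARD('a) * B \<and>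
      (\<forall>y\<in>ball x r. \<forall>z\<in>ball x r. \<bar>g y - g z\<bar> \<le> real CARD('a) * B * dist y z)"
    using r by blast
  then show ?thesis by blast
qed

lemma le_powr_of_le_one:
  fixes d :: real assumes "0 \<le> d" "d \<le> 1" "\<alpha> \<le> 1" shows "d \<le> d powr \<alpha>"
proof (cases "d = 0")
  case False then show ?thesis using assms powr_mono'[of \<alpha> 1 d] by simp
qed simp

text \<open>
The class decreases with $j$: at the lowest level, local Lipschitz continuity implies local Hoelder
continuity because the exponent is at most $1$ and distances can be taken to be at most $1$.
\<close>
lemma C_loc_SucD:
  assumes U: "open U" and \<alpha>: "\<alpha> \<le> 1"
  shows "C_loc (Suc j) \<alpha> U g \<Longrightarrow> C_loc j \<alpha> U g"
proof (induction j arbitrary: g)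
  case 0
  have "\<exists>r>0. \<exists>L\<ge>0. \<forall>y\<in>ball x r \<inter> U. \<forall>z\<in>ball x r \<inter> U. \<bar>g y - g z\<bar> \<le> L * dist y z powr \<alpha>"
    if xU: "x \<in> U" for x
  proof -
    obtain r K where r: "r > 0" "ball x r \<subseteq> U" "K \<ge> 0"
      and K: "\<forall>y\<in>ball x r. \<forall>z\<in>ball x r. \<bar>g y - g z\<bar> \<le> K * dist y z"
      using C_loc_Suc_locally_lipschitz[OF U 0 xU] by blast
    have "\<bar>g y - g z\<bar> \<le> K * dist y z powr \<alpha>"
      if "y \<in> ball x (min r (1/2)) \<inter> U" "z \<in> ball x (min r (1/2)) \<inter> U" for y z
    proof -
      have "dist y z \<le> 1" using that dist_triangle[of y z x] by (auto simp: dist_commute)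
      then have "dist y z \<le> dist y z powr \<alpha>" using \<alpha> by (intro le_powr_of_le_one) auto
      then have "K * dist y z \<le> K * dist y z powr \<alpha>" using r by (intro mult_left_mono) auto
      moreover have "\<bar>g y - g z\<bar> \<le> K * dist y z" using K that by auto
      ultimately show ?thesis by linarith
    qed
    then show ?thesis using r by (intro exI[of _ "min r (1/2)"] conjI exI[of _ K]) auto
  qed
  then show ?case using C_loc_continuous[OF 0] by simp
next
  case (Suc j)
  then obtain G where "\<forall>x\<in>U. has_gradient g (\<lambda>i. G i x) x" "\<forall>i. C_loc (Suc j) \<alpha> U (G i)"
    by (subst (asm) C_loc.simps(2)) auto
  then show ?case using Suc.IH by (subst C_loc.simps(2)) blast
qed

lemma C_loc_le:
  assumes "open U" "\<alpha> \<le> 1" "i \<le> j" "C_loc j \<alpha> U g" shows "C_loc i \<alpha> U g"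
  using assms(3,4) by (induction rule: inc_induct) (auto intro: C_loc_SucD[OF assms(1,2)] simp del: C_loc.simps)

lemma has_gradient_const: "has_gradient (\<lambda>_. c) (\<lambda>_. 0) x"
  by (simp add: has_gradient_def)

lemma has_gradient_add:
  assumes "has_gradient g G x" "has_gradient h H x"
  shows "has_gradient (\<lambda>x. g x + h x) (\<lambda>i. G i + H i) x"
  using has_derivative_add[OF assms[unfolded has_gradient_def]]
  by (simp add: has_gradient_def distrib_left sum.distrib)

lemma has_gradient_mult:
  assumes "has_gradient g G x" "has_gradient h H x"
  shows "has_gradient (\<lambda>x. g x * h x) (\<lambda>i. g x * H i + G i * h x) x"
  using has_derivative_mult[OF assms[unfolded has_gradient_def]]
  by (simp add: has_gradient_def distrib_left sum.distrib sum_distrib_left sum_distrib_right mult_ac)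

lemma has_gradient_inverse:
  assumes "has_gradient g G x" "g x \<noteq> 0"
  shows "has_gradient (\<lambda>x. inverse (g x)) (\<lambda>i. - 1 * G i * (inverse (g x) * inverse (g x))) x"
proof -
  have "((\<lambda>x. inverse (g x)) has_derivative
     (\<lambda>h. - (inverse (g x) * (\<Sum>i\<in>UNIV. h $ i * G i) * inverse (g x)))) (at x)"
    using assms unfolding has_gradient_def by (intro Deriv.has_derivative_inverse)
  then show ?thesis
    by (simp add: has_gradient_def sum_distrib_left sum_distrib_right sum_negf[symmetric] mult_ac)
qed

lemma C_loc_const: "0 \<le> \<alpha> \<Longrightarrow> C_loc j \<alpha> U (\<lambda>_. c)"
proof (induction j arbitrary: c)
  case 0 then show ?case by (auto intro!: exI[of _ "1::real"])
next
  case (Suc j)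
  show ?case unfolding C_loc.simps
    by (rule exI[of _ "\<lambda>_ _. 0"]) (use Suc in \<open>simp add: has_gradient_const\<close>)
qed

lemma C_loc_add:
  "C_loc j \<alpha> U g \<Longrightarrow> C_loc j \<alpha> U h \<Longrightarrow> C_loc j \<alpha> U (\<lambda>x. g x + h x)"
proof (induction j arbitrary: g h)
  case 0
  have "\<exists>r>0. \<exists>L\<ge>0. \<forall>y\<in>ball x r \<inter> U. \<forall>z\<in>ball x r \<inter> U.
      \<bar>g y + h y - (g z + h z)\<bar> \<le> L * dist y z powr \<alpha>" if xU: "x \<in> U" for x
  proof -
    obtain r1 L1 where 1: "r1 > 0" "L1 \<ge> 0"
      "\<forall>y\<in>ball x r1 \<inter> U. \<forall>z\<in>ball x r1 \<inter> U. \<bar>g y - g z\<bar> \<le> L1 * dist y z powr \<alpha>"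
      using 0(1) xU by (rule C_loc_0E)
    obtain r2 L2 where 2: "r2 > 0" "L2 \<ge> 0"
      "\<forall>y\<in>ball x r2 \<inter> U. \<forall>z\<in>ball x r2 \<inter> U. \<bar>h y - h z\<bar> \<le> L2 * dist y z powr \<alpha>"
      using 0(2) xU by (rule C_loc_0E)
    have "\<bar>g y + h y - (g z + h z)\<bar> \<le> (L1 + L2) * dist y z powr \<alpha>"
      if "y \<in> ball x (min r1 r2) \<inter> U" "z \<in> ball x (min r1 r2) \<inter> U" for y z
    proof -
      have "\<bar>g y - g z\<bar> \<le> L1 * dist y z powr \<alpha>" "\<bar>h y - h z\<bar> \<le> L2 * dist y z powr \<alpha>"
        using that 1(3) 2(3) by auto
      then show ?thesis by (simp add: distrib_right)
    qed
    then show ?thesis using 1 2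
      by (intro exI[of _ "min r1 r2"] conjI exI[of _ "L1 + L2"]) auto
  qed
  then show ?case using 0 by (simp add: continuous_on_add)
next
  case (Suc j)
  obtain G H where "\<forall>x\<in>U. has_gradient g (\<lambda>i. G i x) x" "\<forall>i. C_loc j \<alpha> U (G i)"
    "\<forall>x\<in>U. has_gradient h (\<lambda>i. H i x) x" "\<forall>i. C_loc j \<alpha> U (H i)"
    using Suc.prems by auto
  then show ?case unfolding C_loc.simps
    by (intro exI[of _ "\<lambda>i x. G i x + H i x"]) (auto intro: has_gradient_add Suc.IH)
qed

text \<open>
The product rule involves the functions themselves besides their derivatives, so the
induction uses that the class of order $j + 1$ is contained in that of order $j$.
\<close>
lemma C_loc_mult:
  assumes U: "open U" and \<alpha>: "\<alpha> \<le> 1"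
  shows "C_loc j \<alpha> U g \<Longrightarrow> C_loc j \<alpha> U h \<Longrightarrow> C_loc j \<alpha> U (\<lambda>x. g x * h x)"
proof (induction j arbitrary: g h)
  case 0
  have "\<exists>r>0. \<exists>L\<ge>0. \<forall>y\<in>ball x r \<inter> U. \<forall>z\<in>ball x r \<inter> U.
      \<bar>g y * h y - g z * h z\<bar> \<le> L * dist y z powr \<alpha>" if xU: "x \<in> U" for x
  proof -
    obtain r1 L1 where 1: "r1 > 0" "L1 \<ge> 0"
      "\<forall>y\<in>ball x r1 \<inter> U. \<forall>z\<in>ball x r1 \<inter> U. \<bar>g y - g z\<bar> \<le> L1 * dist y z powr \<alpha>"
      using 0(1) xU by (rule C_loc_0E)
    obtain r2 L2 where 2: "r2 > 0" "L2 \<ge> 0"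
      "\<forall>y\<in>ball x r2 \<inter> U. \<forall>z\<in>ball x r2 \<inter> U. \<bar>h y - h z\<bar> \<le> L2 * dist y z powr \<alpha>"
      using 0(2) xU by (rule C_loc_0E)
    obtain r3 M where 3: "r3 > 0" "M > 0" "\<forall>y\<in>ball x r3 \<inter> U. \<bar>g y\<bar> \<le> M"
      using 0(1) xU continuous_on_locally_bounded[of U g x] by auto
    obtain r4 N where 4: "r4 > 0" "N > 0" "\<forall>y\<in>ball x r4 \<inter> U. \<bar>h y\<bar> \<le> N"
      using 0(2) xU continuous_on_locally_bounded[of U h x] by auto
    define r where "r = min (min r1 r2) (min r3 r4)"
    have "\<bar>g y * h y - g z * h z\<bar> \<le> (M * L2 + N * L1) * dist y z powr \<alpha>"
      if "y \<in> ball x r \<inter> U" "z \<in> ball x r \<inter> U" for y z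
    proof -
      have a: "\<bar>g y - g z\<bar> \<le> L1 * dist y z powr \<alpha>" "\<bar>h y - h z\<bar> \<le> L2 * dist y z powr \<alpha>"
        "\<bar>g y\<bar> \<le> M" "\<bar>h z\<bar> \<le> N"
        using that 1(3) 2(3) 3(3) 4(3) by (auto simp: r_def)
      have "g y * h y - g z * h z = g y * (h y - h z) + h z * (g y - g z)" by (simp add: algebra_simps)
      then have "\<bar>g y * h y - g z * h z\<bar> \<le> \<bar>g y\<bar> * \<bar>h y - h z\<bar> + \<bar>h z\<bar> * \<bar>g y - g z\<bar>"
        by (metis abs_mult abs_triangle_ineq)
      also have "\<dots> \<le> M * (L2 * dist y z powr \<alpha>) + N * (L1 * dist y z powr \<alpha>)"
        using a 3(2) 4(2) by (intro add_mono mult_mono) auto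
      finally show ?thesis by (simp add: algebra_simps)
    qed
    moreover have "r > 0" "0 \<le> M * L2 + N * L1" using 1 2 3 4 by (auto simp: r_def)
    ultimately show ?thesis by (intro exI[of _ r] conjI exI[of _ "M * L2 + N * L1"]) auto
  qed
  then show ?case using 0 by (simp add: continuous_on_mult)
next
  case (Suc j)
  obtain G where G: "\<forall>x\<in>U. has_gradient g (\<lambda>i. G i x) x" "\<forall>i. C_loc j \<alpha> U (G i)"
    using Suc.prems by auto
  obtain H where H: "\<forall>x\<in>U. has_gradient h (\<lambda>i. H i x) x" "\<forall>i. C_loc j \<alpha> U (H i)"
    using Suc.prems by auto
  have "C_loc j \<alpha> U g" "C_loc j \<alpha> U h" using Suc.prems C_loc_SucD[OF U \<alpha>] by blast+
  then have "\<forall>i. C_loc j \<alpha> U (\<lambda>x. g x * H i x + G i x * h x)"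
    using G(2) H(2) by (intro allI C_loc_add Suc.IH) auto
  moreover have "\<forall>x\<in>U. has_gradient (\<lambda>x. g x * h x) (\<lambda>i. g x * H i x + G i x * h x) x"
    using G(1) H(1) by (intro ballI has_gradient_mult) auto
  ultimately show ?case unfolding C_loc.simps
    by (intro exI[of _ "\<lambda>i x. g x * H i x + G i x * h x"] conjI)
qed

lemma C_loc_inverse:
  assumes U: "open U" and \<alpha>: "0 \<le> \<alpha>" "\<alpha> \<le> 1"
  shows "C_loc j \<alpha> U g \<Longrightarrow> (\<And>x. x \<in> U \<Longrightarrow> g x \<noteq> 0) \<Longrightarrow> C_loc j \<alpha> U (\<lambda>x. inverse (g x))"
proof (induction j)
  case 0
  have cont: "continuous_on U (\<lambda>x. inverse (g x))"
    using 0 by (intro continuous_on_inverse) auto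
  have "\<exists>r>0. \<exists>L\<ge>0. \<forall>y\<in>ball x r \<inter> U. \<forall>z\<in>ball x r \<inter> U.
      \<bar>inverse (g y) - inverse (g z)\<bar> \<le> L * dist y z powr \<alpha>" if xU: "x \<in> U" for x
  proof -
    obtain r1 L1 where 1: "r1 > 0" "L1 \<ge> 0"
      "\<forall>y\<in>ball x r1 \<inter> U. \<forall>z\<in>ball x r1 \<inter> U. \<bar>g y - g z\<bar> \<le> L1 * dist y z powr \<alpha>"
      using 0(1) xU by (rule C_loc_0E)
    obtain r3 M where 3: "r3 > 0" "M > 0" "\<forall>y\<in>ball x r3 \<inter> U. \<bar>inverse (g y)\<bar> \<le> M"
      using continuous_on_locally_bounded[OF cont xU] by auto
    have "\<bar>inverse (g y) - inverse (g z)\<bar> \<le> (M * M * L1) * dist y z powr \<alpha>"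
      if "y \<in> ball x (min r1 r3) \<inter> U" "z \<in> ball x (min r1 r3) \<inter> U" for y z
    proof -
      have a: "\<bar>g y - g z\<bar> \<le> L1 * dist y z powr \<alpha>" "\<bar>inverse (g y)\<bar> \<le> M" "\<bar>inverse (g z)\<bar> \<le> M"
        using that 1(3) 3(3) by auto
      have nz: "g y \<noteq> 0" "g z \<noteq> 0" using that 0 by auto
      have "\<bar>inverse (g y) - inverse (g z)\<bar> = \<bar>inverse (g y)\<bar> * \<bar>inverse (g z)\<bar> * \<bar>g y - g z\<bar>"
        using nz by (simp add: inverse_diff_inverse abs_mult)
      also have "\<dots> \<le> M * M * (L1 * dist y z powr \<alpha>)"
        using a 3(2) by (intro mult_mono) auto
      finally show ?thesis by (simp add: algebra_simps)
    qed
    then show ?thesis using 1 3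
      by (intro exI[of _ "min r1 r3"] conjI exI[of _ "M * M * L1"]) auto
  qed
  then show ?case using cont by simp
next
  case (Suc j)
  obtain G where G: "\<forall>x\<in>U. has_gradient g (\<lambda>i. G i x) x" "\<forall>i. C_loc j \<alpha> U (G i)"
    using Suc.prems by auto
  have inv: "C_loc j \<alpha> U (\<lambda>x. inverse (g x))"
    using Suc.prems C_loc_SucD[OF U \<alpha>(2)] by (intro Suc.IH) auto
  have "\<forall>i. C_loc j \<alpha> U (\<lambda>x. - 1 * G i x * (inverse (g x) * inverse (g x)))"
    using G(2) inv by (intro allI C_loc_mult[OF U \<alpha>(2)] C_loc_const[OF \<alpha>(1)]) auto
  moreover have "\<forall>x\<in>U. has_gradient (\<lambda>x. inverse (g x)) (\<lambda>i. - 1 * G i x * (inverse (g x) * inverse (g x))) x"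
    using G(1) Suc.prems(2) by (intro ballI has_gradient_inverse) auto
  ultimately show ?case unfolding C_loc.simps
    by (intro exI[of _ "\<lambda>i x. - 1 * G i x * (inverse (g x) * inverse (g x))"] conjI)
qed

lemma C_loc_divide:
  assumes "open U" "0 \<le> \<alpha>" "\<alpha> \<le> 1" "C_loc j \<alpha> U g" "C_loc j \<alpha> U h" "\<And>x. x \<in> U \<Longrightarrow> h x \<noteq> 0"
  shows "C_loc j \<alpha> U (\<lambda>x. g x / h x)"
  unfolding divide_inverse using assms by (intro C_loc_mult C_loc_inverse) auto

lemma C_loc_diff:
  assumes "open U" "0 \<le> \<alpha>" "\<alpha> \<le> 1" "C_loc j \<alpha> U g" "C_loc j \<alpha> U h"
  shows "C_loc j \<alpha> U (\<lambda>x. g x - h x)"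
proof -
  have "C_loc j \<alpha> U (\<lambda>x. g x + (-1) * h x)"
    using assms by (intro C_loc_add C_loc_mult C_loc_const) auto
  then show ?thesis by simp
qed

lemma uniform_local_holder:
  assumes "finite S" "\<And>g. g \<in> S \<Longrightarrow> C_loc 0 \<alpha> U g" "x \<in> U"
  shows "\<exists>r>0. \<exists>L\<ge>0. \<forall>g\<in>S. \<forall>y\<in>ball x r \<inter> U. \<forall>z\<in>ball x r \<inter> U. \<bar>g y - g z\<bar> \<le> L * dist y z powr \<alpha>"
  using assms(1,2)
proof (induction S)
  case empty then show ?case by (auto intro!: exI[of _ "1::real"])
next
  case (insert g S)
  obtain r1 L1 where 1: "r1 > 0" "L1 \<ge> 0"
    "\<forall>g\<in>S. \<forall>y\<in>ball x r1 \<inter> U. \<forall>z\<in>ball x r1 \<inter> U. \<bar>g y - g z\<bar> \<le> L1 * dist y z powr \<alpha>"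
    using insert by auto
  have "C_loc 0 \<alpha> U g" using insert by auto
  then obtain r2 L2 where 2: "r2 > 0" "L2 \<ge> 0"
    "\<forall>y\<in>ball x r2 \<inter> U. \<forall>z\<in>ball x r2 \<inter> U. \<bar>g y - g z\<bar> \<le> L2 * dist y z powr \<alpha>"
    using assms(3) by (rule C_loc_0E)
  define r L where "r = min r1 r2" and "L = max L1 L2"
  have rL: "r > 0" "r \<le> r1" "r \<le> r2" "L \<ge> 0" "L1 \<le> L" "L2 \<le> L" using 1 2 by (auto simp: r_def L_def)
  have "\<bar>g' y - g' z\<bar> \<le> L * dist y z powr \<alpha>"
    if "g' \<in> insert g S" "y \<in> ball x r \<inter> U" "z \<in> ball x r \<inter> U" for g' y z
  proof (cases "g' = g")
    case True
    have "\<bar>g' y - g' z\<bar> \<le> L2 * dist y z powr \<alpha>" using 2(3) that rL True by auto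
    also have "\<dots> \<le> L * dist y z powr \<alpha>" using rL by (intro mult_right_mono) auto
    finally show ?thesis .
  next
    case False
    have "\<bar>g' y - g' z\<bar> \<le> L1 * dist y z powr \<alpha>" using 1(3) that rL False by auto
    also have "\<dots> \<le> L * dist y z powr \<alpha>" using rL by (intro mult_right_mono) auto
    finally show ?thesis .
  qed
  then show ?case using rL by blast
qed

definition locally_lipschitz :: "'a::metric_space set \<Rightarrow> ('a \<Rightarrow> 'b::metric_space) \<Rightarrow> bool" where
  "locally_lipschitz U f \<longleftrightarrow>
     (\<forall>x\<in>U. \<exists>r>0. \<exists>K\<ge>0. \<forall>y\<in>ball x r \<inter> U. \<forall>z\<in>ball x r \<inter> U. dist (f y) (f z) \<le> K * dist y z)"

lemma locally_lipschitzE: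
  assumes "locally_lipschitz U f" "x \<in> U"
  obtains r K where "r > 0" "K \<ge> 0"
    "\<And>y z. y \<in> ball x r \<inter> U \<Longrightarrow> z \<in> ball x r \<inter> U \<Longrightarrow> dist (f y) (f z) \<le> K * dist y z"
  using assms unfolding locally_lipschitz_def by meson

lemma locally_lipschitz_compose:
  assumes f: "locally_lipschitz U f" and \<Psi>: "\<And>y. y \<in> V \<Longrightarrow> \<Psi> y \<in> U" and K: "K > 0"
    and lip: "\<And>y z. y \<in> V \<Longrightarrow> z \<in> V \<Longrightarrow> dist (\<Psi> y) (\<Psi> z) \<le> K * dist y z"
  shows "locally_lipschitz V (f \<circ> \<Psi>)"
  unfolding locally_lipschitz_def
proof
  fix x assume x: "x \<in> V"
  obtain r L where r: "r > 0" "L \<ge> 0"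
    and L: "\<And>y z. y \<in> ball (\<Psi> x) r \<inter> U \<Longrightarrow> z \<in> ball (\<Psi> x) r \<inter> U \<Longrightarrow> dist (f y) (f z) \<le> L * dist y z"
    using f \<Psi>[OF x] by (rule locally_lipschitzE) (rule that, assumption+)
  have "dist ((f \<circ> \<Psi>) y) ((f \<circ> \<Psi>) z) \<le> (L * K) * dist y z"
    if y: "y \<in> ball x (r / K) \<inter> V" and z: "z \<in> ball x (r / K) \<inter> V" for y z
  proof -
    have "\<Psi> w \<in> ball (\<Psi> x) r \<inter> U" if "w \<in> ball x (r / K) \<inter> V" for w
    proof -
      have "dist (\<Psi> x) (\<Psi> w) \<le> K * dist x w" using lip x that by auto
      also have "\<dots> < r" using that K by (auto simp: field_simps)
      finally show ?thesis using that \<Psi> by auto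
    qed
    then have "dist (f (\<Psi> y)) (f (\<Psi> z)) \<le> L * dist (\<Psi> y) (\<Psi> z)" using L y z by blast
    also have "\<dots> \<le> L * (K * dist y z)" using lip y z r by (intro mult_left_mono) auto
    finally show ?thesis by simp
  qed
  moreover have "r / K > 0" "0 \<le> L * K" using r K by auto
  ultimately show "\<exists>r>0. \<exists>K\<ge>0. \<forall>y\<in>ball x r \<inter> V. \<forall>z\<in>ball x r \<inter> V. dist ((f \<circ> \<Psi>) y) ((f \<circ> \<Psi>) z) \<le> K * dist y z"
    by blast
qed

lemma locally_lipschitz_of_C_loc:
  fixes f :: "real^'n \<Rightarrow> real^'d"
  assumes U: "open U" and f: "\<And>c. C_loc (Suc j) \<alpha> U (\<lambda>x. f x $ c)"
  shows "locally_lipschitz U f"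
  unfolding locally_lipschitz_def
proof
  fix x assume x: "x \<in> U"
  have "\<forall>c. \<exists>r K. r > 0 \<and> K \<ge> 0 \<and> (\<forall>y\<in>ball x r. \<forall>z\<in>ball x r. \<bar>f y $ c - f z $ c\<bar> \<le> K * dist y z)"
    using C_loc_Suc_locally_lipschitz[OF U f x] by blast
  then obtain r K where r: "\<And>c. r c > 0" and K: "\<And>c. K c \<ge> 0"
    "\<And>c y z. y \<in> ball x (r c) \<Longrightarrow> z \<in> ball x (r c) \<Longrightarrow> \<bar>f y $ c - f z $ c\<bar> \<le> K c * dist y z"
    unfolding choice_iff by blast
  have "dist (f y) (f z) \<le> (\<Sum>c\<in>UNIV. K c) * dist y z"
    if "y \<in> ball x (Min (range r)) \<inter> U" "z \<in> ball x (Min (range r)) \<inter> U" for y z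
  proof -
    have "dist (f y) (f z) \<le> (\<Sum>c\<in>UNIV. \<bar>f y $ c - f z $ c\<bar>)" by (rule dist_vec_le_sum)
    also have "\<dots> \<le> (\<Sum>c\<in>UNIV. K c * dist y z)"
    proof (intro sum_mono K(2))
      fix c
      have "Min (range r) \<le> r c" by simp
      then show "y \<in> ball x (r c)" "z \<in> ball x (r c)" using that by auto
    qed
    finally show ?thesis by (simp add: sum_distrib_right)
  qed
  moreover have "Min (range r) > 0" "(\<Sum>c\<in>UNIV. K c) \<ge> 0" using r K by (auto intro: sum_nonneg)
  ultimately show "\<exists>r>0. \<exists>K\<ge>0. \<forall>y\<in>ball x r \<inter> U. \<forall>z\<in>ball x r \<inter> U. dist (f y) (f z) \<le> K * dist y z"
    by blast
qed

section \<open>Straightening one coordinate\<close>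

text \<open>
The candidate for a change of coordinates in which the function $h$ becomes the $a$-th coordinate.
Exchanging a single coordinate at a time keeps the derivatives of the map and of its inverse explicit.
\<close>
definition straighten :: "'n \<Rightarrow> (real^'n \<Rightarrow> real) \<Rightarrow> real^'n \<Rightarrow> real^'n" where
  "straighten a h x = x + (h x - x $ a) *\<^sub>R axis a 1"

lemma straighten_nth: "straighten a h x $ i = (if i = a then h x else x $ i)"
  by (simp add: straighten_def axis_def)

lemma sum_nth_add_axis:
  "(\<Sum>i\<in>UNIV. (k + t *\<^sub>R axis a 1 :: real^'n) $ i * d i) = (\<Sum>i\<in>UNIV. k $ i * d i) + t * d a"
  by (simp add: distrib_right sum.distrib axis_def if_distrib[where f = "\<lambda>x. _ * x * _"] cong: if_cong)

definition straighten_deriv :: "'n \<Rightarrow> ('n \<Rightarrow> real) \<Rightarrow> real^'n \<Rightarrow> real^'n" where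
  "straighten_deriv a d k = k + ((\<Sum>i\<in>UNIV. k $ i * d i) - k $ a) *\<^sub>R axis a 1"

text \<open>
The inverse of \<open>straighten_deriv\<close>: it moves along the $a$-th axis until the derivative of $h$ in
direction $k$, rather than the $a$-th component, has the prescribed value.
\<close>
definition unstraighten_deriv :: "'n \<Rightarrow> ('n \<Rightarrow> real) \<Rightarrow> real^'n \<Rightarrow> real^'n" where
  "unstraighten_deriv a d k = k + ((k $ a - (\<Sum>i\<in>UNIV. k $ i * d i)) / d a) *\<^sub>R axis a 1"

lemma straighten_deriv_inverse:
  assumes "d a \<noteq> 0"
  shows "straighten_deriv a d (unstraighten_deriv a d k) = k"
    and "unstraighten_deriv a d (straighten_deriv a d k) = k"
  using assms unfolding straighten_deriv_def unstraighten_deriv_def sum_nth_add_axis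
  by (simp_all add: vec_eq_iff axis_def)

lemma bounded_linear_straighten_deriv: "bounded_linear (straighten_deriv a d)"
  unfolding straighten_deriv_def
  by (intro bounded_linear_intros bounded_linear_ident bounded_linear_scaleR_const bounded_linear_sum
      bounded_linear_mult_const bounded_linear_sub bounded_linear_add bounded_linear_vec_nth)

lemma bounded_linear_unstraighten_deriv: "bounded_linear (unstraighten_deriv a d)"
  unfolding unstraighten_deriv_def divide_inverse
  by (intro bounded_linear_intros bounded_linear_ident bounded_linear_scaleR_const bounded_linear_sum
      bounded_linear_mult_const bounded_linear_sub bounded_linear_add bounded_linear_vec_nth)

lemma has_derivative_straighten:
  assumes "has_gradient h d x"
  shows "(straighten a h has_derivative straighten_deriv a d) (at x)"
proof -
  have "((\<lambda>x. x + (h x - x $ a) *\<^sub>R axis a 1) has_derivative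
    (\<lambda>k. k + ((\<Sum>i\<in>UNIV. k $ i * d i) - k $ a) *\<^sub>R axis a 1)) (at x)"
    using assms unfolding has_gradient_def
    by (auto intro!: derivative_eq_intros bounded_linear_imp_has_derivative[OF bounded_linear_vec_nth])
  then show ?thesis by (simp add: straighten_def[abs_def] straighten_deriv_def[abs_def])
qed

text \<open>
Here $d$ is the gradient of the function that has become the coordinate $a$. In the new coordinates
a partial derivative in direction $b \neq a$ is taken along the level sets of this function, which
subtracts a multiple of the old derivative in direction $a$.
\<close>
lemma has_gradient_compose:
  assumes g: "has_gradient g G (\<Psi> y)"
    and \<Psi>: "(\<Psi> has_derivative unstraighten_deriv a d) (at y)" and nz: "d a \<noteq> 0"
  shows "has_gradient (\<lambda>y. g (\<Psi> y)) (\<lambda>b. if b = a then G a / d a else G b - G a * (d b / d a)) y"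
proof -
  have "((\<lambda>y. g (\<Psi> y)) has_derivative (\<lambda>k. \<Sum>i\<in>UNIV. unstraighten_deriv a d k $ i * G i)) (at y)"
    using has_derivative_compose[OF \<Psi> g[unfolded has_gradient_def]] by simp
  also have "(\<lambda>k. \<Sum>i\<in>UNIV. unstraighten_deriv a d k $ i * G i) =
     (\<lambda>k. \<Sum>b\<in>UNIV. k $ b * (if b = a then G a / d a else G b - G a * (d b / d a)))"
  proof
    fix k :: "real^'a"
    have split: "(\<Sum>i\<in>UNIV. F i) = F a + (\<Sum>i\<in>UNIV - {a}. F i)" for F :: "'a \<Rightarrow> real"
      by (rule sum.remove) auto
    have "(\<Sum>i\<in>UNIV. unstraighten_deriv a d k $ i * G i)
        = (\<Sum>i\<in>UNIV. k $ i * G i) + (k $ a - (\<Sum>i\<in>UNIV. k $ i * d i)) / d a * G a"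
      unfolding unstraighten_deriv_def by (rule sum_nth_add_axis)
    also have "\<dots> = (\<Sum>i\<in>UNIV - {a}. k $ i * G i) - (\<Sum>i\<in>UNIV - {a}. k $ i * d i) / d a * G a
        + k $ a * (G a / d a)"
    proof -
      have "(\<Sum>i\<in>UNIV. k $ i * G i) = k $ a * G a + (\<Sum>i\<in>UNIV - {a}. k $ i * G i)"
        "(\<Sum>i\<in>UNIV. k $ i * d i) = k $ a * d a + (\<Sum>i\<in>UNIV - {a}. k $ i * d i)"
        by (rule split)+
      then show ?thesis using nz by (simp add: field_simps)
    qed
    also have "\<dots> = (\<Sum>b\<in>UNIV - {a}. k $ b * (G b - G a * (d b / d a))) + k $ a * (G a / d a)"
      by (simp add: right_diff_distrib sum_subtractf sum_distrib_left sum_distrib_right sum_divide_distrib mult_ac)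
    also have "\<dots> = (\<Sum>b\<in>UNIV. k $ b * (if b = a then G a / d a else G b - G a * (d b / d a)))"
      by (subst split) simp
    finally show "(\<Sum>i\<in>UNIV. unstraighten_deriv a d k $ i * G i) = \<dots>" .
  qed
  finally show ?thesis by (simp add: has_gradient_def)
qed

text \<open>
\<open>\<Psi>\<close> is the inverse of \<open>straighten a h\<close> between open sets \<open>U\<close> and \<open>V\<close>. The functions \<open>d\<close> play the role of
the gradient of \<open>h\<close>, which enters only through the derivative of \<open>\<Psi>\<close>.
The constant \<open>K\<close> bounds the quantities by which estimates change under this substitution.
\<close>
locale coordinate_change =
  fixes a :: "'n::finite" and h :: "real^'n \<Rightarrow> real" and d :: "'n \<Rightarrow> real^'n \<Rightarrow> real"
    and U V :: "(real^'n) set" and \<Psi> :: "real^'n \<Rightarrow> real^'n" and K :: real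
  assumes open_U: "open U" and open_V: "open V"
    and nz: "\<And>x. x \<in> U \<Longrightarrow> d a x \<noteq> 0"
    and \<Psi>_in: "\<And>y. y \<in> V \<Longrightarrow> \<Psi> y \<in> U"
    and straighten_in: "\<And>x. x \<in> U \<Longrightarrow> straighten a h x \<in> V"
    and \<Psi>_straighten: "\<And>x. x \<in> U \<Longrightarrow> \<Psi> (straighten a h x) = x"
    and straighten_\<Psi>: "\<And>y. y \<in> V \<Longrightarrow> straighten a h (\<Psi> y) = y"
    and \<Psi>_deriv: "\<And>y. y \<in> V \<Longrightarrow> (\<Psi> has_derivative unstraighten_deriv a (\<lambda>i. d i (\<Psi> y))) (at y)"
    and K: "K > 0"
    and \<Psi>_lipschitz: "\<And>y z. y \<in> V \<Longrightarrow> z \<in> V \<Longrightarrow> dist (\<Psi> y) (\<Psi> z) \<le> K * dist y z"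
    and ratio: "\<And>x b. x \<in> U \<Longrightarrow> \<bar>d b x / d a x\<bar> \<le> K"
begin

lemma \<Psi>_nth: "y \<in> V \<Longrightarrow> i \<noteq> a \<Longrightarrow> \<Psi> y $ i = y $ i"
  using straighten_nth[of a h "\<Psi> y" i] straighten_\<Psi> by simp

lemma h_\<Psi>: "y \<in> V \<Longrightarrow> h (\<Psi> y) = y $ a"
  using straighten_nth[of a h "\<Psi> y" a] straighten_\<Psi> by simp

lemma image_\<Psi>: "\<Psi> ` (V \<inter> \<Psi> -` A) = U \<inter> A"
proof
  show "\<Psi> ` (V \<inter> \<Psi> -` A) \<subseteq> U \<inter> A" using \<Psi>_in by auto
  show "U \<inter> A \<subseteq> \<Psi> ` (V \<inter> \<Psi> -` A)"
  proof
    fix x assume "x \<in> U \<inter> A"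
    then show "x \<in> \<Psi> ` (V \<inter> \<Psi> -` A)"
      by (intro image_eqI[of _ _ "straighten a h x"]) (auto simp: straighten_in \<Psi>_straighten)
  qed
qed

text \<open>
The partial derivatives of $g \circ \Psi$ are again of the form $G \circ \Psi$, where $G$ is a
rational expression in the derivatives of $g$ and $h$. So the class of the composition follows by
induction on the order, for all $g$ simultaneously, from the closure of the classes under
arithmetic.
\<close>
lemma C_loc_compose:
  assumes \<alpha>: "0 \<le> \<alpha>" "\<alpha> \<le> 1" and d: "\<And>b. C_loc j \<alpha> U (d b)"
  shows "i \<le> Suc j \<Longrightarrow> C_loc i \<alpha> U g \<Longrightarrow> C_loc i \<alpha> V (\<lambda>y. g (\<Psi> y))"
proof (induction i arbitrary: g)
  case 0
  have cont: "continuous_on V \<Psi>"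
    using \<Psi>_deriv by (intro continuous_at_imp_continuous_on) (blast intro: has_derivative_continuous)
  then have "continuous_on V (\<lambda>y. g (\<Psi> y))"
    using C_loc_continuous[OF 0(2)] \<Psi>_in by (intro continuous_on_compose2[of U g V \<Psi>]) auto
  moreover have "\<exists>r>0. \<exists>L\<ge>0. \<forall>y\<in>ball x r \<inter> V. \<forall>z\<in>ball x r \<inter> V.
      \<bar>g (\<Psi> y) - g (\<Psi> z)\<bar> \<le> L * dist y z powr \<alpha>" if xV: "x \<in> V" for x
  proof -
    obtain r L where r: "r > 0" "L \<ge> 0"
      and L: "\<forall>y\<in>ball (\<Psi> x) r \<inter> U. \<forall>z\<in>ball (\<Psi> x) r \<inter> U. \<bar>g y - g z\<bar> \<le> L * dist y z powr \<alpha>"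
      using 0(2) \<Psi>_in[OF xV] by (rule C_loc_0E)
    have "\<bar>g (\<Psi> y) - g (\<Psi> z)\<bar> \<le> (L * K powr \<alpha>) * dist y z powr \<alpha>"
      if y: "y \<in> ball x (r / K) \<inter> V" and z: "z \<in> ball x (r / K) \<inter> V" for y z
    proof -
      have "\<Psi> w \<in> ball (\<Psi> x) r \<inter> U" if "w \<in> ball x (r / K) \<inter> V" for w
      proof -
        have "dist (\<Psi> x) (\<Psi> w) \<le> K * dist x w" using \<Psi>_lipschitz xV that by auto
        also have "\<dots> < r" using that K by (auto simp: field_simps)
        finally show ?thesis using that \<Psi>_in by auto
      qed
      then have "\<bar>g (\<Psi> y) - g (\<Psi> z)\<bar> \<le> L * dist (\<Psi> y) (\<Psi> z) powr \<alpha>" using L y z by blast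
      also have "\<dots> \<le> L * (K * dist y z) powr \<alpha>"
        using \<Psi>_lipschitz y z r \<alpha> by (intro mult_left_mono powr_mono2) auto
      also have "\<dots> = (L * K powr \<alpha>) * dist y z powr \<alpha>" using K by (simp add: powr_mult)
      finally show ?thesis .
    qed
    moreover have "r / K > 0" "L * K powr \<alpha> \<ge> 0" using r K by auto
    ultimately show ?thesis by blast
  qed
  ultimately show ?case by simp
next
  case (Suc i)
  obtain G where G: "\<forall>x\<in>U. has_gradient g (\<lambda>i. G i x) x" "\<forall>b. C_loc i \<alpha> U (G b)"
    using Suc.prems by auto
  have d': "C_loc i \<alpha> U (d b)" for b
    using Suc.prems d by (intro C_loc_le[OF open_U \<alpha>(2), of i j]) auto
  define E where "E b x = (if b = a then G a x / d a x else G b x - G a x * (d b x / d a x))" for b x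
  have E: "C_loc i \<alpha> U (E b)" for b
  proof (cases "b = a")
    case True
    have "C_loc i \<alpha> U (\<lambda>x. G a x / d a x)"
      using G(2) d' nz open_U \<alpha> by (intro C_loc_divide) auto
    then show ?thesis using True by (simp add: E_def[abs_def])
  next
    case False
    have "C_loc i \<alpha> U (\<lambda>x. G b x - G a x * (d b x / d a x))"
      using G(2) d' nz open_U \<alpha> by (intro C_loc_diff C_loc_mult C_loc_divide) auto
    then show ?thesis using False by (simp add: E_def[abs_def])
  qed
  have "\<forall>b. C_loc i \<alpha> V (\<lambda>y. E b (\<Psi> y))" using Suc E by auto
  moreover have "\<forall>y\<in>V. has_gradient (\<lambda>y. g (\<Psi> y)) (\<lambda>b. E b (\<Psi> y)) y"
  proof
    fix y assume y: "y \<in> V"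
    have "has_gradient (\<lambda>y. g (\<Psi> y)) (\<lambda>b. if b = a then G a (\<Psi> y) / d a (\<Psi> y)
       else G b (\<Psi> y) - G a (\<Psi> y) * (d b (\<Psi> y) / d a (\<Psi> y))) y"
      using G(1) \<Psi>_in[OF y] nz \<Psi>_deriv[OF y] by (intro has_gradient_compose) auto
    then show "has_gradient (\<lambda>y. g (\<Psi> y)) (\<lambda>b. E b (\<Psi> y)) y" by (simp add: E_def)
  qed
  ultimately show ?case unfolding C_loc.simps by (intro exI[of _ "\<lambda>b y. E b (\<Psi> y)"] conjI)
qed

end

text \<open>
The inverse function theorem applies since the derivative of \<open>straighten a h\<close> is invertible wherever
the $a$-th partial derivative of $h$ is non-zero. The target is shrunk to a ball: it is convex, so a
bound on the derivative of the inverse yields a Lipschitz bound.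
\<close>
lemma coordinate_change_exists:
  fixes h :: "real^'n \<Rightarrow> real"
  assumes W: "open W" and x0: "x0 \<in> W"
    and grad: "\<And>x. x \<in> W \<Longrightarrow> has_gradient h (\<lambda>i. d i x) x"
    and cont: "\<And>i. continuous_on W (d i)" and nz0: "d a x0 \<noteq> 0"
  obtains U V \<Psi> K where "coordinate_change a h d U V \<Psi> K" "x0 \<in> U" "U \<subseteq> W"
proof -
  let ?f = "straighten a h"
  define f' where "f' x = Blinfun (straighten_deriv a (\<lambda>i. d i x))" for x
  have f': "blinfun_apply (f' x) = straighten_deriv a (\<lambda>i. d i x)" for x
    unfolding f'_def by (rule bounded_linear_Blinfun_apply[OF bounded_linear_straighten_deriv])
  define invf where "invf = Blinfun (unstraighten_deriv a (\<lambda>i. d i x0))"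
  have invf: "blinfun_apply invf = unstraighten_deriv a (\<lambda>i. d i x0)"
    unfolding invf_def by (rule bounded_linear_Blinfun_apply[OF bounded_linear_unstraighten_deriv])
  have contf: "continuous_on W f'"
  proof -
    define E where "E b = Blinfun (\<lambda>k::real^'n. (k $ b) *\<^sub>R (axis a 1 :: real^'n))" for b
    have E: "blinfun_apply (E b) = (\<lambda>k. (k $ b) *\<^sub>R axis a 1)" for b
      unfolding E_def by (intro bounded_linear_Blinfun_apply bounded_linear_scaleR_const bounded_linear_vec_nth)
    have "f' x = id_blinfun - E a + (\<Sum>b\<in>UNIV. d b x *\<^sub>R E b)" for x
      by (rule blinfun_eqI)
         (simp add: f' E straighten_deriv_def blinfun.bilinear_simps scaleR_left_diff_distrib scaleR_sum_left mult.commute)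
    then show ?thesis using cont by (auto intro!: continuous_intros)
  qed
  have deriv: "(?f has_derivative blinfun_apply (f' x)) (at x)" if "x \<in> W" for x
    unfolding f' by (intro has_derivative_straighten grad that)
  have invc: "invf o\<^sub>L f' x0 = id_blinfun"
    by (rule blinfun_eqI) (simp add: f' invf straighten_deriv_inverse nz0)
  obtain U' V' g g' where ift: "open U'" "U' \<subseteq> W" "x0 \<in> U'" "open V'" "?f x0 \<in> V'"
     "homeomorphism U' V' ?f g"
    and der: "\<And>y. y \<in> V' \<Longrightarrow> (g has_derivative (g' y)) (at y)"
    and g': "\<And>y. y \<in> V' \<Longrightarrow> g' y = inv (blinfun_apply (f' (g y)))"
    and "\<And>y. y \<in> V' \<Longrightarrow> bij (blinfun_apply (f' (g y)))"
    by (rule inverse_function_theorem[OF W deriv contf x0 invc]) (assumption, rule that, assumption+)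
  have hom: "\<And>x. x \<in> U' \<Longrightarrow> ?f x \<in> V' \<and> g (?f x) = x" "\<And>y. y \<in> V' \<Longrightarrow> g y \<in> U' \<and> ?f (g y) = y"
    "continuous_on U' ?f" "continuous_on V' g"
    using ift(6) by (auto simp: homeomorphism_def)
  \<comment> \<open>on a small ball the $a$-th derivative stays away from zero and all derivatives stay bounded;
    this gives the Lipschitz constant of the inverse and the bound for the quotients\<close>
  obtain r c M where r: "r > 0" "ball x0 r \<subseteq> U'" and c: "c > 0" "\<And>x. x \<in> ball x0 r \<Longrightarrow> c \<le> \<bar>d a x\<bar>"
    and M: "M > 0" "\<And>x b. x \<in> ball x0 r \<Longrightarrow> \<bar>d b x\<bar> \<le> M"
  proof -
    obtain r0 where r0: "r0 > 0" "ball x0 r0 \<subseteq> U'" using ift open_contains_ball by blast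
    have "\<forall>b. \<exists>r>0. \<exists>M>0. \<forall>y\<in>ball x0 r \<inter> W. \<bar>d b y\<bar> \<le> M"
      using cont x0 continuous_on_locally_bounded by blast
    then obtain \<rho> B where \<rho>: "\<And>b. \<rho> b > 0" and B: "\<And>b. B b > 0" "\<And>b y. y \<in> ball x0 (\<rho> b) \<inter> W \<Longrightarrow> \<bar>d b y\<bar> \<le> B b"
      by metis
    obtain r1 where r1: "r1 > 0" "\<And>y. y \<in> W \<Longrightarrow> dist y x0 < r1 \<Longrightarrow> dist (d a y) (d a x0) < \<bar>d a x0\<bar> / 2"
      using cont[of a] x0 nz0 unfolding continuous_on_iff by (metis half_gt_zero zero_less_abs_iff)
    define r where "r = min (min r0 r1) (Min (range \<rho>))"
    have r: "r > 0" "r \<le> r0" "r \<le> r1" "\<And>b. r \<le> \<rho> b"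
      using r0 r1 \<rho> by (auto simp: r_def intro!: min.coboundedI2)
    have sub: "ball x0 r \<subseteq> W" using r r0 ift by force
    show thesis
    proof (rule that[of r "\<bar>d a x0\<bar> / 2" "Max (range B)"])
      show "ball x0 r \<subseteq> U'" using r r0 by force
      show "\<bar>d a x0\<bar> / 2 \<le> \<bar>d a x\<bar>" if "x \<in> ball x0 r" for x
      proof -
        have "dist (d a x) (d a x0) < \<bar>d a x0\<bar> / 2"
          using that sub r by (intro r1) (auto simp: dist_commute)
        then show ?thesis unfolding dist_real_def by linarith
      qed
      show "\<bar>d b x\<bar> \<le> Max (range B)" if "x \<in> ball x0 r" for x b
      proof -
        have "\<bar>d b x\<bar> \<le> B b" using that sub r(4)[of b] by (intro B) auto
        also have "\<dots> \<le> Max (range B)" by simp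
        finally show ?thesis .
      qed
      have "0 < B a" by (rule B)
      also have "\<dots> \<le> Max (range B)" by simp
      finally show "0 < Max (range B)" .
    qed (use r nz0 in auto)
  qed
  have "open (V' \<inter> g -` ball x0 r)"
    using hom(4) ift(4) by (intro continuous_open_preimage) auto
  moreover have "?f x0 \<in> V' \<inter> g -` ball x0 r" using hom(1)[OF ift(3)] r by auto
  ultimately obtain e where e: "e > 0" "ball (?f x0) e \<subseteq> V' \<inter> g -` ball x0 r"
    using open_contains_ball by blast
  define V where "V = ball (?f x0) e"
  have V: "y \<in> V' \<and> g y \<in> ball x0 r" if "y \<in> V" for y using e that by (auto simp: V_def)
  define U where "U = U' \<inter> ?f -` V"
  have Ur: "x \<in> ball x0 r" if "x \<in> U" for x
    using that V[of "?f x"] hom(1)[of x] by (auto simp: U_def)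
  have nz: "d a x \<noteq> 0" if "x \<in> ball x0 r" for x using c(1) c(2)[OF that] by auto
  have derg: "(g has_derivative unstraighten_deriv a (\<lambda>i. d i (g y))) (at y)" if "y \<in> V" for y
  proof -
    have n: "d a (g y) \<noteq> 0" using V that nz by auto
    have "inv (straighten_deriv a (\<lambda>i. d i (g y))) = unstraighten_deriv a (\<lambda>i. d i (g y))"
      by (rule inv_equality) (use n in \<open>simp_all add: straighten_deriv_inverse\<close>)
    then show ?thesis using der[of y] g'[of y] V[OF that] by (simp add: f')
  qed
  define K where "K = 1 + (1 + real CARD('n) * M) / c + M / c"
  have K: "K > 0" "M / c \<le> K" "1 + (1 + real CARD('n) * M) / c \<le> K"
    using c M by (auto simp: K_def intro!: add_pos_nonneg add_nonneg_nonneg)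
  have "coordinate_change a h d U V g K"
  proof
    show "open U" unfolding U_def V_def using hom(3) ift(1) by (intro continuous_open_preimage) auto
    show "open V" by (simp add: V_def)
    show "g y \<in> U" if "y \<in> V" for y using hom(2)[of y] V[OF that] that by (auto simp: U_def)
    show "dist (g y) (g z) \<le> K * dist y z" if "y \<in> V" "z \<in> V" for y z
    proof -
      have "norm (g y - g z) \<le> K * norm (y - z)"
      proof (rule differentiable_bound)
        show "convex V" by (simp add: V_def)
        fix w assume w: "w \<in> V"
        then show "(g has_derivative unstraighten_deriv a (\<lambda>i. d i (g w))) (at w within V)"
          using derg by (blast intro: has_derivative_at_withinI)
        show "onorm (unstraighten_deriv a (\<lambda>i. d i (g w))) \<le> K"
        proof (rule onorm_le)
          fix k :: "real^'n"
          let ?S = "\<Sum>i\<in>UNIV. k $ i * d i (g w)"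
          have "\<bar>?S\<bar> \<le> real CARD('n) * M * norm k" using M V[OF w] by (intro has_gradient_norm_le) auto
          moreover have "\<bar>k $ a\<bar> \<le> norm k" by (rule component_le_norm_cart)
          ultimately have "\<bar>k $ a - ?S\<bar> \<le> (1 + real CARD('n) * M) * norm k" by (simp add: algebra_simps)
          then have "\<bar>k $ a - ?S\<bar> / \<bar>d a (g w)\<bar> \<le> (1 + real CARD('n) * M) * norm k / c"
            using c V[OF w] by (intro frac_le) auto
          then have "\<bar>(k $ a - ?S) / d a (g w)\<bar> \<le> (1 + real CARD('n) * M) / c * norm k"
            by (simp add: abs_divide)
          then have "norm (unstraighten_deriv a (\<lambda>i. d i (g w)) k) \<le> norm k + (1 + real CARD('n) * M) / c * norm k"
            unfolding unstraighten_deriv_def by (intro norm_triangle_le) (simp add: norm_axis_1)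
          also have "\<dots> = (1 + (1 + real CARD('n) * M) / c) * norm k" by (simp add: algebra_simps)
          also have "\<dots> \<le> K * norm k" using K by (intro mult_right_mono) auto
          finally show "norm (unstraighten_deriv a (\<lambda>i. d i (g w)) k) \<le> K * norm k" .
        qed
      qed (use that in auto)
      then show ?thesis by (simp add: dist_norm)
    qed
    show "\<bar>d b x / d a x\<bar> \<le> K" if "x \<in> U" for x b
    proof -
      have "\<bar>d b x / d a x\<bar> \<le> M / c"
        unfolding abs_divide using M(2)[OF Ur[OF that]] c(2)[OF Ur[OF that]] c(1) M(1) by (intro frac_le) auto
      then show ?thesis using K by linarith
    qed
  qed (use hom V Ur nz derg K in \<open>auto simp: U_def\<close>)
  moreover have "x0 \<in> U" using ift(3) e by (auto simp: U_def V_def)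
  moreover have "U \<subseteq> W" using ift by (auto simp: U_def)
  ultimately show thesis by (rule that)
qed

section \<open>Chains of functions vanishing on a set\<close>

text \<open>
At each point the derivatives of functions in \<open>G\<close> in the directions \<open>R\<close> are dominated by the values
there of the functions in \<open>H\<close>. Unlike the exact relation that \<open>H\<close> consists of the derivatives of \<open>G\<close>,
this one survives a change of coordinates, which mixes derivatives.
\<close>
definition controls ::
  "(real^'n) set \<Rightarrow> 'n set \<Rightarrow> (real^'n \<Rightarrow> real) set \<Rightarrow> (real^'n \<Rightarrow> real) set \<Rightarrow> bool" where
  "controls U R H G \<longleftrightarrow> (\<exists>C\<ge>0. \<forall>g\<in>G. \<forall>x\<in>U. \<exists>d. has_gradient g d x \<and>
     (\<forall>a\<in>R. \<forall>B\<ge>0. (\<forall>h\<in>H. \<bar>h x\<bar> \<le> B) \<longrightarrow> \<bar>d a\<bar> \<le> C * B))"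

text \<open>
\<open>R\<close> is the set of free coordinates and \<open>H\<close> contains coordinates that are constant on \<open>A\<close>. The chain
starts with the components of \<open>f\<close>, each generation controls the free derivatives of the
previous one, and all generations except the components of \<open>f\<close> vanish on \<open>A\<close>.
\<close>
locale vanishing_chain =
  fixes f :: "real^'n \<Rightarrow> real^'d" and A U :: "(real^'n) set" and R H :: "'n set"
    and F :: "nat \<Rightarrow> (real^'n \<Rightarrow> real) set" and l :: nat
  assumes open_U: "open U" and A_sub: "A \<subseteq> U"
    and lip: "locally_lipschitz U f"
    and F_0: "F 0 = range (\<lambda>c x. f x $ c)"
    and finite_F: "finite (F l)" and l: "1 \<le> l"
    and ctrl: "\<And>i. i < l \<Longrightarrow> controls U R (F (Suc i)) (F i)"
    and vanish: "\<And>i g x. 1 \<le> i \<Longrightarrow> i \<le> l \<Longrightarrow> g \<in> F i \<Longrightarrow> x \<in> A \<Longrightarrow> g x = 0"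
    and const: "\<And>i x y. i \<in> H \<Longrightarrow> x \<in> A \<Longrightarrow> y \<in> A \<Longrightarrow> x $ i = y $ i"

text \<open>
Only the free coordinates change along the segment from $z$ to $w$, so only the controlled
derivatives of $g$ enter the mean value inequality.
\<close>
lemma controlled_increment:
  fixes z w :: "real^'n"
  assumes ctrl: "\<And>x. x \<in> Q \<Longrightarrow> \<exists>d. has_gradient g d x \<and>
      (\<forall>a\<in>R. \<forall>B\<ge>0. (\<forall>h\<in>H. \<bar>h x\<bar> \<le> B) \<longrightarrow> \<bar>d a\<bar> \<le> C * B)"
    and C: "0 \<le> C" and Q: "convex Q" and zw: "z \<in> Q" "w \<in> Q"
    and agree: "\<And>i. i \<notin> R \<Longrightarrow> w $ i = z $ i"
    and B: "0 \<le> B" "\<And>p h. p \<in> Q \<Longrightarrow> (\<And>i. i \<notin> R \<Longrightarrow> p $ i = z $ i) \<Longrightarrow> h \<in> H \<Longrightarrow> \<bar>h p\<bar> \<le> B"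
    and \<rho>: "norm (w - z) \<le> \<rho>"
  shows "\<bar>g w - g z\<bar> \<le> (real CARD('n) * \<rho> * C) * B"
proof -
  obtain d where d: "\<And>x. x \<in> Q \<Longrightarrow> has_gradient g (d x) x"
    "\<And>x a B. x \<in> Q \<Longrightarrow> a \<in> R \<Longrightarrow> 0 \<le> B \<Longrightarrow> (\<forall>h\<in>H. \<bar>h x\<bar> \<le> B) \<Longrightarrow> \<bar>d x a\<bar> \<le> C * B"
    using bchoice[of Q "\<lambda>x d. has_gradient g d x \<and> (\<forall>a\<in>R. \<forall>B\<ge>0. (\<forall>h\<in>H. \<bar>h x\<bar> \<le> B) \<longrightarrow> \<bar>d a\<bar> \<le> C * B)"]
      ctrl by blast
  define p where "p t = z + t *\<^sub>R (w - z)" for t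
  have pQ: "p t \<in> Q" if "0 \<le> t" "t \<le> 1" for t
  proof -
    have "p t = (1 - t) *\<^sub>R z + t *\<^sub>R w" by (simp add: p_def algebra_simps)
    then show ?thesis using convexD[OF Q zw, of "1 - t" t] that by simp
  qed
  have pagree: "p t $ i = z $ i" if "i \<notin> R" for t i using agree[OF that] by (simp add: p_def)
  have "norm (g (p 1) - g (p 0)) \<le> (real CARD('n) * \<rho> * C * B) * norm (1 - 0 :: real)"
  proof (rule differentiable_bound[where S = "{0..1}" and f = "\<lambda>t. g (p t)" and
        f' = "\<lambda>t s. \<Sum>i\<in>UNIV. (s *\<^sub>R (w - z)) $ i * d (p t) i"])
    fix t :: real assume t: "t \<in> {0..1}"
    have "(p has_derivative (\<lambda>s. s *\<^sub>R (w - z))) (at t within {0..1})"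
      unfolding p_def by (auto intro!: derivative_eq_intros)
    moreover have "(g has_derivative (\<lambda>h. \<Sum>i\<in>UNIV. h $ i * d (p t) i)) (at (p t) within p ` {0..1})"
      using d(1)[OF pQ] t unfolding has_gradient_def by (auto intro: has_derivative_at_withinI)
    ultimately show "((\<lambda>t. g (p t)) has_derivative (\<lambda>s. \<Sum>i\<in>UNIV. (s *\<^sub>R (w - z)) $ i * d (p t) i)) (at t within {0..1})"
      by (rule has_derivative_in_compose)
    show "onorm (\<lambda>s. \<Sum>i\<in>UNIV. (s *\<^sub>R (w - z)) $ i * d (p t) i) \<le> real CARD('n) * \<rho> * C * B"
    proof (rule onorm_le)
      fix s :: real
      have "norm (\<Sum>i\<in>UNIV. (s *\<^sub>R (w - z)) $ i * d (p t) i) \<le> (\<Sum>i\<in>UNIV. \<bar>(s *\<^sub>R (w - z)) $ i * d (p t) i\<bar>)"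
        unfolding real_norm_def by (rule sum_abs)
      also have "\<dots> \<le> (\<Sum>i\<in>(UNIV::'n set). \<bar>s\<bar> * (\<rho> * (C * B)))"
      proof (rule sum_mono)
        fix i
        show "\<bar>(s *\<^sub>R (w - z)) $ i * d (p t) i\<bar> \<le> \<bar>s\<bar> * (\<rho> * (C * B))"
        proof (cases "i \<in> R")
          case True
          have "\<bar>d (p t) i\<bar> \<le> C * B"
            using t pQ pagree B True by (intro d(2)) auto
          moreover have "\<bar>(w - z) $ i\<bar> \<le> \<rho>" using component_le_norm_cart[of "w - z" i] \<rho> by linarith
          ultimately have "\<bar>(w - z) $ i\<bar> * \<bar>d (p t) i\<bar> \<le> \<rho> * (C * B)" by (intro mult_mono) auto
          then show ?thesis by (simp add: abs_mult mult.assoc mult_left_mono)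
        next
          case False
          have "0 \<le> \<rho>" using \<rho> norm_ge_zero[of "w - z"] by linarith
          then show ?thesis using agree[OF False] B(1) C by simp
        qed
      qed
      finally show "norm (\<Sum>i\<in>UNIV. (s *\<^sub>R (w - z)) $ i * d (p t) i) \<le> real CARD('n) * \<rho> * C * B * norm s"
        by (simp add: mult_ac)
    qed
  qed auto
  then show ?thesis by (simp add: p_def)
qed

lemma (in vanishing_chain) uniform_control:
  obtains C where "C \<ge> 0" "\<And>i g x. i < l \<Longrightarrow> g \<in> F i \<Longrightarrow> x \<in> U \<Longrightarrow> \<exists>d. has_gradient g d x \<and>
      (\<forall>a\<in>R. \<forall>B\<ge>0. (\<forall>h\<in>F (Suc i). \<bar>h x\<bar> \<le> B) \<longrightarrow> \<bar>d a\<bar> \<le> C * B)"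
proof -
  have "\<forall>i\<in>{..<l}. \<exists>C\<ge>0. \<forall>g\<in>F i. \<forall>x\<in>U. \<exists>d. has_gradient g d x \<and>
      (\<forall>a\<in>R. \<forall>B\<ge>0. (\<forall>h\<in>F (Suc i). \<bar>h x\<bar> \<le> B) \<longrightarrow> \<bar>d a\<bar> \<le> C * B)"
    using ctrl unfolding controls_def by blast
  from bchoice[OF this] obtain C where C': "\<forall>i\<in>{..<l}. 0 \<le> C i \<and> (\<forall>g\<in>F i. \<forall>x\<in>U. \<exists>d. has_gradient g d x \<and>
      (\<forall>a\<in>R. \<forall>B\<ge>0. (\<forall>h\<in>F (Suc i). \<bar>h x\<bar> \<le> B) \<longrightarrow> \<bar>d a\<bar> \<le> C i * B))"
    by blast
  have C: "\<And>i. i < l \<Longrightarrow> C i \<ge> 0"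
    "\<And>i g x. i < l \<Longrightarrow> g \<in> F i \<Longrightarrow> x \<in> U \<Longrightarrow> \<exists>d. has_gradient g d x \<and>
      (\<forall>a\<in>R. \<forall>B\<ge>0. (\<forall>h\<in>F (Suc i). \<bar>h x\<bar> \<le> B) \<longrightarrow> \<bar>d a\<bar> \<le> C i * B)"
    using C' by blast+
  show thesis
  proof (rule that)
    show "0 \<le> (\<Sum>i<l. C i)" using C(1) by (intro sum_nonneg) auto
    fix i g x assume *: "i < l" "g \<in> F i" "x \<in> U"
    have le: "C i \<le> (\<Sum>i<l. C i)" using *(1) C(1) by (intro member_le_sum) auto
    obtain d where d: "has_gradient g d x"
      "\<forall>a\<in>R. \<forall>B\<ge>0. (\<forall>h\<in>F (Suc i). \<bar>h x\<bar> \<le> B) \<longrightarrow> \<bar>d a\<bar> \<le> C i * B"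
      using C(2)[OF *] by blast
    have "\<bar>d a\<bar> \<le> (\<Sum>i<l. C i) * B" if "a \<in> R" "B \<ge> 0" "\<forall>h\<in>F (Suc i). \<bar>h x\<bar> \<le> B" for a B
      using d(2) that mult_right_mono[OF le that(2)] by fastforce
    then show "\<exists>d. has_gradient g d x \<and>
      (\<forall>a\<in>R. \<forall>B\<ge>0. (\<forall>h\<in>F (Suc i). \<bar>h x\<bar> \<le> B) \<longrightarrow> \<bar>d a\<bar> \<le> (\<Sum>i<l. C i) * B)"
      using d(1) by blast
  qed
qed

text \<open>
Starting from a point $z$ of $A$ each generation vanishes at $z$, so a bound $B$ for the last
generation gains one factor $\rho$, the size of the set, per generation on the way down to the
components of $f$.
\<close>
lemma (in vanishing_chain) increment_le:
  assumes C: "C \<ge> 0" "\<And>i g x. i < l \<Longrightarrow> g \<in> F i \<Longrightarrow> x \<in> U \<Longrightarrow> \<exists>d. has_gradient g d x \<and>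
      (\<forall>a\<in>R. \<forall>B\<ge>0. (\<forall>h\<in>F (Suc i). \<bar>h x\<bar> \<le> B) \<longrightarrow> \<bar>d a\<bar> \<le> C * B)"
    and Q: "convex Q" "Q \<subseteq> U" and z: "z \<in> A" "z \<in> Q"
    and \<rho>: "\<And>p. p \<in> Q \<Longrightarrow> norm (p - z) \<le> \<rho>" "0 \<le> \<rho>"
    and B: "0 \<le> B" "\<And>p g. p \<in> Q \<Longrightarrow> g \<in> F l \<Longrightarrow> \<bar>g p\<bar> \<le> B"
    and i: "i \<le> l" and w: "w \<in> Q" "\<And>a. a \<notin> R \<Longrightarrow> w $ a = z $ a" and g: "g \<in> F i"
  shows "\<bar>g w - g z\<bar> \<le> (real CARD('n) * \<rho> * C) ^ (l - i) * B"
  using i w g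
proof (induction arbitrary: w g rule: inc_induct)
  case base
  have "g z = 0" by (rule vanish[OF l order_refl base(3) z(1)])
  moreover have "\<bar>g w\<bar> \<le> B" by (rule B(2)[OF base(1,3)])
  ultimately show ?case by simp
next
  case (step i)
  define B' where "B' = (real CARD('n) * \<rho> * C) ^ (l - Suc i) * B"
  have B': "0 \<le> B'" using B C \<rho> by (simp add: B'_def)
  have "\<bar>g w - g z\<bar> \<le> (real CARD('n) * \<rho> * C) * B'"
  proof (rule controlled_increment[OF _ C(1) Q(1) z(2)])
    show "\<exists>d. has_gradient g d x \<and> (\<forall>a\<in>R. \<forall>B\<ge>0. (\<forall>h\<in>F (Suc i). \<bar>h x\<bar> \<le> B) \<longrightarrow> \<bar>d a\<bar> \<le> C * B)"
      if "x \<in> Q" for x using C(2) step Q that by blast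
    show "\<bar>h p\<bar> \<le> B'" if "p \<in> Q" "\<And>i. i \<notin> R \<Longrightarrow> p $ i = z $ i" "h \<in> F (Suc i)" for p h
      using step.IH[of p h] that vanish[of "Suc i" h z] step z by (simp add: B'_def)
  qed (use step B' \<rho> in auto)
  also have "\<dots> = (real CARD('n) * \<rho> * C) ^ (l - i) * B"
    using step by (simp add: B'_def Suc_diff_Suc[symmetric])
  finally show ?case .
qed

lemma uniform_modulus:
  assumes "finite S" "\<And>g. g \<in> S \<Longrightarrow> continuous_on Q g" "compact Q" "(e::real) > 0"
  shows "\<exists>\<tau>>0. \<forall>g\<in>S. \<forall>x\<in>Q. \<forall>y\<in>Q. dist x y < \<tau> \<longrightarrow> dist (g x) (g y) < e"
  using assms(1,2)
proof (induction S)
  case empty then show ?case by (auto intro!: exI[of _ "1::real"])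
next
  case (insert g S)
  obtain r1 where 1: "r1 > 0" "\<forall>g\<in>S. \<forall>x\<in>Q. \<forall>y\<in>Q. dist x y < r1 \<longrightarrow> dist (g x) (g y) < e"
    using insert by auto
  have "uniformly_continuous_on Q g" using insert assms(3) by (intro compact_uniformly_continuous) auto
  then obtain r2 where 2: "r2 > 0" "\<forall>x\<in>Q. \<forall>y\<in>Q. dist y x < r2 \<longrightarrow> dist (g y) (g x) < e"
    using assms(4) unfolding uniformly_continuous_on_def by meson
  show ?case using 1 2 by (intro exI[of _ "min r1 r2"]) (auto simp: dist_commute)
qed

lemma exists_small_powr:
  assumes "0 < \<alpha>" "0 < (b::real)"
  shows "\<exists>N\<ge>1::nat. real N powr - \<alpha> \<le> b"
proof -
  define N where "N = max 1 (nat \<lceil>b powr (- 1 / \<alpha>)\<rceil>)"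
  have N: "1 \<le> N" "b powr (- 1 / \<alpha>) \<le> real N" unfolding N_def by linarith+
  have "real N powr - \<alpha> \<le> (b powr (- 1 / \<alpha>)) powr - \<alpha>"
    using N assms by (intro powr_mono2') auto
  also have "\<dots> = b" using assms by (simp add: powr_powr)
  finally show ?thesis using N by blast
qed

lemma exists_small_factor:
  assumes "0 < (e::real)" "0 < K" "0 < p"
  shows "\<exists>b. 0 < b \<and> b \<le> 1 \<and> K * b powr p \<le> e"
proof -
  define b where "b = min 1 ((e / K) powr (1 / p))"
  have b: "0 < b" "b \<le> 1" using assms by (auto simp: b_def)
  have "b powr p \<le> ((e / K) powr (1 / p)) powr p"
    using b assms by (intro powr_mono2) (auto simp: b_def)
  also have "\<dots> = e / K" using assms by (simp add: powr_powr)
  finally have "K * b powr p \<le> e" using assms by (simp add: field_simps)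
  then show ?thesis using b by blast
qed

text \<open>
Functions vanishing on a set which meets all $N^n$ subcubes are small on the whole cube. For
$\alpha > 0$ the factor $b$ comes from the distance $r/N$ to the nearest zero and large $N$; for
$\alpha = 0$ it comes from uniform continuity and small $r$, with $N = 1$.
\<close>
lemma small_on_dense_cubes:
  fixes Q0 :: "(real^'n) set"
  assumes S: "finite S" "\<And>g. g \<in> S \<Longrightarrow> continuous_on Q0 g" and Q0: "compact Q0"
    and L: "0 \<le> L" "\<And>g y z. g \<in> S \<Longrightarrow> y \<in> Q0 \<Longrightarrow> z \<in> Q0 \<Longrightarrow> \<bar>g y - g z\<bar> \<le> L * dist y z powr \<alpha>"
    and zero: "\<And>g x. g \<in> S \<Longrightarrow> x \<in> A \<Longrightarrow> g x = 0" and A: "A \<subseteq> Q0"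
    and \<alpha>: "0 \<le> \<alpha>" "\<alpha> \<le> 1" and b: "0 < b" "b \<le> 1"
  shows "\<exists>N\<ge>1. \<exists>t>0. \<forall>c r. 0 < r \<longrightarrow> r \<le> t \<longrightarrow> cube c r \<subseteq> Q0 \<longrightarrow>
     (\<forall>\<kappa>\<in>grid N. A \<inter> subcube c r N \<kappa> \<noteq> {}) \<longrightarrow>
     (\<forall>g\<in>S. \<forall>p\<in>cube c r. \<bar>g p\<bar> \<le> (L * real CARD('n) + 1) * (b * r powr \<alpha>))"
proof (cases "\<alpha> = 0")
  case True
  obtain \<tau> where \<tau>: "\<tau> > 0" "\<And>g x y. g \<in> S \<Longrightarrow> x \<in> Q0 \<Longrightarrow> y \<in> Q0 \<Longrightarrow> dist x y < \<tau> \<Longrightarrow> dist (g x) (g y) < b"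
    using uniform_modulus[OF S Q0 b(1)] by blast
  define t where "t = \<tau> / (2 * real CARD('n))"
  have t: "t > 0" using \<tau> by (simp add: t_def)
  have "\<bar>g p\<bar> \<le> (L * real CARD('n) + 1) * (b * r powr \<alpha>)"
    if r: "0 < r" "r \<le> t" and sub: "cube c r \<subseteq> Q0" and meet: "\<forall>\<kappa>\<in>grid 1. A \<inter> subcube c r 1 \<kappa> \<noteq> {}"
      and g: "g \<in> S" and p: "p \<in> cube c r" for c :: "real^'n" and r g p
  proof -
    have "(\<lambda>_. 0) \<in> (grid 1 :: ('n \<Rightarrow> nat) set)" by auto
    then obtain x where x: "x \<in> A" "x \<in> subcube c r 1 (\<lambda>_. 0)" using meet by blast
    have xc: "x \<in> cube c r" using x(2) r subcube_subset_cube[of "\<lambda>_. 0" 1 r c] by auto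
    have "dist p x \<le> real CARD('n) * r" using p xc by (rule dist_cube_le)
    also have "\<dots> \<le> real CARD('n) * t" using r by (intro mult_left_mono) auto
    also have "\<dots> < \<tau>" using \<tau> by (simp add: t_def)
    finally have "dist (g p) (g x) < b" using g p xc sub by (intro \<tau>(2)) auto
    then have "\<bar>g p\<bar> \<le> 1 * b" using zero[OF g x(1)] by (simp add: dist_real_def)
    also have "\<dots> \<le> (L * real CARD('n) + 1) * b" using L b by (intro mult_right_mono) auto
    finally show ?thesis using True r by simp
  qed
  then show ?thesis using t by (intro exI[of _ 1] conjI exI[of _ t]) auto
next
  case False
  then have \<alpha>': "\<alpha> > 0" using \<alpha> by simp
  obtain N :: nat where N: "N \<ge> 1" "real N powr - \<alpha> \<le> b" using exists_small_powr[OF \<alpha>' b(1)] by blast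
  have "\<bar>g p\<bar> \<le> (L * real CARD('n) + 1) * (b * r powr \<alpha>)"
    if r: "0 < r" and sub: "cube c r \<subseteq> Q0" and meet: "\<forall>\<kappa>\<in>grid N. A \<inter> subcube c r N \<kappa> \<noteq> {}"
      and g: "g \<in> S" and p: "p \<in> cube c r" for c :: "real^'n" and r g p
  proof -
    obtain \<kappa> where \<kappa>: "\<kappa> \<in> grid N" "p \<in> subcube c r N \<kappa>" using cube_subset_subcubes[OF N(1)] p by blast
    then obtain x where x: "x \<in> A" "x \<in> subcube c r N \<kappa>" using meet by blast
    have "dist p x \<le> real CARD('n) * (r / N)"
      using \<kappa>(2) x(2) unfolding subcube_def by (rule dist_cube_le)
    then have "dist p x powr \<alpha> \<le> (real CARD('n) * (r / N)) powr \<alpha>" using \<alpha> by (intro powr_mono2) auto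
    also have "\<dots> = real CARD('n) powr \<alpha> * (real N powr - \<alpha> * r powr \<alpha>)"
      using r N by (simp add: powr_mult powr_divide powr_minus_divide)
    also have "\<dots> \<le> real CARD('n) * (b * r powr \<alpha>)"
    proof (intro mult_mono)
      show "real CARD('n) powr \<alpha> \<le> real CARD('n)"
        using powr_mono[of \<alpha> 1 "real CARD('n)"] \<alpha> by (simp add: Suc_le_eq)
    qed (use N b in auto)
    finally have "dist p x powr \<alpha> \<le> real CARD('n) * (b * r powr \<alpha>)" .
    moreover have "\<bar>g p\<bar> \<le> L * dist p x powr \<alpha>"
      using L(2)[OF g, of p x] zero[OF g x(1)] p sub x(1) A by auto
    ultimately have "\<bar>g p\<bar> \<le> L * (real CARD('n) * (b * r powr \<alpha>))"
      using L(1) by (meson mult_left_mono order_trans)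
    also have "\<dots> \<le> (L * real CARD('n) + 1) * (b * r powr \<alpha>)"
      using b by (simp add: algebra_simps)
    finally show ?thesis .
  qed
  then show ?thesis using N by (intro exI[of _ N] conjI exI[of _ 1]) auto
qed

text \<open>
The end of the process of exchanging coordinates: the last generation is only Hoelder continuous.
All constants are fixed on a small cube \<open>Q0\<close> around the given point, and the cost of
its subcubes is estimated by box counting in the coordinates that are neither free nor constant.
\<close>
lemma (in vanishing_chain) mixed_content_null_of_holder:
  assumes holder: "\<And>g. g \<in> F l \<Longrightarrow> C_loc 0 \<alpha> U g" and \<alpha>: "0 \<le> \<alpha>" "\<alpha> \<le> 1"
    and card: "card (- (R \<union> H)) \<le> m" and q: "q > real m"
    and \<mu>: "\<mu> = real CARD('n) - real m - (real l + \<alpha>) * (q - real m)"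
  shows "mixed_content \<mu> q f A = 0"
proof (rule mixed_content_null_local)
  show q0: "q > 0" using q by linarith
  fix x0 assume x0: "x0 \<in> A"
  define n where "n = real CARD('n)"
  have n1: "1 \<le> n" by (simp add: n_def Suc_le_eq)
  have x0U: "x0 \<in> U" using x0 A_sub by auto
  obtain r1 where r1: "r1 > 0" "ball x0 r1 \<subseteq> U" using open_U x0U open_contains_ball by blast
  obtain r2 K where r2: "r2 > 0" and K: "K \<ge> 0"
    "\<And>y z. y \<in> ball x0 r2 \<inter> U \<Longrightarrow> z \<in> ball x0 r2 \<inter> U \<Longrightarrow> dist (f y) (f z) \<le> K * dist y z"
    using lip x0U by (rule locally_lipschitzE) (rule that, assumption+)
  obtain r3 L where r3: "r3 > 0" and L: "L \<ge> 0"
    "\<forall>g\<in>F l. \<forall>y\<in>ball x0 r3 \<inter> U. \<forall>z\<in>ball x0 r3 \<inter> U. \<bar>g y - g z\<bar> \<le> L * dist y z powr \<alpha>"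
    using uniform_local_holder[OF finite_F holder x0U] by blast
  obtain C where C: "C \<ge> 0" "\<And>i g x. i < l \<Longrightarrow> g \<in> F i \<Longrightarrow> x \<in> U \<Longrightarrow> \<exists>d. has_gradient g d x \<and>
      (\<forall>a\<in>R. \<forall>B\<ge>0. (\<forall>h\<in>F (Suc i). \<bar>h x\<bar> \<le> B) \<longrightarrow> \<bar>d a\<bar> \<le> C * B)"
    by (rule uniform_control) (rule that, assumption+)
  define C0 where "C0 = L * n + 1"
  have C0: "C0 > 0" using L n1 by (simp add: C0_def add_nonneg_pos)
  define C1 where "C1 = K * n + real CARD('d) * ((n * n * C) ^ l * C0) + 1"
  have C1: "C1 > 0" "K * n \<le> C1" "real CARD('d) * ((n * n * C) ^ l * C0) \<le> C1"
    using K C C0 n1 by (auto simp: C1_def intro!: add_nonneg_pos add_nonneg_nonneg)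
  \<comment> \<open>the cube has to lie in the three balls, and images of the pieces must have diameter at most $1$\<close>
  define r0 where "r0 = min (min 1 (1 / (2 * C1))) (min r1 (min r2 r3) / (2 * n))"
  have r0: "r0 > 0" "r0 \<le> 1" "C1 * 2 * r0 \<le> 1" "n * r0 < r1" "n * r0 < r2" "n * r0 < r3"
  proof -
    have "r0 \<le> 1 / (2 * C1)" by (simp add: r0_def)
    then show "C1 * 2 * r0 \<le> 1" using C1 by (simp add: field_simps)
    have "r0 \<le> min r1 (min r2 r3) / (2 * n)" by (simp add: r0_def)
    then have "n * r0 \<le> min r1 (min r2 r3) / 2" using n1 by (simp add: field_simps)
    then show "n * r0 < r1" "n * r0 < r2" "n * r0 < r3" using r1 r2 r3 by auto
  qed (use C1 n1 r1 r2 r3 in \<open>auto simp: r0_def\<close>)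
  define c0 where "c0 = (\<chi> i. x0 $ i - r0 / 2)"
  define Q0 where "Q0 = cube c0 r0"
  have x0Q: "x0 \<in> Q0" using r0 by (auto simp: Q0_def c0_def cube_def)
  have near: "dist x0 p \<le> n * r0" if "p \<in> Q0" for p
    using dist_cube_le[of x0 c0 r0 p] x0Q that by (simp add: Q0_def n_def)
  have Q0U: "Q0 \<subseteq> U" using near r0 r1 by force
  have KQ: "dist (f y) (f z) \<le> K * dist y z" if "y \<in> Q0" "z \<in> Q0" for y z
    using K(2)[of y z] near[OF that(1)] near[OF that(2)] that Q0U r0 by auto
  have LQ: "\<bar>g y - g z\<bar> \<le> L * dist y z powr \<alpha>" if "g \<in> F l" "y \<in> Q0" "z \<in> Q0" for g y z
  proof -
    have "y \<in> ball x0 r3 \<inter> U" "z \<in> ball x0 r3 \<inter> U"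
      using near[OF that(2)] near[OF that(3)] that(2,3) Q0U r0(6) by auto
    then show ?thesis using L(2) that(1) by blast
  qed
  define Kc where "Kc = 2 ^ m * n powr \<mu> * (C1 * (1 + 1)) powr q"
  have Kc: "Kc > 0" using n1 C1 by (simp add: Kc_def)
  \<comment> \<open>a cube on which the last generation is bounded by a multiple of $b r^\alpha$; $b = 1$ is
    possible whenever \<open>A\<close> meets the cube, and small $b$ is what density of \<open>A\<close> in the cube provides\<close>
  have cost: "mixed_content \<mu> q f (A \<inter> cube c r) \<le> ennreal (Kc * b powr (q - real m) * r ^ CARD('n))"
    if r: "0 < r" and sub: "cube c r \<subseteq> Q0" and b: "0 < b" "b \<le> 1"
      and small: "\<And>g p. g \<in> F l \<Longrightarrow> p \<in> cube c r \<Longrightarrow> \<bar>g p\<bar> \<le> C0 * (b * r powr \<alpha>)" for c r b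
  proof -
    have "c \<in> cube c r" "c + r *\<^sub>R axis undefined 1 \<in> cube c r" using r by (auto simp: cube_def axis_def)
    then have "c \<in> Q0" "c + r *\<^sub>R axis undefined 1 \<in> Q0" using sub by auto
    then have "c0 $ undefined \<le> c $ undefined" "c $ undefined + r \<le> c0 $ undefined + r0"
      by (auto simp: Q0_def cube_def axis_def dest!: spec[of _ undefined])
    then have rr0: "r \<le> r0" by linarith
    have "mixed_content \<mu> q f (A \<inter> cube c r)
      \<le> ennreal (2 ^ m * n powr \<mu> * (C1 * (1 + 1)) powr q * b powr (q - real m) * r ^ CARD('n))"
    proof (rule mixed_content_scaled_box_count[where u = "\<lambda>i x. x $ i" and B = "- (R \<union> H)" and s = "real l + \<alpha>"
          and c = "\<lambda>i. c $ i"])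
      show "C1 * (1 + 1) * r \<le> 1"
      proof -
        have "C1 * 2 * r \<le> C1 * 2 * r0" using rr0 C1(1) by (intro mult_left_mono) auto
        then have "C1 * 2 * r \<le> 1" using r0(3) by linarith
        then show ?thesis by (simp only: one_add_one)
      qed
      show "dist x y \<le> n * r" if "x \<in> A \<inter> cube c r" "y \<in> A \<inter> cube c r" for x y
        using dist_cube_le[of x c r y] that by (auto simp: n_def)
      show "c $ i \<le> x $ i \<and> x $ i \<le> c $ i + 1 * r" if "x \<in> A \<inter> cube c r" for i x
        using that by (auto simp: cube_def)
      fix x y \<delta> assume x: "x \<in> A \<inter> cube c r" and y: "y \<in> A \<inter> cube c r" and \<delta>: "0 \<le> \<delta>"
        and P: "\<And>i. i \<in> - (R \<union> H) \<Longrightarrow> \<bar>x $ i - y $ i\<bar> \<le> \<delta>"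
      \<comment> \<open>go from \<open>x\<close> to \<open>y\<close> through \<open>w\<close>: first change the free coordinates, using the chain at the point \<open>x\<close>
        of \<open>A\<close>, then the at most $m$ counted ones, using the Lipschitz bound\<close>
      define w where "w = (\<chi> i. if i \<in> R then y $ i else x $ i)"
      have w: "w \<in> cube c r" using x y by (auto simp: w_def cube_def)
      have xyQ: "x \<in> Q0" "y \<in> Q0" "w \<in> Q0" using x y w sub by auto
      have "dist w y \<le> (\<Sum>i\<in>UNIV. \<bar>w $ i - y $ i\<bar>)" by (rule dist_vec_le_sum)
      also have "\<dots> \<le> (\<Sum>i\<in>(UNIV::'n set). \<delta>)"
      proof (rule sum_mono)
        fix i
        show "\<bar>w $ i - y $ i\<bar> \<le> \<delta>"
          using P[of i] const[of i x y] x y \<delta> by (cases "i \<in> R"; cases "i \<in> H") (auto simp: w_def)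
      qed
      finally have wy: "dist w y \<le> n * \<delta>" by (simp add: n_def)
      have "dist (f w) (f y) \<le> K * dist w y" by (rule KQ[OF xyQ(3,2)])
      also have "\<dots> \<le> K * (n * \<delta>)" using wy K by (intro mult_left_mono)
      finally have 1: "dist (f w) (f y) \<le> K * n * \<delta>" by simp
      have incr: "\<bar>f w $ j - f x $ j\<bar> \<le> (n * (n * r) * C) ^ (l - 0) * (C0 * (b * r powr \<alpha>))" for j
        unfolding n_def
      proof (rule increment_le[OF C convex_cube[of c r], where i = 0 and g = "\<lambda>x. f x $ j"])
        show "cube c r \<subseteq> U" using sub Q0U by auto
        show "norm (p - x) \<le> real CARD('n) * r" if "p \<in> cube c r" for p
          using dist_cube_le[of p c r x] that x by (auto simp: dist_norm)
        show "(\<lambda>x. f x $ j) \<in> F 0" by (simp add: F_0)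
        show "w $ a = x $ a" if "a \<notin> R" for a using that by (simp add: w_def)
      qed (use x w r b small C0 in auto)
      have "dist (f w) (f x) \<le> (\<Sum>j\<in>UNIV. \<bar>f w $ j - f x $ j\<bar>)" by (rule dist_vec_le_sum)
      also have "\<dots> \<le> (\<Sum>j\<in>(UNIV::'d set). (n * (n * r) * C) ^ l * (C0 * (b * r powr \<alpha>)))"
        using incr by (intro sum_mono) simp
      also have "\<dots> = real CARD('d) * ((n * n * C) ^ l * C0) * (b * (r powr real l * r powr \<alpha>))"
        using r by (simp add: power_mult_distrib powr_realpow mult_ac)
      also have "r powr real l * r powr \<alpha> = r powr (real l + \<alpha>)" by (simp add: powr_add)
      finally have 2: "dist (f w) (f x) \<le> real CARD('d) * ((n * n * C) ^ l * C0) * (b * r powr (real l + \<alpha>))" .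
      have "dist (f x) (f y) \<le> dist (f w) (f x) + dist (f w) (f y)" by (rule dist_triangle3)
      also have "\<dots> \<le> C1 * (b * r powr (real l + \<alpha>)) + C1 * \<delta>"
      proof (rule add_mono)
        show "dist (f w) (f x) \<le> C1 * (b * r powr (real l + \<alpha>))"
          by (rule order_trans[OF 2 mult_right_mono[OF C1(3)]]) (use b in simp)
        show "dist (f w) (f y) \<le> C1 * \<delta>" by (rule order_trans[OF 1 mult_right_mono[OF C1(2) \<delta>]])
      qed
      finally show "dist (f x) (f y) \<le> C1 * (\<delta> + b * r powr (real l + \<alpha>))" by (simp add: algebra_simps)
    qed (use q l \<alpha> card \<mu> r rr0 r0 b C1 n1 in auto)
    then show ?thesis by (simp add: Kc_def)
  qed
  have null: "mixed_content \<mu> q f ((A \<inter> Q0) \<inter> cube c0 r0) = 0"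
  proof (rule mixed_content_cube_null[OF q0 r0(1), where K = Kc])
    fix c r assume r: "0 < r" and sub: "cube c r \<subseteq> cube c0 r0"
    have e: "A \<inter> Q0 \<inter> cube c r = A \<inter> cube c r" using sub by (auto simp: Q0_def)
    show "mixed_content \<mu> q f (A \<inter> Q0 \<inter> cube c r) \<le> ennreal (Kc * r ^ CARD('n))"
    proof (cases "A \<inter> cube c r = {}")
      case True
      then show ?thesis using q0 by (simp add: e)
    next
      case False
      then obtain x where x: "x \<in> A" "x \<in> cube c r" by auto
      have "\<bar>g p\<bar> \<le> C0 * (1 * r powr \<alpha>)" if g: "g \<in> F l" and p: "p \<in> cube c r" for g p
      proof -
        have "\<bar>g p - g x\<bar> \<le> L * dist p x powr \<alpha>" using LQ[OF g, of p x] p x sub by (auto simp: Q0_def)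
        also have "\<dots> \<le> L * (n * r) powr \<alpha>"
          using dist_cube_le[OF p x(2)] L \<alpha> by (intro mult_left_mono powr_mono2) (auto simp: n_def)
        also have "\<dots> = L * (n powr \<alpha> * r powr \<alpha>)" using r n1 by (simp add: powr_mult)
        also have "\<dots> \<le> L * (n * r powr \<alpha>)"
          using powr_mono[of \<alpha> 1 n] \<alpha> n1 L by (intro mult_left_mono mult_right_mono) auto
        also have "\<dots> \<le> C0 * (1 * r powr \<alpha>)" by (simp add: C0_def algebra_simps)
        finally show ?thesis using vanish[OF l order_refl g x(1)] by simp
      qed
      then show ?thesis using cost[OF r, of c 1] sub e by (simp add: Q0_def)
    qed
  next
    fix \<epsilon> :: real assume \<epsilon>: "0 < \<epsilon>"
    obtain b where b: "0 < b" "b \<le> 1" "Kc * b powr (q - real m) \<le> \<epsilon>"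
      using exists_small_factor[OF \<epsilon> Kc, of "q - real m"] q by auto
    have contF: "continuous_on Q0 g" if "g \<in> F l" for g
      using C_loc_continuous[OF holder[OF that]] Q0U by (rule continuous_on_subset)
    have "compact Q0" unfolding Q0_def by (rule compact_cube)
    then have "\<exists>N\<ge>1. \<exists>t>0. \<forall>c r. 0 < r \<longrightarrow> r \<le> t \<longrightarrow> cube c r \<subseteq> Q0 \<longrightarrow>
       (\<forall>\<kappa>\<in>grid N. A \<inter> Q0 \<inter> subcube c r N \<kappa> \<noteq> {}) \<longrightarrow>
       (\<forall>g\<in>F l. \<forall>p\<in>cube c r. \<bar>g p\<bar> \<le> C0 * (b * r powr \<alpha>))"
      unfolding C0_def n_def
      using contF LQ vanish[OF l order_refl] b L(1)
      by (intro small_on_dense_cubes finite_F \<alpha>) auto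
    then obtain N t where N: "N \<ge> 1" and t: "t > 0" and
      dense': "\<forall>c r. 0 < r \<longrightarrow> r \<le> t \<longrightarrow> cube c r \<subseteq> Q0 \<longrightarrow>
       (\<forall>\<kappa>\<in>grid N. A \<inter> Q0 \<inter> subcube c r N \<kappa> \<noteq> {}) \<longrightarrow>
       (\<forall>g\<in>F l. \<forall>p\<in>cube c r. \<bar>g p\<bar> \<le> C0 * (b * r powr \<alpha>))"
      by (elim exE conjE) (rule that)
    have dense: "\<bar>g p\<bar> \<le> C0 * (b * r powr \<alpha>)" if "0 < r" "r \<le> t" "cube c r \<subseteq> Q0"
     "\<forall>\<kappa>\<in>grid N. A \<inter> Q0 \<inter> subcube c r N \<kappa> \<noteq> {}" "g \<in> F l" "p \<in> cube c r" for c r g p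
      using dense'[rule_format, of r c g p] that by simp
    have "(\<exists>\<kappa>\<in>grid N. A \<inter> Q0 \<inter> subcube c r N \<kappa> = {}) \<or>
        mixed_content \<mu> q f (A \<inter> Q0 \<inter> cube c r) \<le> ennreal (\<epsilon> * r ^ CARD('n))"
      if r: "0 < r" "r \<le> t" and sub: "cube c r \<subseteq> cube c0 r0" for c r
    proof (rule disjCI)
      assume "\<not> mixed_content \<mu> q f (A \<inter> Q0 \<inter> cube c r) \<le> ennreal (\<epsilon> * r ^ CARD('n))"
      then have not: "\<not> mixed_content \<mu> q f (A \<inter> cube c r) \<le> ennreal (\<epsilon> * r ^ CARD('n))"
        using sub by (simp add: Q0_def Int_assoc Int_absorb1)
      show "\<exists>\<kappa>\<in>grid N. A \<inter> Q0 \<inter> subcube c r N \<kappa> = {}"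
      proof (rule ccontr)
        assume "\<not> (\<exists>\<kappa>\<in>grid N. A \<inter> Q0 \<inter> subcube c r N \<kappa> = {})"
        then have "mixed_content \<mu> q f (A \<inter> cube c r) \<le> ennreal (Kc * b powr (q - real m) * r ^ CARD('n))"
          using dense[OF r] sub b by (intro cost[OF r(1)]) (auto simp: Q0_def)
        also have "\<dots> \<le> ennreal (\<epsilon> * r ^ CARD('n))"
          using b r by (intro ennreal_leI mult_right_mono) auto
        finally show False using not by simp
      qed
    qed
    then show "\<exists>N\<ge>1. \<exists>t>0. \<forall>c r. 0 < r \<longrightarrow> r \<le> t \<longrightarrow> cube c r \<subseteq> cube c0 r0 \<longrightarrow>
        (\<exists>\<kappa>\<in>grid N. A \<inter> Q0 \<inter> subcube c r N \<kappa> = {}) \<or>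
        mixed_content \<mu> q f (A \<inter> Q0 \<inter> cube c r) \<le> ennreal (\<epsilon> * r ^ CARD('n))"
      using N t by blast
  qed
  have "ball x0 (r0 / 2) \<subseteq> Q0" unfolding Q0_def c0_def by (rule ball_subset_cube)
  then have "mixed_content \<mu> q f (A \<inter> ball x0 (r0 / 2)) \<le> mixed_content \<mu> q f ((A \<inter> Q0) \<inter> cube c0 r0)"
    by (intro mixed_content_mono) (auto simp: Q0_def)
  then have "mixed_content \<mu> q f (A \<inter> ball x0 (r0 / 2)) = 0" using null by simp
  then show "\<exists>U. open U \<and> x0 \<in> U \<and> mixed_content \<mu> q f (A \<inter> U) = 0"
    using r0 by (intro exI[of _ "ball x0 (r0 / 2)"]) auto
qed

lemma (in coordinate_change) mixed_content_null_transfer: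
  assumes "mixed_content \<mu> q (f \<circ> \<Psi>) (V \<inter> \<Psi> -` A) = 0"
  shows "mixed_content \<mu> q f (A \<inter> U) = 0"
proof -
  have "mixed_content \<mu> q f (\<Psi> ` (V \<inter> \<Psi> -` A)) = 0"
    using \<Psi>_lipschitz by (intro mixed_content_null_image[OF K _ assms]) auto
  then show ?thesis by (simp add: image_\<Psi> Int_commute)
qed

text \<open>
If a function $g$ vanishing on \<open>A\<close> becomes the coordinate $a$, this coordinate moves from the free to the
constant ones. The remaining free directions are mixed only with the direction $a$, which was free
before, so the control of derivatives persists with a larger constant.
\<close>
lemma vanishing_chain_pullback:
  assumes vc: "vanishing_chain f A U R H F l" and cc: "coordinate_change a g D W V \<Psi> K"
    and W: "W \<subseteq> U" and a: "a \<in> R" and gA: "\<And>x. x \<in> A \<Longrightarrow> g x = 0"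
  shows "vanishing_chain (f \<circ> \<Psi>) (V \<inter> \<Psi> -` A) V (R - {a}) (insert a H) (\<lambda>i. (\<lambda>h y. h (\<Psi> y)) ` F i) l"
proof -
  interpret vanishing_chain f A U R H F l by fact
  interpret cc: coordinate_change a g D W V \<Psi> K by fact
  have \<Psi>U: "\<Psi> y \<in> U" if "y \<in> V" for y using cc.\<Psi>_in that W by auto
  show ?thesis
  proof
    show "open V" by (rule cc.open_V)
    show "locally_lipschitz V (f \<circ> \<Psi>)"
      by (rule locally_lipschitz_compose[OF lip \<Psi>U cc.K cc.\<Psi>_lipschitz])
    show "(\<lambda>h y. h (\<Psi> y)) ` F 0 = range (\<lambda>c x. (f \<circ> \<Psi>) x $ c)" by (simp add: F_0 image_image)
    show "finite ((\<lambda>h y. h (\<Psi> y)) ` F l)" using finite_F by simp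
    show "1 \<le> l" by (rule l)
    show "g' x = 0" if "1 \<le> i" "i \<le> l" "g' \<in> (\<lambda>h y. h (\<Psi> y)) ` F i" "x \<in> V \<inter> \<Psi> -` A" for i g' x
      using vanish that by auto
    show "x $ i = y $ i" if "i \<in> insert a H" "x \<in> V \<inter> \<Psi> -` A" "y \<in> V \<inter> \<Psi> -` A" for i x y
    proof (cases "i = a")
      case True
      then show ?thesis using that gA cc.h_\<Psi>[of x] cc.h_\<Psi>[of y] by simp
    next
      case False
      then show ?thesis using that const[of i "\<Psi> x" "\<Psi> y"] cc.\<Psi>_nth[of x i] cc.\<Psi>_nth[of y i] by simp
    qed
    fix i assume i: "i < l"
    obtain C where C: "C \<ge> 0" "\<forall>h\<in>F i. \<forall>x\<in>U. \<exists>d. has_gradient h d x \<and>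
     (\<forall>a\<in>R. \<forall>B\<ge>0. (\<forall>h\<in>F (Suc i). \<bar>h x\<bar> \<le> B) \<longrightarrow> \<bar>d a\<bar> \<le> C * B)"
      using ctrl[OF i] unfolding controls_def by blast
    show "controls V (R - {a}) ((\<lambda>h y. h (\<Psi> y)) ` F (Suc i)) ((\<lambda>h y. h (\<Psi> y)) ` F i)"
      unfolding controls_def
    proof (intro exI[of _ "C * (1 + K)"] conjI ballI)
      show "0 \<le> C * (1 + K)" using C cc.K by simp
      fix h' y assume h': "h' \<in> (\<lambda>h y. h (\<Psi> y)) ` F i" and y: "y \<in> V"
      obtain h where h: "h \<in> F i" "h' = (\<lambda>y. h (\<Psi> y))" using h' by auto
      obtain d where d: "has_gradient h d (\<Psi> y)"
        "\<And>a B. a \<in> R \<Longrightarrow> 0 \<le> B \<Longrightarrow> (\<forall>h\<in>F (Suc i). \<bar>h (\<Psi> y)\<bar> \<le> B) \<Longrightarrow> \<bar>d a\<bar> \<le> C * B"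
        using C(2) h(1) \<Psi>U[OF y] by blast
      let ?d = "\<lambda>b. if b = a then d a / D a (\<Psi> y) else d b - d a * (D b (\<Psi> y) / D a (\<Psi> y))"
      have "has_gradient h' ?d y"
        unfolding h(2) using d(1) cc.\<Psi>_deriv[OF y] cc.nz[OF cc.\<Psi>_in[OF y]] by (rule has_gradient_compose)
      moreover have "\<bar>?d b\<bar> \<le> C * (1 + K) * B"
        if b: "b \<in> R - {a}" and B: "0 \<le> B" and hB: "\<forall>h\<in>(\<lambda>h y. h (\<Psi> y)) ` F (Suc i). \<bar>h y\<bar> \<le> B" for b B
      proof -
        have hB': "\<forall>h\<in>F (Suc i). \<bar>h (\<Psi> y)\<bar> \<le> B" using hB by auto
        have 1: "\<bar>d b\<bar> \<le> C * B" "\<bar>d a\<bar> \<le> C * B" using d(2) hB' B b a by auto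
        have "\<bar>d a * (D b (\<Psi> y) / D a (\<Psi> y))\<bar> \<le> (C * B) * K"
          unfolding abs_mult using 1 cc.ratio[OF cc.\<Psi>_in[OF y], of b] C B by (intro mult_mono) auto
        then have "\<bar>d b - d a * (D b (\<Psi> y) / D a (\<Psi> y))\<bar> \<le> C * B + (C * B) * K" using 1(1) by linarith
        then show ?thesis using b by (simp add: algebra_simps)
      qed
      ultimately show "\<exists>d. has_gradient h' d y \<and> (\<forall>b\<in>R - {a}. \<forall>B\<ge>0.
          (\<forall>h\<in>(\<lambda>h y. h (\<Psi> y)) ` F (Suc i). \<bar>h y\<bar> \<le> B) \<longrightarrow> \<bar>d b\<bar> \<le> C * (1 + K) * B)"
        by (intro exI[of _ ?d] conjI ballI allI impI)
    qed
  qed auto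
qed

text \<open>
Induction on $j + |R|$. At points where all free derivatives of the last generation vanish, these
derivatives form a new generation of lower order $j - 1$. Near any other point some function of the last
generation has a non-zero free derivative and can be made a constant coordinate, which decreases
$|R|$. The order $l + j + \alpha$ available in the end is the same in both cases.
\<close>
theorem mixed_content_null_of_vanishing_chain:
  fixes f :: "real^'n \<Rightarrow> real^'d"
  assumes \<alpha>: "0 \<le> \<alpha>" "\<alpha> \<le> 1" and q: "q > real m"
  shows "vanishing_chain f A U R H F l \<Longrightarrow> (\<And>g. g \<in> F l \<Longrightarrow> C_loc j \<alpha> U g) \<Longrightarrow>
    card (- (R \<union> H)) \<le> m \<Longrightarrow>
    \<mu> = real CARD('n) - real m - (real l + real j + \<alpha>) * (q - real m) \<Longrightarrow>
    mixed_content \<mu> q f A = 0"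
proof (induction "j + card R" arbitrary: f A U R H F l j rule: less_induct)
  case less
  interpret vanishing_chain f A U R H F l by (rule less.prems)
  show ?case
  proof (cases j)
    case 0
    then show ?thesis using less.prems \<alpha> q by (intro mixed_content_null_of_holder) auto
  next
    case (Suc j')
    have q0: "q > 0" using q by linarith
    have "\<forall>g\<in>F l. \<exists>G. (\<forall>x\<in>U. has_gradient g (\<lambda>i. G i x) x) \<and> (\<forall>i. C_loc j' \<alpha> U (G i))"
      using less.prems(2) Suc by auto
    from bchoice[OF this] obtain G where G: "\<And>g x. g \<in> F l \<Longrightarrow> x \<in> U \<Longrightarrow> has_gradient g (\<lambda>i. G g i x) x"
      "\<And>g i. g \<in> F l \<Longrightarrow> C_loc j' \<alpha> U (G g i)" by blast
    define F' where "F' = F(Suc l := (\<lambda>(g, a). G g a) ` (F l \<times> R))"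
    define A1 where "A1 = {x \<in> A. \<forall>g\<in>F l. \<forall>a\<in>R. G g a x = 0}"
    have "mixed_content \<mu> q f A1 = 0"
    proof (rule less.hyps[of j' R])
      show "j' + card R < j + card R" using Suc by simp
      show "vanishing_chain f A1 U R H F' (Suc l)"
      proof
        show "A1 \<subseteq> U" using A_sub by (auto simp: A1_def)
        show "F' 0 = range (\<lambda>c x. f x $ c)" by (simp add: F'_def F_0)
        show "finite (F' (Suc l))" using finite_F by (simp add: F'_def)
        show "g x = 0" if "1 \<le> i" "i \<le> Suc l" "g \<in> F' i" "x \<in> A1" for i g x
          using that vanish[of i g x] by (cases "i = Suc l") (auto simp: F'_def A1_def)
        show "x $ i = y $ i" if "i \<in> H" "x \<in> A1" "y \<in> A1" for i x y
          using that const by (auto simp: A1_def)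
        show "controls U R (F' (Suc i)) (F' i)" if i: "i < Suc l" for i
        proof (cases "i = l")
          case True
          have "\<exists>d. has_gradient g d x \<and> (\<forall>a\<in>R. \<forall>B\<ge>0. (\<forall>h\<in>F' (Suc l). \<bar>h x\<bar> \<le> B) \<longrightarrow> \<bar>d a\<bar> \<le> 1 * B)"
            if "g \<in> F l" "x \<in> U" for g x
            using that G(1) by (intro exI[of _ "\<lambda>i. G g i x"]) (auto simp: F'_def)
          then show ?thesis using True unfolding controls_def
            by (intro exI[of _ 1]) (auto simp: F'_def)
        next
          case False
          then show ?thesis using i ctrl[of i] by (simp add: F'_def)
        qed
      qed (use open_U lip in auto)
      show "C_loc j' \<alpha> U g" if "g \<in> F' (Suc l)" for g using that G(2) by (auto simp: F'_def)
    qed (use less.prems Suc in \<open>auto simp: algebra_simps\<close>)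
    moreover have "mixed_content \<mu> q f (A - A1) = 0"
    proof (rule mixed_content_null_local[OF q0])
      fix x0 assume x0: "x0 \<in> A - A1"
      then obtain g a where ga: "g \<in> F l" "a \<in> R" "G g a x0 \<noteq> 0" by (auto simp: A1_def)
      have x0U: "x0 \<in> U" using x0 A_sub by auto
      obtain W V \<Psi> K where cc: "coordinate_change a g (G g) W V \<Psi> K" and W: "x0 \<in> W" "W \<subseteq> U"
        using coordinate_change_exists[OF open_U x0U G(1)[OF ga(1)] C_loc_continuous[OF G(2)[OF ga(1)]] ga(3)]
        by blast
      interpret cc: coordinate_change a g "G g" W V \<Psi> K by fact
      have "mixed_content \<mu> q (f \<circ> \<Psi>) (V \<inter> \<Psi> -` A) = 0"
      proof (rule less.hyps[of j "R - {a}"])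
        have "card (R - {a}) < card R" using ga(2) by (intro card_Diff1_less) auto
        then show "j + card (R - {a}) < j + card R" by simp
        show "vanishing_chain (f \<circ> \<Psi>) (V \<inter> \<Psi> -` A) V (R - {a}) (insert a H) (\<lambda>i. (\<lambda>h y. h (\<Psi> y)) ` F i) l"
          using less.prems(1) cc W(2) ga(2) vanish[OF l order_refl ga(1)] by (rule vanishing_chain_pullback)
        show "C_loc j \<alpha> V h" if h: "h \<in> (\<lambda>h y. h (\<Psi> y)) ` F l" for h
        proof -
          obtain h' where h': "h' \<in> F l" "h = (\<lambda>y. h' (\<Psi> y))" using h by auto
          have "C_loc j' \<alpha> W (G g b)" for b using C_loc_subset[OF G(2)[OF ga(1)] W(2)] .
          moreover have "C_loc j \<alpha> W h'" using C_loc_subset[OF less.prems(2)[OF h'(1)] W(2)] .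
          ultimately show ?thesis unfolding h'(2) using \<alpha> Suc by (intro cc.C_loc_compose[of \<alpha> j' j h']) auto
        qed
        have "- (R - {a} \<union> insert a H) = - (R \<union> H)" using ga(2) by auto
        then show "card (- (R - {a} \<union> insert a H)) \<le> m" using less.prems(3) by simp
      qed (rule less.prems(4))
      then have "mixed_content \<mu> q f (A \<inter> W) = 0" by (rule cc.mixed_content_null_transfer)
      then have "mixed_content \<mu> q f ((A - A1) \<inter> W) = 0"
        using mixed_content_mono[of "(A - A1) \<inter> W" "A \<inter> W" \<mu> q f] by auto
      then show "\<exists>U. open U \<and> x0 \<in> U \<and> mixed_content \<mu> q f ((A - A1) \<inter> U) = 0"
        using W(1) cc.open_U by blast
    qed
    ultimately have "mixed_content \<mu> q f (A1 \<union> (A - A1)) = 0" by (rule mixed_content_null_Un[OF q0])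
    moreover have "A1 \<union> (A - A1) = A" by (auto simp: A1_def)
    ultimately show ?thesis by simp
  qed
qed

section \<open>Points of low rank of a smooth map\<close>

text \<open>
If the coordinates in \<open>P\<close> are themselves components of $f$, the derivative of $f$ maps onto these
components.
\<close>
lemma card_straight_coordinates_le_rank:
  fixes f :: "real^'n \<Rightarrow> real^'d"
  assumes U: "open U" "x \<in> U" and str: "\<And>p y. p \<in> P \<Longrightarrow> y \<in> U \<Longrightarrow> f y $ c p = y $ p"
    and f': "(f has_derivative f') (at x)"
  shows "card P \<le> dim (range f')"
proof -
  have lin: "linear f'" using f' by (rule has_derivative_linear)
  have nth: "f' h $ c p = h $ p" if p: "p \<in> P" for h p
  proof -
    have 1: "((\<lambda>y. f y $ c p) has_derivative (\<lambda>h. f' h $ c p)) (at x)"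
      using f' by (rule bounded_linear.has_derivative[OF bounded_linear_vec_nth])
    have "((\<lambda>y. y $ p) has_derivative (\<lambda>h. h $ p)) (at x)"
      by (rule bounded_linear_imp_has_derivative[OF bounded_linear_vec_nth])
    then have "((\<lambda>y. f y $ c p) has_derivative (\<lambda>h. h $ p)) (at x)"
      by (rule has_derivative_transform_within_open[OF _ U]) (simp add: str p)
    then have "(\<lambda>h. f' h $ c p) = (\<lambda>h. h $ p)" using 1 by (rule has_derivative_unique[rotated])
    then show ?thesis by metis
  qed
  define T :: "real^'d \<Rightarrow> real^'n" where "T w = (\<chi> p. if p \<in> P then w $ c p else 0)" for w
  have T: "linear T" by (rule linearI) (auto simp: T_def vec_eq_iff)
  have sub: "{v :: real^'n. \<forall>i. i \<notin> P \<longrightarrow> v $ i = 0} \<subseteq> T ` range f'"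
  proof
    fix v :: "real^'n" assume "v \<in> {v. \<forall>i. i \<notin> P \<longrightarrow> v $ i = 0}"
    then have "v = T (f' v)" by (auto simp: T_def vec_eq_iff nth)
    then show "v \<in> T ` range f'" by blast
  qed
  have "card P = dim {v :: real^'n. \<forall>i. i \<notin> P \<longrightarrow> v $ i = 0}"
    unfolding dim_vec_eq[symmetric] by (rule dim_substandard_cart[symmetric])
  also have "\<dots> \<le> dim (T ` range f')" by (rule dim_subset[OF sub])
  also have "\<dots> \<le> dim (range f')" by (rule dim_image_le[OF T])
  finally show ?thesis .
qed

text \<open>
Induction on the number of coordinates outside \<open>P\<close>, the set of coordinates that are already components
of $f$. Where some component has a non-zero derivative in a coordinate outside \<open>P\<close>, it
is made a coordinate. Where there is none, the derivatives of $f$ in the directions outside \<open>P\<close>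
form the first generation of a chain with free directions $-P$ and no constant ones, and
$|P| \le m$ by the rank condition.
\<close>
theorem mixed_content_null_of_low_rank:
  fixes f :: "real^'n \<Rightarrow> real^'d"
  assumes \<alpha>: "0 \<le> \<alpha>" "\<alpha> \<le> 1" and q: "q > real m"
    and \<mu>: "\<mu> = real CARD('n) - real m - (real (Suc k) + \<alpha>) * (q - real m)"
  shows "open U \<Longrightarrow> A \<subseteq> U \<Longrightarrow> (\<And>j. C_loc (Suc k) \<alpha> U (\<lambda>x. f x $ j)) \<Longrightarrow>
    (\<And>p y. p \<in> P \<Longrightarrow> y \<in> U \<Longrightarrow> f y $ c p = y $ p) \<Longrightarrow>
    (\<And>x. x \<in> A \<Longrightarrow> \<exists>f'. (f has_derivative f') (at x) \<and> dim (range f') \<le> m) \<Longrightarrow>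
    mixed_content \<mu> q f A = 0"
proof (induction "card (- P)" arbitrary: f A U P c rule: less_induct)
  case less
  note U = less.prems(1) and AU = less.prems(2) and smooth = less.prems(3) and str = less.prems(4)
    and rank = less.prems(5)
  have q0: "q > 0" using q by linarith
  show ?case
  proof (cases "A = {}")
    case True
    then show ?thesis using q0 by simp
  next
    case False
    then obtain x f' where x: "x \<in> A" "(f has_derivative f') (at x)" "dim (range f') \<le> m" using rank by blast
    then have card: "card P \<le> m"
      using card_straight_coordinates_le_rank[OF U _ str x(2)] AU by fastforce
    have "\<forall>j. \<exists>G. (\<forall>x\<in>U. has_gradient (\<lambda>x. f x $ j) (\<lambda>i. G i x) x) \<and> (\<forall>i. C_loc k \<alpha> U (G i))"
      using smooth by auto
    then obtain G where G: "\<And>j x. x \<in> U \<Longrightarrow> has_gradient (\<lambda>x. f x $ j) (\<lambda>i. G j i x) x"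
      "\<And>j i. C_loc k \<alpha> U (G j i)" unfolding choice_iff by blast
    define F where "F i = (if i = 0 then range (\<lambda>j x. f x $ j) else (\<lambda>(j, a). G j a) ` (UNIV \<times> - P))" for i :: nat
    define A1 where "A1 = {x \<in> A. \<forall>j. \<forall>a\<in>- P. G j a x = 0}"
    have "mixed_content \<mu> q f A1 = 0"
    proof (rule mixed_content_null_of_vanishing_chain[OF \<alpha> q])
      show "vanishing_chain f A1 U (- P) {} F 1"
      proof
        show "locally_lipschitz U f" using U smooth by (rule locally_lipschitz_of_C_loc)
        show "controls U (- P) (F (Suc i)) (F i)" if "i < 1" for i
          unfolding controls_def
        proof (intro exI[of _ 1] conjI ballI)
          fix g x assume gF: "g \<in> F i" and "x \<in> U"
          have "g \<in> range (\<lambda>j x. f x $ j)" using gF that by (simp add: F_def)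
          then obtain j where "g = (\<lambda>x. f x $ j)" by auto
          then show "\<exists>d. has_gradient g d x \<and> (\<forall>a\<in>- P. \<forall>B\<ge>0. (\<forall>h\<in>F (Suc i). \<bar>h x\<bar> \<le> B) \<longrightarrow> \<bar>d a\<bar> \<le> 1 * B)"
            using G(1)[OF \<open>x \<in> U\<close>] by (intro exI[of _ "\<lambda>i. G j i x"]) (auto simp: F_def)
        qed simp
      qed (use U AU in \<open>auto simp: A1_def F_def\<close>)
      show "C_loc k \<alpha> U g" if "g \<in> F 1" for g using that G(2) by (auto simp: F_def)
      show "\<mu> = real CARD('n) - real m - (real 1 + real k + \<alpha>) * (q - real m)" using \<mu> by simp
    qed (use card in simp)
    moreover have "mixed_content \<mu> q f (A - A1) = 0"
    proof (rule mixed_content_null_local[OF q0])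
      fix x0 assume x0: "x0 \<in> A - A1"
      then obtain j a where ja: "a \<notin> P" "G j a x0 \<noteq> 0" by (auto simp: A1_def)
      have x0U: "x0 \<in> U" using x0 AU by auto
      obtain W V \<Psi> K where cc: "coordinate_change a (\<lambda>x. f x $ j) (G j) W V \<Psi> K" and W: "x0 \<in> W" "W \<subseteq> U"
        using coordinate_change_exists[OF U x0U G(1) C_loc_continuous[OF G(2)] ja(2)] by blast
      interpret cc: coordinate_change a "\<lambda>x. f x $ j" "G j" W V \<Psi> K by fact
      have "mixed_content \<mu> q (f \<circ> \<Psi>) (V \<inter> \<Psi> -` A) = 0"
      proof (rule less.hyps[of "insert a P" V _ _ "c(a := j)"])
        show "card (- insert a P) < card (- P)"
          using ja(1) by (intro psubset_card_mono) auto
        show "C_loc (Suc k) \<alpha> V (\<lambda>x. (f \<circ> \<Psi>) x $ i)" for i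
        proof -
          have "C_loc k \<alpha> W (G j b)" for b using C_loc_subset[OF G(2) W(2)] .
          moreover have "C_loc (Suc k) \<alpha> W (\<lambda>x. f x $ i)" using C_loc_subset[OF smooth W(2)] .
          ultimately show ?thesis
            using \<alpha> cc.C_loc_compose[of \<alpha> k "Suc k" "\<lambda>x. f x $ i"] by (simp del: C_loc.simps)
        qed
        show "(f \<circ> \<Psi>) y $ (c(a := j)) p = y $ p" if "p \<in> insert a P" "y \<in> V" for p y
        proof (cases "p = a")
          case True then show ?thesis using cc.h_\<Psi>[OF that(2)] by simp
        next
          case False
          then show ?thesis using that str[of p "\<Psi> y"] cc.\<Psi>_in[OF that(2)] W cc.\<Psi>_nth[OF that(2) False] by auto
        qed
        show "\<exists>f'. (f \<circ> \<Psi> has_derivative f') (at y) \<and> dim (range f') \<le> m" if y: "y \<in> V \<inter> \<Psi> -` A" for y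
        proof -
          obtain f' where f': "(f has_derivative f') (at (\<Psi> y))" "dim (range f') \<le> m" using rank y by auto
          have "(f \<circ> \<Psi> has_derivative f' \<circ> unstraighten_deriv a (\<lambda>i. G j i (\<Psi> y))) (at y)"
            using cc.\<Psi>_deriv[of y] y f'(1) by (intro diff_chain_at) auto
          moreover have "dim (range (f' \<circ> unstraighten_deriv a (\<lambda>i. G j i (\<Psi> y)))) \<le> dim (range f')"
            by (rule dim_subset) auto
          ultimately show ?thesis using f'(2) by (metis order_trans)
        qed
      qed (use cc.open_V in auto)
      then have "mixed_content \<mu> q f (A \<inter> W) = 0" by (rule cc.mixed_content_null_transfer)
      then have "mixed_content \<mu> q f ((A - A1) \<inter> W) = 0"
        using mixed_content_mono[of "(A - A1) \<inter> W" "A \<inter> W" \<mu> q f] by auto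
      then show "\<exists>U. open U \<and> x0 \<in> U \<and> mixed_content \<mu> q f ((A - A1) \<inter> U) = 0"
        using W(1) cc.open_U by blast
    qed
    ultimately have "mixed_content \<mu> q f (A1 \<union> (A - A1)) = 0" by (rule mixed_content_null_Un[OF q0])
    moreover have "A1 \<union> (A - A1) = A" by (auto simp: A1_def)
    ultimately show ?thesis by simp
  qed
qed

section \<open>Points of low rank of a Lipschitz map\<close>

lemma emeasure_interior_cube:
  fixes c :: "real^'n" assumes "0 \<le> r"
  shows "emeasure lborel (interior (cube c r)) = ennreal (r ^ CARD('n))"
proof -
  have "emeasure lborel (interior (cube c r)) = ennreal (\<Prod>b\<in>Basis. ((\<chi> i. c $ i + r) - c) \<bullet> b)"
    unfolding cube_eq_cbox interior_cbox
    by (rule emeasure_lborel_box) (use assms in \<open>auto simp: Basis_vec_def inner_axis\<close>)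
  also have "(\<Prod>b\<in>Basis. ((\<chi> i. c $ i + r) - c) \<bullet> b) = (\<Prod>b\<in>(Basis :: (real^'n) set). r)"
    by (rule prod.cong) (auto simp: Basis_vec_def inner_axis)
  finally show ?thesis by simp
qed

text \<open>
The part of $w$ orthogonal to the span of $B$ only depends on $e$. This measures how far the
increments of a map deviate from the range of its derivative.
\<close>
lemma norm_le_of_projection:
  fixes w e :: "'a::euclidean_space"
  assumes B: "finite B" "card B \<le> m" "\<And>b. b \<in> B \<Longrightarrow> norm b = 1" "pairwise orthogonal B"
    and v: "v \<in> span B" and w: "w = v + e"
    and small: "\<And>b. b \<in> B \<Longrightarrow> \<bar>w \<bullet> b\<bar> \<le> \<delta>" and \<delta>: "0 \<le> \<delta>"
  shows "norm w \<le> real m * \<delta> + (1 + real m) * norm e"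
proof -
  have v_eq: "v = (\<Sum>b\<in>B. (v \<bullet> b) *\<^sub>R b)"
    by (rule orthonormal_basis_expand[symmetric]) (use B v in auto)
  have sum_le: "norm (\<Sum>b\<in>B. (u \<bullet> b) *\<^sub>R b) \<le> real m * t" if "\<And>b. b \<in> B \<Longrightarrow> \<bar>u \<bullet> b\<bar> \<le> t" "0 \<le> t" for u t
  proof -
    have "norm (\<Sum>b\<in>B. (u \<bullet> b) *\<^sub>R b) \<le> (\<Sum>b\<in>B. t)"
      using that B by (intro sum_norm_le) auto
    also have "\<dots> \<le> real m * t" using B that by (simp add: mult_right_mono)
    finally show ?thesis .
  qed
  have "w = (\<Sum>b\<in>B. (w \<bullet> b) *\<^sub>R b) - (\<Sum>b\<in>B. (e \<bullet> b) *\<^sub>R b) + e"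
    using w v_eq by (simp add: inner_add_left scaleR_add_left sum.distrib)
  then have "norm w = norm ((\<Sum>b\<in>B. (w \<bullet> b) *\<^sub>R b) - (\<Sum>b\<in>B. (e \<bullet> b) *\<^sub>R b) + e)"
    by (rule arg_cong)
  also have "\<dots> \<le> norm ((\<Sum>b\<in>B. (w \<bullet> b) *\<^sub>R b) - (\<Sum>b\<in>B. (e \<bullet> b) *\<^sub>R b)) + norm e"
    by (rule norm_triangle_ineq)
  also have "\<dots> \<le> norm (\<Sum>b\<in>B. (w \<bullet> b) *\<^sub>R b) + norm (\<Sum>b\<in>B. (e \<bullet> b) *\<^sub>R b) + norm e"
    by (intro add_right_mono norm_triangle_ineq4)
  finally have "norm w \<le> norm (\<Sum>b\<in>B. (w \<bullet> b) *\<^sub>R b) + norm (\<Sum>b\<in>B. (e \<bullet> b) *\<^sub>R b) + norm e" .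
  moreover have "norm (\<Sum>b\<in>B. (w \<bullet> b) *\<^sub>R b) \<le> real m * \<delta>" using small \<delta> by (intro sum_le)
  moreover have "norm (\<Sum>b\<in>B. (e \<bullet> b) *\<^sub>R b) \<le> real m * norm e"
  proof (rule sum_le)
    show "\<bar>e \<bullet> b\<bar> \<le> norm e" if "b \<in> B" for b
      using Cauchy_Schwarz_ineq2[of e b] B(3)[OF that] by simp
  qed simp
  ultimately show ?thesis by (simp add: algebra_simps)
qed

text \<open>
The controlling functions are the components of $f$ along an orthonormal basis of the range of the
derivative at a point $x$ of $A$. The size of cube on which the linear approximation at $x$ is good to
within $b$ depends on $x$ without any uniformity, but the bound for the cost of the cube
does not. So a countable cover of a unit cube by non-overlapping cubes, each of them
small enough for one of its points, has total cost at most a small multiple of the volume.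
\<close>
theorem mixed_content_null_of_lipschitz:
  fixes f :: "real^'n \<Rightarrow> real^'d"
  assumes L: "0 \<le> L" "\<And>x y. dist (f x) (f y) \<le> L * dist x y"
    and rank: "\<And>x. x \<in> A \<Longrightarrow> \<exists>f'. (f has_derivative f') (at x) \<and> dim (range f') \<le> m"
    and q: "q > real m" and \<mu>: "\<mu> = real CARD('n) - real m - 1 * (q - real m)"
  shows "mixed_content \<mu> q f A = 0"
proof (rule mixed_content_null_local)
  show q0: "q > 0" using q by linarith
  fix x0 assume "x0 \<in> A"
  define n where "n = real CARD('n)"
  have n1: "1 \<le> n" by (simp add: n_def Suc_le_eq)
  define c0 where "c0 = (\<chi> i. x0 $ i - 1 / 2)"
  define Q0 where "Q0 = cube c0 1"
  define C where "C = 2 * n * (1 + real m)"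
  define K where "K = 2 * (L * n) + 1"
  have "0 < C" using n1 by (simp add: C_def)
  moreover have "0 < K" using n1 L(1) by (auto simp: K_def intro!: add_nonneg_pos)
  ultimately have CK: "0 < C" "0 < K" "0 < C * (K + 1)" by auto
  define Kc where "Kc = 2 ^ m * n powr \<mu> * (C * (K + 1)) powr q"
  have Kc: "Kc > 0" using n1 CK by (simp add: Kc_def)
  have "mixed_content \<mu> q f (A \<inter> Q0) \<le> 0 + ennreal e" if e: "0 < e" for e
  proof -
    obtain b where b: "0 < b" "b \<le> 1" "Kc * b powr (q - real m) \<le> e"
      using exists_small_factor[OF e Kc, of "q - real m"] q by auto
    have "\<forall>x\<in>A. \<exists>f' d. linear f' \<and> dim (range f') \<le> m \<and> d > 0 \<and>
       (\<forall>y. norm (y - x) < d \<longrightarrow> norm (f y - f x - f' (y - x)) \<le> b * norm (y - x))"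
    proof
      fix x assume "x \<in> A"
      then obtain f' where f': "(f has_derivative f') (at x)" "dim (range f') \<le> m" using rank by blast
      moreover obtain d where "d > 0" "\<forall>y. norm (y - x) < d \<longrightarrow> norm (f y - f x - f' (y - x)) \<le> b * norm (y - x)"
        using f'(1) b(1) unfolding has_derivative_at_alt by blast
      moreover have "linear f'" using f'(1) by (rule has_derivative_linear)
      ultimately show "\<exists>f' d. linear f' \<and> dim (range f') \<le> m \<and> d > 0 \<and>
       (\<forall>y. norm (y - x) < d \<longrightarrow> norm (f y - f x - f' (y - x)) \<le> b * norm (y - x))" by blast
    qed
    from bchoice[OF this] obtain f' where "\<forall>x\<in>A. \<exists>d. linear (f' x) \<and> dim (range (f' x)) \<le> m \<and> d > 0 \<and>
       (\<forall>y. norm (y - x) < d \<longrightarrow> norm (f y - f x - f' x (y - x)) \<le> b * norm (y - x))" by blast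
    from bchoice[OF this] obtain d where d: "\<And>x. x \<in> A \<Longrightarrow> linear (f' x)" "\<And>x. x \<in> A \<Longrightarrow> dim (range (f' x)) \<le> m"
      "\<And>x. x \<in> A \<Longrightarrow> d x > 0"
      "\<And>x y. x \<in> A \<Longrightarrow> norm (y - x) < d x \<Longrightarrow> norm (f y - f x - f' x (y - x)) \<le> b * norm (y - x)" by blast
    define R0 where "R0 = 1 / (C * (K + 1))"
    have R0: "R0 > 0" using CK(3) by (simp add: R0_def)
    \<comment> \<open>a cube inside a ball of radius $R_0/2$ has side at most $R_0$, which keeps the images of its pieces
      within diameter $1$\<close>
    define \<rho> where "\<rho> x = min (if x \<in> A then d x else 1) (R0 / 2)" for x
    have \<rho>: "\<rho> x > 0" for x using d(3) R0 unfolding \<rho>_def by auto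
    define \<gamma> where "\<gamma> x = ball x (\<rho> x)" for x
    have g: "gauge \<gamma>" using \<rho> by (auto simp: gauge_def \<gamma>_def)
    have cost: "mixed_content \<mu> q f (cube u r) \<le> ennreal (e * r ^ CARD('n))"
      if x: "x \<in> A" "x \<in> cube u r" and r: "0 < r" "r \<le> 1" and sub: "cube u r \<subseteq> \<gamma> x" for x u r
    proof -
      have rle: "C * (K + 1) * r \<le> 1"
      proof -
        have "u \<in> cube u r" "u + r *\<^sub>R axis undefined 1 \<in> cube u r" using r by (auto simp: cube_def axis_def)
        then have "u \<in> ball x (\<rho> x)" "u + r *\<^sub>R axis undefined 1 \<in> ball x (\<rho> x)" using sub by (auto simp: \<gamma>_def)
        then have "dist (u + r *\<^sub>R axis undefined 1) u < 2 * \<rho> x"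
          using dist_triangle3[of "u + r *\<^sub>R axis undefined 1" u x] by simp
        moreover have "dist (u + r *\<^sub>R axis undefined 1) u = r" using r by (simp add: dist_norm norm_axis_1)
        moreover have "\<rho> x \<le> R0 / 2" unfolding \<rho>_def by (rule min.cobounded2)
        ultimately have "r \<le> R0" by linarith
        then have "C * (K + 1) * r \<le> C * (K + 1) * R0" using CK(3) by (intro mult_left_mono) auto
        also have "\<dots> = 1" unfolding R0_def using CK(3) by (metis less_irrefl nonzero_mult_div_cancel_left times_divide_eq_right mult.right_neutral divide_self)
        finally show ?thesis .
      qed
      have sub_d: "norm (y - x) < d x" if "y \<in> cube u r" for y
        using sub that x(1) by (auto simp: \<gamma>_def \<rho>_def dist_norm norm_minus_commute)
      have diam: "norm (y - x) \<le> n * r" if "y \<in> cube u r" for y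
        using dist_cube_le[OF that x(2)] by (simp add: n_def dist_norm)
      obtain B where B: "pairwise orthogonal B" "\<And>b. b \<in> B \<Longrightarrow> norm b = 1" "independent B"
          "card B = dim (range (f' x))" "span B = range (f' x)"
        using orthonormal_basis_subspace[of "range (f' x)"] linear_subspace_image[OF d(1)[OF x(1)] subspace_UNIV]
        by metis
      have finB: "finite B" using B(3) by (rule independent_imp_finite)
      have cardB: "card B \<le> m" using B(4) d(2)[OF x(1)] by simp
      have "mixed_content \<mu> q f (cube u r)
        \<le> ennreal (2 ^ m * n powr \<mu> * (C * (K + 1)) powr q * b powr (q - real m) * r ^ CARD('n))"
      proof (rule mixed_content_scaled_box_count[where u = "\<lambda>b y. (f y - f x) \<bullet> b" and c = "\<lambda>_. - (L * (n * r))" and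
            B = B and s = 1])
        show "dist y z \<le> n * r" if "y \<in> cube u r" "z \<in> cube u r" for y z
          using dist_cube_le[OF that] by (simp add: n_def)
        show "- (L * (n * r)) \<le> (f y - f x) \<bullet> b' \<and> (f y - f x) \<bullet> b' \<le> - (L * (n * r)) + K * r"
          if "b' \<in> B" "y \<in> cube u r" for b' y
        proof -
          have "\<bar>(f y - f x) \<bullet> b'\<bar> \<le> norm (f y - f x)"
            using Cauchy_Schwarz_ineq2[of "f y - f x" b'] B(2)[OF that(1)] by simp
          also have "\<dots> \<le> L * norm (y - x)" using L(2)[of y x] by (simp add: dist_norm)
          also have "\<dots> \<le> L * (n * r)" using diam[OF that(2)] L(1) by (intro mult_left_mono)
          finally have *: "\<bar>(f y - f x) \<bullet> b'\<bar> \<le> L * (n * r)" .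
          have "K * r = 2 * (L * (n * r)) + r" by (simp add: K_def algebra_simps)
          then show ?thesis using * r by linarith
        qed
        fix y z \<delta> assume y: "y \<in> cube u r" and z: "z \<in> cube u r" and \<delta>: "0 \<le> \<delta>"
          and small: "\<And>b'. b' \<in> B \<Longrightarrow> \<bar>(f y - f x) \<bullet> b' - (f z - f x) \<bullet> b'\<bar> \<le> \<delta>"
        define err where "err w = f w - f x - f' x (w - x)" for w
        have err: "norm (err w) \<le> b * (n * r)" if "w \<in> cube u r" for w
        proof -
          have "norm (err w) \<le> b * norm (w - x)" unfolding err_def by (rule d(4)[OF x(1) sub_d[OF that]])
          also have "\<dots> \<le> b * (n * r)" using diam[OF that] b by (intro mult_left_mono) auto
          finally show ?thesis .
        qed
        have "norm (f y - f z) \<le> real m * \<delta> + (1 + real m) * norm (err y - err z)"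
        proof (rule norm_le_of_projection[OF finB cardB B(2,1)])
          show "f' x (y - x) - f' x (z - x) \<in> span B" unfolding B(5)
            using linear_diff[OF d(1)[OF x(1)], of "y - x" "z - x"] by (metis rangeI)
          show "f y - f z = f' x (y - x) - f' x (z - x) + (err y - err z)" by (simp add: err_def)
          show "\<bar>(f y - f z) \<bullet> b'\<bar> \<le> \<delta>" if "b' \<in> B" for b'
            using small[OF that] by (simp add: inner_diff_left)
        qed (use \<delta> in auto)
        also have "norm (err y - err z) \<le> b * (n * r) + b * (n * r)"
          using norm_triangle_ineq4[of "err y" "err z"] err[OF y] err[OF z] by linarith
        also have "real m * \<delta> + (1 + real m) * (b * (n * r) + b * (n * r)) \<le> C * (\<delta> + b * r powr 1)"
        proof -
          have "real m \<le> 1 * (1 + real m)" by simp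
          also have "\<dots> \<le> 2 * n * (1 + real m)" using n1 by (intro mult_right_mono) auto
          finally have "real m \<le> C" by (simp only: C_def)
          then have "real m * \<delta> \<le> C * \<delta>" using \<delta> by (rule mult_right_mono)
          then show ?thesis using r by (simp add: C_def algebra_simps)
        qed
        finally show "dist (f y) (f z) \<le> C * (\<delta> + b * r powr 1)" by (simp add: dist_norm mult_left_mono)
      qed (use q finB cardB \<mu> r b n1 CK rle in auto)
      also have "\<dots> \<le> ennreal (e * r ^ CARD('n))"
        using b(3) r unfolding Kc_def[symmetric] by (intro ennreal_leI mult_right_mono) auto
      finally show ?thesis .
    qed
    have Q0: "Q0 = cbox c0 (\<chi> i. c0 $ i + 1)" by (simp add: Q0_def cube_eq_cbox)
    have "box c0 (\<chi> i. c0 $ i + 1) \<noteq> {}"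
    proof -
      have "(\<chi> i. c0 $ i + 1 / 2) \<in> box c0 (\<chi> i. c0 $ i + 1)" by (simp add: mem_box_cart)
      then show ?thesis by blast
    qed
    with g obtain \<D> where \<D>: "countable \<D>" "\<Union>\<D> \<subseteq> Q0"
      "\<And>k. k \<in> \<D> \<Longrightarrow> interior k \<noteq> {} \<and> (\<exists>u v. k = cbox u v)"
      "pairwise (\<lambda>A B. interior A \<inter> interior B = {}) \<D>"
      "\<And>k. k \<in> \<D> \<Longrightarrow> \<exists>x \<in> (A \<inter> Q0) \<inter> k. k \<subseteq> \<gamma> x"
      "\<And>u v. cbox u v \<in> \<D> \<Longrightarrow> \<exists>j. \<forall>i \<in> Basis. v \<bullet> i - u \<bullet> i = ((\<chi> i. c0 $ i + 1) \<bullet> i - c0 \<bullet> i) / 2^j"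
      "A \<inter> Q0 \<subseteq> \<Union>\<D>"
      using covering_lemma[of "A \<inter> Q0" c0 "\<chi> i. c0 $ i + 1" \<gamma>] unfolding Q0 by (metis inf_le2)
    have cost\<D>: "mixed_content \<mu> q f k \<le> ennreal e * emeasure lborel (interior k)" if k: "k \<in> \<D>" for k
    proof -
      obtain u v where uv: "k = cbox u v" using \<D>(3)[OF k] by blast
      obtain j where j: "\<forall>i \<in> Basis. v \<bullet> i - u \<bullet> i = ((\<chi> i. c0 $ i + 1) \<bullet> i - c0 \<bullet> i) / 2^j"
        using \<D>(6) k uv by blast
      have "v $ i = u $ i + 1 / 2 ^ j" for i
      proof -
        have "axis i 1 \<in> (Basis :: (real^'n) set)" by (simp add: axis_in_Basis_iff)
        then have "v \<bullet> axis i 1 - u \<bullet> axis i 1 = ((\<chi> i. c0 $ i + 1) \<bullet> axis i 1 - c0 \<bullet> axis i 1) / 2^j" using j by blast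
        then show ?thesis by (simp add: inner_axis)
      qed
      then have kc: "k = cube u (1 / 2 ^ j)" unfolding uv by (auto simp: cube_def mem_box_cart)
      obtain x where "x \<in> A" "x \<in> k" "k \<subseteq> \<gamma> x" using \<D>(5)[OF k] by blast
      then have "mixed_content \<mu> q f k \<le> ennreal (e * (1 / 2 ^ j) ^ CARD('n))"
        unfolding kc by (intro cost) auto
      also have "\<dots> = ennreal e * emeasure lborel (interior k)"
        unfolding kc using e by (subst emeasure_interior_cube) (auto simp: ennreal_mult')
      finally show ?thesis .
    qed
    \<comment> \<open>an enumeration without repetitions, so that interiors stay disjoint; it is padded by empty sets
      if there are only finitely many cubes\<close>
    define X where "X i = (if i \<in> to_nat_on \<D> ` \<D> then from_nat_into \<D> i else {})" for i
    have X: "X i \<in> \<D> \<or> X i = {}" for i using \<D>(1) by (auto simp: X_def)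
    have "A \<inter> Q0 \<subseteq> (\<Union>i. X i)"
    proof
      fix x assume "x \<in> A \<inter> Q0"
      then obtain k where "k \<in> \<D>" "x \<in> k" using \<D>(7) by blast
      then have "x \<in> X (to_nat_on \<D> k)" using \<D>(1) by (simp add: X_def)
      then show "x \<in> (\<Union>i. X i)" by blast
    qed
    then have "mixed_content \<mu> q f (A \<inter> Q0) \<le> mixed_content \<mu> q f (\<Union>i. X i)" by (rule mixed_content_mono)
    also have "\<dots> \<le> (\<Sum>i. mixed_content \<mu> q f (X i))" by (rule mixed_content_UN_le)
    also have "\<dots> \<le> (\<Sum>i. ennreal e * emeasure lborel (interior (X i)))"
    proof (rule suminf_le)
      show "mixed_content \<mu> q f (X i) \<le> ennreal e * emeasure lborel (interior (X i))" for i
        using X[of i] cost\<D> q0 by auto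
    qed auto
    also have "\<dots> = ennreal e * (\<Sum>i. emeasure lborel (interior (X i)))" by (rule ennreal_suminf_cmult)
    also have "(\<Sum>i. emeasure lborel (interior (X i))) = emeasure lborel (\<Union>i. interior (X i))"
    proof (rule suminf_emeasure)
      show "disjoint_family (\<lambda>i. interior (X i))"
        unfolding disjoint_family_on_def
      proof (intro ballI impI)
        fix i j :: nat assume "i \<noteq> j"
        show "interior (X i) \<inter> interior (X j) = {}"
        proof (cases "i \<in> to_nat_on \<D> ` \<D> \<and> j \<in> to_nat_on \<D> ` \<D>")
          case True
          then obtain k k' where "k \<in> \<D>" "k' \<in> \<D>" "i = to_nat_on \<D> k" "j = to_nat_on \<D> k'" by blast
          then show ?thesis using \<D>(1,4) \<open>i \<noteq> j\<close> by (auto simp: X_def pairwise_def)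
        qed (auto simp: X_def)
      qed
    qed auto
    also have "\<dots> \<le> emeasure lborel Q0"
    proof (rule emeasure_mono)
      show "(\<Union>i. interior (X i)) \<subseteq> Q0" using X \<D>(2) interior_subset by fastforce
      show "Q0 \<in> sets lborel" by (simp add: Q0)
    qed
    also have "emeasure lborel Q0 = 1"
    proof -
      have "emeasure lborel Q0 = ennreal (\<Prod>b\<in>Basis. ((\<chi> i. c0 $ i + 1) - c0) \<bullet> b)"
        unfolding Q0 by (rule emeasure_lborel_cbox) (auto simp: Basis_vec_def inner_axis)
      also have "(\<Prod>b\<in>Basis. ((\<chi> i. c0 $ i + 1) - c0) \<bullet> b) = 1"
        by (rule prod.neutral) (auto simp: Basis_vec_def inner_axis)
      finally show ?thesis by simp
    qed
    finally show ?thesis by (simp add: mult_left_mono)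
  qed
  then have "mixed_content \<mu> q f (A \<inter> Q0) \<le> 0" by (rule ennreal_le_epsilon)
  then have null: "mixed_content \<mu> q f (A \<inter> Q0) = 0" by simp
  have "ball x0 (1 / 2) \<subseteq> Q0" unfolding Q0_def c0_def by (rule ball_subset_cube)
  then have "mixed_content \<mu> q f (A \<inter> ball x0 (1 / 2)) \<le> mixed_content \<mu> q f (A \<inter> Q0)"
    by (intro mixed_content_mono) auto
  then have "mixed_content \<mu> q f (A \<inter> ball x0 (1 / 2)) = 0" using null by simp
  then show "\<exists>U. open U \<and> x0 \<in> U \<and> mixed_content \<mu> q f (A \<inter> U) = 0"
    by (intro exI[of _ "ball x0 (1 / 2)"]) auto
qed

section \<open>Hausdorff measure of fibres\<close>

lemma ennreal_le_suminf: "f i \<le> (\<Sum>i. f i :: ennreal)"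
proof -
  have "sum f {i} \<le> (\<Sum>i. f i)" by (rule sum_le_suminf) auto
  then show ?thesis by simp
qed

text \<open>
A small total cost forces every single set to be small, so a vanishing content already gives
a vanishing measure, for which the size of the covering sets tends to zero.
\<close>
lemma hausdorff_null_of_mixed_content:
  fixes Y :: "'a::metric_space set"
  assumes q: "q > 0" and null: "mixed_content 0 q (\<lambda>x. x) Y = 0"
  shows "hausdorff q Y = 0"
proof -
  have "hausdorff_pre q t Y = 0" if t: "t > 0" for t
  proof -
    have "hausdorff_pre q t Y \<le> 0 + ennreal e" if e: "0 < e" for e
    proof -
      have "mixed_content 0 q (\<lambda>x. x) Y < ennreal (min e (t powr q))" using null e t by simp
      then obtain C r \<rho> where cov: "mixed_cover (\<lambda>x. x) Y C r \<rho>"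
        and less: "(\<Sum>i. ennreal (r i powr 0 * \<rho> i powr q)) < ennreal (min e (t powr q))"
        by (rule mixed_content_lessE)
      have C: "Y \<subseteq> (\<Union>i. C i)" "\<And>i. 0 < \<rho> i" "\<And>i. 0 < r i" "\<And>i x y. x \<in> C i \<Longrightarrow> y \<in> C i \<Longrightarrow> dist x y \<le> \<rho> i"
        using cov by (auto simp: mixed_cover_def)
      have cost_eq: "ennreal (r i powr 0 * \<rho> i powr q) = ennreal (\<rho> i powr q)" for i using C(3)[of i] by simp
      have diam: "diameter (C i) \<le> \<rho> i" for i
        using C(2)[of i] C(4)[of _ i] unfolding diameter_def by (auto intro!: cSUP_least simp: less_imp_le)
      have bdd: "bounded (C i)" for i
      proof (cases "C i = {}")
        case False
        then obtain x where "x \<in> C i" by blast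
        then show ?thesis unfolding bounded_def using C(4) by blast
      qed simp
      have "ennreal (\<rho> i powr q) \<le> (\<Sum>i. ennreal (\<rho> i powr q))" for i
        by (rule ennreal_le_suminf)
      also have "\<dots> \<le> ennreal (t powr q)"
        using less unfolding cost_eq by (meson ennreal_leI less_imp_le min.cobounded2 order_trans)
      finally have "\<rho> i powr q \<le> t powr q" for i by simp
      then have \<rho>t: "\<rho> i \<le> t" for i
        using q t C(2)[of i] by (metis less_imp_le not_le powr_less_mono2)
      have "hausdorff_pre q t Y \<le> (\<Sum>i. ennreal (diameter (C i) powr q))"
        unfolding hausdorff_pre_def using C(1) bdd order_trans[OF diam \<rho>t] by (intro INF_lower) auto
      also have "\<dots> \<le> (\<Sum>i. ennreal (\<rho> i powr q))"
        using diam q bdd by (intro suminf_le ennreal_leI powr_mono2) (auto simp: diameter_ge_0)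
      also have "\<dots> \<le> ennreal e"
        using less unfolding cost_eq by (meson ennreal_leI less_imp_le min.cobounded1 order_trans)
      finally show ?thesis by simp
    qed
    then have "hausdorff_pre q t Y \<le> 0" by (rule ennreal_le_epsilon)
    then show ?thesis by simp
  qed
  then show ?thesis by (simp add: hausdorff_eq_SUP[OF q])
qed

lemma mixed_content_mono_exponent:
  assumes null: "mixed_content 0 p (\<lambda>x. x) Y = 0" and "0 < p" "p \<le> q"
  shows "mixed_content 0 q (\<lambda>x. x) Y = 0"
proof -
  have "mixed_content 0 q (\<lambda>x. x) Y \<le> 0 + ennreal e" if e: "0 < e" for e
  proof -
    have "mixed_content 0 p (\<lambda>x. x) Y < ennreal e" using null e by simp
    then obtain C r \<rho> where cov: "mixed_cover (\<lambda>x. x) Y C r \<rho>"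
        and less: "(\<Sum>i. ennreal (r i powr 0 * \<rho> i powr p)) < ennreal e"
      by (rule mixed_content_lessE)
    have "mixed_content 0 q (\<lambda>x. x) Y \<le> (\<Sum>i. ennreal (r i powr 0 * \<rho> i powr q))"
      using cov by (rule mixed_content_le)
    also have "\<dots> \<le> (\<Sum>i. ennreal (r i powr 0 * \<rho> i powr p))"
      using cov assms by (intro suminf_le ennreal_leI mult_left_mono powr_mono') (auto simp: mixed_cover_def less_imp_le)
    finally show ?thesis using less by simp
  qed
  then have "mixed_content 0 q (\<lambda>x. x) Y \<le> 0" by (rule ennreal_le_epsilon)
  then show ?thesis by simp
qed

lemma mixed_content_null_range:
  assumes null: "mixed_content 0 q f A = 0"
  shows "mixed_content 0 q (\<lambda>x. x) (f ` A) = 0"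
proof -
  have "mixed_content 0 q (\<lambda>x. x) (f ` A) \<le> 0 + ennreal e" if e: "0 < e" for e
  proof -
    have "mixed_content 0 q f A < ennreal e" using null e by simp
    then obtain C r \<rho> where cov: "mixed_cover f A C r \<rho>"
        and less: "(\<Sum>i. ennreal (r i powr 0 * \<rho> i powr q)) < ennreal e"
      by (rule mixed_content_lessE)
    have "mixed_cover (\<lambda>x. x) (f ` A) (\<lambda>i. f ` C i) \<rho> \<rho>"
      using cov unfolding mixed_cover_def by (auto simp: image_iff) blast
    then have "mixed_content 0 q (\<lambda>x. x) (f ` A) \<le> (\<Sum>i. ennreal (\<rho> i powr 0 * \<rho> i powr q))"
      by (rule mixed_content_le)
    also have "\<dots> = (\<Sum>i. ennreal (r i powr 0 * \<rho> i powr q))"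
      using cov by (intro suminf_cong) (simp add: mixed_cover_def, metis less_irrefl)
    finally show ?thesis using less by simp
  qed
  then have "mixed_content 0 q (\<lambda>x. x) (f ` A) \<le> 0" by (rule ennreal_le_epsilon)
  then show ?thesis by simp
qed

text \<open>
The index of the dyadic cube containing $y$. The factor $d$, the dimension of the target, makes
the diameter of a cube of generation $j$ at most $2^{-j}$ in the Euclidean metric.
\<close>
definition cell :: "nat \<Rightarrow> real^'d \<Rightarrow> ('d \<Rightarrow> int)" where
  "cell j y = (\<lambda>l. \<lfloor>y $ l * (real CARD('d) * 2 ^ j)\<rfloor>)"

lemma cell_coarsen:
  fixes y z :: "real^'d"
  assumes "cell j y = cell j z" "i \<le> j" shows "cell i y = cell i z"
proof
  fix l
  have *: "\<lfloor>y $ l * (real CARD('d) * 2 ^ i)\<rfloor> = \<lfloor>y $ l * (real CARD('d) * 2 ^ j)\<rfloor> div 2 ^ (j - i)" for y :: "real^'d"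
  proof -
    have "(2::real) ^ j = 2 ^ i * 2 ^ (j - i)" using assms(2) by (simp flip: power_add)
    then have "y $ l * (real CARD('d) * 2 ^ i) = y $ l * (real CARD('d) * 2 ^ j) / real_of_int (2 ^ (j - i))"
      by simp
    then show ?thesis by (simp only: floor_divide_real_eq_div[of "2 ^ (j - i)"] zero_le_power zero_le_numeral)
  qed
  have "\<lfloor>y $ l * (real CARD('d) * 2 ^ j)\<rfloor> = \<lfloor>z $ l * (real CARD('d) * 2 ^ j)\<rfloor>"
    using fun_cong[OF assms(1), of l] by (simp add: cell_def)
  then show "cell i y l = cell i z l" unfolding cell_def * by simp
qed

lemma dist_same_cell:
  fixes y z :: "real^'d"
  assumes "cell j y = cell j z" shows "dist y z \<le> (1 / 2) ^ j"
proof -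
  have "dist y z \<le> (\<Sum>l\<in>UNIV. \<bar>y $ l - z $ l\<bar>)" by (rule dist_vec_le_sum)
  also have "\<dots> \<le> (\<Sum>l\<in>(UNIV::'d set). (1 / 2) ^ j / real CARD('d))"
  proof (rule sum_mono)
    fix l :: 'd
    define s where "s = real CARD('d) * 2 ^ j"
    have s: "s > 0" by (simp add: s_def)
    have "\<lfloor>y $ l * s\<rfloor> = \<lfloor>z $ l * s\<rfloor>" using fun_cong[OF assms, of l] by (simp add: cell_def s_def)
    then have "\<bar>y $ l * s - z $ l * s\<bar> \<le> 1" by linarith
    then have "\<bar>y $ l - z $ l\<bar> * s \<le> 1" using s by (simp add: abs_mult flip: left_diff_distrib)
    then have "\<bar>y $ l - z $ l\<bar> \<le> 1 / s" using s by (simp add: field_simps)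
    then show "\<bar>y $ l - z $ l\<bar> \<le> (1 / 2) ^ j / real CARD('d)" by (simp add: s_def power_divide mult.commute)
  qed
  also have "\<dots> = (1 / 2) ^ j" by simp
  finally show ?thesis .
qed

text \<open>
A set of diameter at most $2^{-j}$ spreads over at most $d$ neighbouring cells to either side in
each coordinate.
\<close>
lemma card_cells_le:
  fixes E :: "(real^'d) set"
  assumes "\<And>x y. x \<in> E \<Longrightarrow> y \<in> E \<Longrightarrow> dist x y \<le> (1 / 2) ^ j"
  shows "finite (cell j ` E)" "card (cell j ` E) \<le> (2 * CARD('d) + 1) ^ CARD('d)"
proof -
  have "finite (cell j ` E) \<and> card (cell j ` E) \<le> (2 * CARD('d) + 1) ^ CARD('d)"
  proof (cases "E = {}")
    case False
    then obtain z where z: "z \<in> E" by blast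
    let ?d = "int CARD('d)"
    let ?P = "PiE UNIV (\<lambda>l. {cell j z l - ?d .. cell j z l + ?d})"
    have sub: "cell j ` E \<subseteq> ?P"
    proof
      fix \<kappa> assume "\<kappa> \<in> cell j ` E"
      then obtain y where y: "y \<in> E" "\<kappa> = cell j y" by blast
      have "cell j y l \<in> {cell j z l - ?d .. cell j z l + ?d}" for l
      proof -
        have "\<bar>y $ l - z $ l\<bar> \<le> (1 / 2) ^ j"
          using component_le_norm_cart[of "y - z" l] assms[OF y(1) z] by (simp add: dist_norm)
        then have "\<bar>y $ l - z $ l\<bar> * (real CARD('d) * 2 ^ j) \<le> (1 / 2) ^ j * (real CARD('d) * 2 ^ j)"
          by (intro mult_right_mono) auto
        then have "\<bar>y $ l * (real CARD('d) * 2 ^ j) - z $ l * (real CARD('d) * 2 ^ j)\<bar> \<le> real CARD('d)"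
          by (simp add: abs_mult power_divide flip: left_diff_distrib)
        then show ?thesis unfolding cell_def by (simp add: abs_le_iff) linarith
      qed
      then show "\<kappa> \<in> ?P" using y by auto
    qed
    have fin: "finite ?P" by (intro finite_PiE) auto
    have "card ?P = (2 * CARD('d) + 1) ^ CARD('d)" by (simp add: card_PiE nat_add_distrib nat_mult_distrib)
    then show ?thesis using card_mono[OF fin sub] finite_subset[OF sub fin] by simp
  qed simp
  then show "finite (cell j ` E)" "card (cell j ` E) \<le> (2 * CARD('d) + 1) ^ CARD('d)" by auto
qed

lemma dyadic_level:
  assumes "0 < (\<rho>::real)" "\<rho> \<le> 1" obtains j where "\<rho> \<le> (1 / 2) ^ j" "(1 / 2) ^ j \<le> 2 * \<rho>"
proof -
  obtain N where "(1 / 2) ^ N < \<rho>" using real_arch_pow_inv[of \<rho> "1/2"] assms by auto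
  define j where "j = (LEAST N. (1 / 2) ^ N \<le> 2 * \<rho>)"
  have ex: "(1 / 2) ^ N \<le> 2 * \<rho>" using \<open>(1 / 2) ^ N < \<rho>\<close> assms by linarith
  then have 1: "(1 / 2) ^ j \<le> 2 * \<rho>" unfolding j_def by (rule LeastI)
  have "\<rho> \<le> (1 / 2) ^ j"
  proof (cases j)
    case 0 then show ?thesis using assms by simp
  next
    case (Suc i)
    then have "\<not> (1 / 2) ^ i \<le> 2 * \<rho>" unfolding j_def by (metis lessI not_less_Least)
    then show ?thesis using Suc by simp
  qed
  then show thesis using 1 by (rule that)
qed

text \<open>
The thresholds crossed by a sum that passes from $a$ to $a + b$; both may be infinite.
\<close>
lemma emeasure_threshold_le:
  "emeasure lborel {\<theta>::real. 0 < \<theta> \<and> a < ennreal \<theta> \<and> ennreal \<theta> \<le> a + b} \<le> b"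
proof (cases "a = top \<or> b = top")
  case True
  then show ?thesis by auto
next
  case False
  then obtain a' b' where ab: "a = ennreal a'" "b = ennreal b'" "0 \<le> a'" "0 \<le> b'"
    by (metis ennreal_cases)
  have "{\<theta>::real. 0 < \<theta> \<and> a < ennreal \<theta> \<and> ennreal \<theta> \<le> a + b} \<subseteq> {a'<..a' + b'}"
    using ab by (auto simp: ennreal_less_iff ennreal_le_iff simp flip: ennreal_plus)
  then have "emeasure lborel {\<theta>::real. 0 < \<theta> \<and> a < ennreal \<theta> \<and> ennreal \<theta> \<le> a + b} \<le> emeasure lborel {a'<..a' + b'}"
    by (intro emeasure_mono) auto
  also have "\<dots> = b" using ab by simp
  finally show ?thesis .
qed

lemma suminf_ennreal_swap: "(\<Sum>i. \<Sum>j. f i j) = (\<Sum>j. \<Sum>i. (f i j :: ennreal))"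
proof -
  have "(\<Sum>i. \<Sum>j. f i j) = (\<integral>\<^sup>+i. (\<Sum>j. f i j) \<partial>count_space UNIV)"
    by (rule nn_integral_count_space_nat[symmetric])
  also have "\<dots> = (\<Sum>j. \<integral>\<^sup>+i. f i j \<partial>count_space UNIV)"
    by (rule nn_integral_suminf) simp
  also have "\<dots> = (\<Sum>j. \<Sum>i. f i j)"
    by (simp add: nn_integral_count_space_nat)
  finally show ?thesis .
qed

text \<open>
Replace each $E_i$ by the dyadic cells of comparable size meeting it and let $S_j(y)$ be the total
weight of the cells of generation less than $j$ containing $y$. It depends only on the cell of
generation $j$ containing $y$, and it increases with $j$ from $0$ to at least $t$. For each threshold
$\theta \in (0,t)$ the cells at which $S$ crosses $\theta$ cover $Y$. A cell of weight $T$ is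
used for a set of thresholds of length at most $T$, so integrating the cost of these covers over
$\theta$ gives at most the sum of weight times cost over all cells, while the integral is at least $t$ times
the content of $Y$.
\<close>
lemma weighted_cover_content_le:
  fixes E :: "nat \<Rightarrow> (real^'d) set" and t q :: real
  assumes q: "q > 0" and t: "t > 0" and w: "\<And>i. 0 \<le> w i"
    and \<rho>: "\<And>i. 0 < \<rho> i" "\<And>i. \<rho> i \<le> 1"
    and diam: "\<And>i x y. x \<in> E i \<Longrightarrow> y \<in> E i \<Longrightarrow> dist x y \<le> \<rho> i"
    and Y: "\<And>y. y \<in> Y \<Longrightarrow> ennreal t \<le> (\<Sum>i. if y \<in> E i then ennreal (w i) else 0)"
  shows "ennreal t * mixed_content 0 q (\<lambda>x. x) Y
    \<le> ennreal (real ((2 * CARD('d) + 1) ^ CARD('d)) * 2 powr q) * (\<Sum>i. ennreal (w i * \<rho> i powr q))"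
proof -
  define M where "M = (2 * CARD('d) + 1) ^ CARD('d)"
  have "\<forall>i. \<exists>j. \<rho> i \<le> (1 / 2) ^ j \<and> (1 / 2) ^ j \<le> 2 * \<rho> i"
    using \<rho> by (metis dyadic_level)
  then obtain J where J: "\<And>i. \<rho> i \<le> (1 / 2) ^ J i" "\<And>i. (1 / 2) ^ J i \<le> 2 * \<rho> i"
    unfolding choice_iff by blast
  define T where "T j \<kappa> = (\<Sum>i. if J i = j \<and> \<kappa> \<in> cell j ` E i then ennreal (w i) else 0)" for j \<kappa>
  define S where "S j y = (\<Sum>l<j. T l (cell l y))" for j and y :: "real^'d"
  have S_Suc: "S (Suc j) y = S j y + T j (cell j y)" for j y by (simp add: S_def)
  have S_cell: "S j y = S j z" if "cell j y = cell j z" for j y z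
    unfolding S_def using cell_coarsen[OF that] by (intro sum.cong) (auto simp: less_imp_le)
  have cross: "\<exists>j. S j y < ennreal \<theta> \<and> ennreal \<theta> \<le> S (Suc j) y" if y: "y \<in> Y" and \<theta>: "0 < \<theta>" "\<theta> < t" for y \<theta>
  proof -
    let ?u = "\<lambda>i. if y \<in> E i then ennreal (w i) else 0"
    have "ennreal \<theta> < ennreal t" using \<theta> by (simp add: ennreal_less_iff)
    also have "\<dots> \<le> (SUP n. \<Sum>i<n. ?u i)" using Y[OF y] by (simp add: suminf_eq_SUP)
    finally obtain n where n: "ennreal \<theta> < (\<Sum>i<n. ?u i)" by (auto simp: less_SUP_iff)
    define j where "j = Suc (\<Sum>i<n. J i)"
    have Jj: "J i < j" if "i < n" for i
      using member_le_sum[of i "{..<n}" J] that by (auto simp: j_def)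
    have "(\<Sum>i<n. ?u i) \<le> (\<Sum>i<n. \<Sum>l<j. if J i = l \<and> cell l y \<in> cell l ` E i then ennreal (w i) else 0)"
    proof (rule sum_mono)
      fix i assume "i \<in> {..<n}"
      then have "J i < j" using Jj by auto
      then have "?u i \<le> (\<Sum>l\<in>{J i}. if J i = l \<and> cell l y \<in> cell l ` E i then ennreal (w i) else 0)" by auto
      also have "\<dots> \<le> (\<Sum>l<j. if J i = l \<and> cell l y \<in> cell l ` E i then ennreal (w i) else 0)"
        using \<open>J i < j\<close> by (intro sum_mono2) auto
      finally show "?u i \<le> \<dots>" .
    qed
    also have "\<dots> = (\<Sum>l<j. \<Sum>i<n. if J i = l \<and> cell l y \<in> cell l ` E i then ennreal (w i) else 0)"
      by (rule sum.swap)
    also have "\<dots> \<le> S j y"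
      unfolding S_def T_def by (intro sum_mono sum_le_suminf) auto
    finally have ex: "ennreal \<theta> \<le> S j y" using n by simp
    define k where "k = (LEAST j. ennreal \<theta> \<le> S j y)"
    have k: "ennreal \<theta> \<le> S k y" unfolding k_def using ex by (rule LeastI)
    have "k \<noteq> 0"
    proof
      assume "k = 0"
      then have "ennreal \<theta> \<le> 0" using k by (simp add: S_def)
      then show False using \<theta> by (simp add: ennreal_eq_0_iff)
    qed
    then obtain i where i: "k = Suc i" by (cases k) auto
    have "\<not> ennreal \<theta> \<le> S i y" using i unfolding k_def by (metis lessI not_less_Least)
    then show ?thesis using k i by (auto simp: not_le)
  qed
  \<comment> \<open>an enumeration of all cells of all generations; \<open>a n\<close> is the value of \<open>S\<close> before the \<open>n\<close>-th cell and
    \<open>b n\<close> the weight of that cell, so that \<open>I n\<close> is the set of thresholds crossed there\<close>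
  define \<pi> where "\<pi> = from_nat_into (UNIV :: (nat \<times> ('d \<Rightarrow> int)) set)"
  have inf: "infinite (UNIV :: (nat \<times> ('d \<Rightarrow> int)) set)" by (simp add: finite_prod)
  have \<pi>: "bij \<pi>" unfolding \<pi>_def using bij_betw_from_nat_into[OF countableI_type inf] by simp
  define a where "a n = S (fst (\<pi> n)) (SOME y. cell (fst (\<pi> n)) y = snd (\<pi> n))" for n
  define b where "b n = T (fst (\<pi> n)) (snd (\<pi> n))" for n
  define c where "c n = ennreal (((1 / 2) ^ fst (\<pi> n)) powr q)" for n
  define I where "I n = {\<theta>::real. 0 < \<theta> \<and> a n < ennreal \<theta> \<and> ennreal \<theta> \<le> a n + b n}" for n
  have I_sets: "I n \<in> sets lborel" for n unfolding I_def by measurable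
  have pointwise: "mixed_content 0 q (\<lambda>x. x) Y * indicator {0<..<t} \<theta> \<le> (\<Sum>n. c n * indicator (I n) \<theta>)" for \<theta>
  proof (cases "\<theta> \<in> {0<..<t}")
    case True
    then have \<theta>: "0 < \<theta>" "\<theta> < t" by auto
    define Z where "Z n = {y. cell (fst (\<pi> n)) y = snd (\<pi> n) \<and> S (fst (\<pi> n)) y < ennreal \<theta> \<and>
       ennreal \<theta> \<le> S (Suc (fst (\<pi> n))) y}" for n
    have "Y \<subseteq> (\<Union>n. Z n)"
    proof
      fix y assume y: "y \<in> Y"
      obtain j where j: "S j y < ennreal \<theta>" "ennreal \<theta> \<le> S (Suc j) y" using cross[OF y \<theta>] by blast
      obtain n where "\<pi> n = (j, cell j y)" using \<pi> by (metis bij_pointE)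
      then have "y \<in> Z n" using j by (simp add: Z_def)
      then show "y \<in> (\<Union>n. Z n)" by blast
    qed
    then have "mixed_content 0 q (\<lambda>x. x) Y \<le> mixed_content 0 q (\<lambda>x. x) (\<Union>n. Z n)" by (rule mixed_content_mono)
    also have "\<dots> \<le> (\<Sum>n. mixed_content 0 q (\<lambda>x. x) (Z n))" by (rule mixed_content_UN_le)
    also have "\<dots> \<le> (\<Sum>n. c n * indicator (I n) \<theta>)"
    proof (rule suminf_le)
      fix n
      show "mixed_content 0 q (\<lambda>x. x) (Z n) \<le> c n * indicator (I n) \<theta>"
      proof (cases "Z n = {}")
        case True then show ?thesis using q by simp
      next
        case False
        then obtain y where y: "y \<in> Z n" by blast
        have cy: "cell (fst (\<pi> n)) y = snd (\<pi> n)" using y by (simp add: Z_def)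
        then have "cell (fst (\<pi> n)) (SOME y. cell (fst (\<pi> n)) y = snd (\<pi> n)) = snd (\<pi> n)" by (rule someI)
        then have "a n = S (fst (\<pi> n)) y" unfolding a_def by (intro S_cell) (simp add: cy)
        then have "\<theta> \<in> I n" using y \<theta> by (simp add: Z_def I_def b_def S_Suc cy)
        moreover have "mixed_content 0 q (\<lambda>x. x) (Z n) \<le> ennreal (1 powr 0 * ((1 / 2) ^ fst (\<pi> n)) powr q)"
        proof (rule mixed_content_single[OF q])
          fix x z assume "x \<in> Z n" "z \<in> Z n"
          then have d: "dist x z \<le> (1 / 2) ^ fst (\<pi> n)" by (intro dist_same_cell) (simp add: Z_def)
          then show "dist x z \<le> (1 / 2) ^ fst (\<pi> n)" .
          show "dist x z \<le> 1" using d power_le_one[of "1/2::real" "fst (\<pi> n)"] by linarith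
        qed (auto simp: power_le_one)
        ultimately show ?thesis by (simp add: c_def)
      qed
    qed auto
    finally show ?thesis using True by simp
  qed simp
  have "ennreal t * mixed_content 0 q (\<lambda>x. x) Y = (\<integral>\<^sup>+\<theta>. mixed_content 0 q (\<lambda>x. x) Y * indicator {0<..<t} \<theta> \<partial>lborel)"
    using t by (subst nn_integral_cmult_indicator) (auto simp: mult.commute)
  also have "\<dots> \<le> (\<integral>\<^sup>+\<theta>. (\<Sum>n. c n * indicator (I n) \<theta>) \<partial>lborel)"
    by (intro nn_integral_mono pointwise)
  also have "\<dots> = (\<Sum>n. \<integral>\<^sup>+\<theta>. c n * indicator (I n) \<theta> \<partial>lborel)"
    using I_sets by (intro nn_integral_suminf) auto
  also have "\<dots> = (\<Sum>n. c n * emeasure lborel (I n))"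
    using I_sets by (simp add: nn_integral_cmult_indicator)
  also have "\<dots> \<le> (\<Sum>n. c n * b n)"
    unfolding I_def by (intro suminf_le mult_left_mono emeasure_threshold_le) auto
  also have "\<dots> = (\<Sum>n. \<Sum>i. c n * (if J i = fst (\<pi> n) \<and> snd (\<pi> n) \<in> cell (fst (\<pi> n)) ` E i then ennreal (w i) else 0))"
    by (simp add: b_def T_def)
  also have "\<dots> = (\<Sum>i. \<Sum>n. c n * (if J i = fst (\<pi> n) \<and> snd (\<pi> n) \<in> cell (fst (\<pi> n)) ` E i then ennreal (w i) else 0))"
    by (rule suminf_ennreal_swap)
  also have "\<dots> \<le> (\<Sum>i. ennreal (real M * 2 powr q) * ennreal (w i * \<rho> i powr q))"
  proof (rule suminf_le)
    fix i
    have diam': "dist x y \<le> (1 / 2) ^ J i" if "x \<in> E i" "y \<in> E i" for x y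
      using diam[OF that] J(1)[of i] by linarith
    let ?N = "{n. J i = fst (\<pi> n) \<and> snd (\<pi> n) \<in> cell (fst (\<pi> n)) ` E i}"
    have sub: "\<pi> ` ?N \<subseteq> {J i} \<times> cell (J i) ` E i"
    proof
      fix p assume "p \<in> \<pi> ` ?N"
      then obtain n where "p = \<pi> n" "J i = fst (\<pi> n)" "snd (\<pi> n) \<in> cell (fst (\<pi> n)) ` E i" by blast
      then show "p \<in> {J i} \<times> cell (J i) ` E i" by (simp add: mem_Times_iff)
    qed
    have inj: "inj_on \<pi> ?N" using \<pi> by (meson bij_def inj_on_subset subset_UNIV)
    have fin: "finite ({J i} \<times> cell (J i) ` E i)" using card_cells_le(1)[OF diam'] by simp
    have finN: "finite ?N" using inj_on_finite[OF inj sub fin] .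
    have "card ?N \<le> card ({J i} \<times> cell (J i) ` E i)" by (rule card_inj_on_le[OF inj sub fin])
    also have "\<dots> \<le> M" using card_cells_le(2)[OF diam'] by (simp add: M_def card_cartesian_product)
    finally have cardN: "card ?N \<le> M" .
    have "(\<Sum>n. c n * (if J i = fst (\<pi> n) \<and> snd (\<pi> n) \<in> cell (fst (\<pi> n)) ` E i then ennreal (w i) else 0))
      = (\<Sum>n\<in>?N. c n * (if J i = fst (\<pi> n) \<and> snd (\<pi> n) \<in> cell (fst (\<pi> n)) ` E i then ennreal (w i) else 0))"
      using finN by (intro suminf_finite) auto
    also have "\<dots> = (\<Sum>n\<in>?N. ennreal (((1 / 2) ^ J i) powr q * w i))"
      by (intro sum.cong) (auto simp: c_def ennreal_mult' w)
    also have "\<dots> \<le> (\<Sum>n\<in>?N. ennreal (2 powr q * (w i * \<rho> i powr q)))"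
    proof (intro sum_mono ennreal_leI)
      have "((1 / 2) ^ J i) powr q \<le> (2 * \<rho> i) powr q" using J(2)[of i] q by (intro powr_mono2) auto
      also have "\<dots> = 2 powr q * \<rho> i powr q" using \<rho>(1)[of i] by (simp add: powr_mult)
      finally have "((1 / 2) ^ J i) powr q * w i \<le> 2 powr q * \<rho> i powr q * w i" using w by (rule mult_right_mono)
      then show "((1 / 2) ^ J i) powr q * w i \<le> 2 powr q * (w i * \<rho> i powr q)" by (simp add: mult_ac)
    qed
    also have "\<dots> = ennreal (real (card ?N) * (2 powr q * (w i * \<rho> i powr q)))"
      by (simp add: ennreal_of_nat_eq_real_of_nat ennreal_mult')
    also have "\<dots> \<le> ennreal (real M * (2 powr q * (w i * \<rho> i powr q)))"
      using cardN w by (intro ennreal_leI mult_right_mono) auto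
    also have "\<dots> = ennreal (real M * 2 powr q) * ennreal (w i * \<rho> i powr q)"
      by (simp add: ennreal_mult'[symmetric] mult.assoc)
    finally show "(\<Sum>n. c n * (if J i = fst (\<pi> n) \<and> snd (\<pi> n) \<in> cell (fst (\<pi> n)) ` E i then ennreal (w i) else 0))
      \<le> ennreal (real M * 2 powr q) * ennreal (w i * \<rho> i powr q)" .
  qed auto
  also have "\<dots> = ennreal (real M * 2 powr q) * (\<Sum>i. ennreal (w i * \<rho> i powr q))"
    by (rule ennreal_suminf_cmult)
  finally show ?thesis by (simp add: M_def)
qed

text \<open>
For a cover of $A$ as in the mixed content, the sets $C_i$ with $y \in f(C_i)$ cover the fibre over $y$, at cost
$\sum r_i^\mu$. If the fibre has content larger than $\tau \le 1$, then $y$ is covered by the images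
$f(C_i)$ with weight at least $\tau$, and the content of the set of these $y$ is at most a constant times
$\sum_i r_i^\mu \rho_i^q / \tau$.
\<close>
theorem hausdorff_fibres_null:
  fixes f :: "'a::metric_space \<Rightarrow> real^'d"
  assumes \<mu>: "\<mu> > 0" and q: "q > 0" and null: "mixed_content \<mu> q f A = 0"
  shows "mixed_content 0 q (\<lambda>x. x) {y. hausdorff \<mu> (A \<inter> f -` {y}) \<noteq> 0} = 0"
proof -
  define \<phi> where "\<phi> y = mixed_content 0 \<mu> (\<lambda>x. x) (A \<inter> f -` {y})" for y
  define Mq where "Mq = real ((2 * CARD('d) + 1) ^ CARD('d)) * 2 powr q"
  have Mq: "Mq > 0" by (simp add: Mq_def)
  have level: "mixed_content 0 q (\<lambda>x. x) {y. ennreal \<tau> < \<phi> y} = 0" if \<tau>: "0 < \<tau>" "\<tau> \<le> 1" for \<tau>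
  proof -
    have "mixed_content 0 q (\<lambda>x. x) {y. ennreal \<tau> < \<phi> y} \<le> 0 + ennreal e" if e: "0 < e" for e
    proof -
      have "mixed_content \<mu> q f A < ennreal (e * \<tau> / Mq)" using null e \<tau> Mq by simp
      then obtain C r \<rho> where cov: "mixed_cover f A C r \<rho>"
        and less: "(\<Sum>i. ennreal (r i powr \<mu> * \<rho> i powr q)) < ennreal (e * \<tau> / Mq)"
        by (rule mixed_content_lessE)
      have C: "A \<subseteq> (\<Union>i. C i)" "\<And>i. 0 < \<rho> i" "\<And>i. \<rho> i \<le> 1" "\<And>i. 0 < r i"
        "\<And>i x y. x \<in> C i \<Longrightarrow> y \<in> C i \<Longrightarrow> dist x y \<le> r i"
        "\<And>i x y. x \<in> C i \<Longrightarrow> y \<in> C i \<Longrightarrow> dist (f x) (f y) \<le> \<rho> i"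
        using cov by (auto simp: mixed_cover_def)
      have heavy: "ennreal \<tau> \<le> (\<Sum>i. if y \<in> f ` C i then ennreal (r i powr \<mu>) else 0)" if y: "ennreal \<tau> < \<phi> y" for y
      proof (rule ccontr)
        let ?u = "\<lambda>i. if y \<in> f ` C i then ennreal (r i powr \<mu>) else 0"
        assume "\<not> ennreal \<tau> \<le> (\<Sum>i. ?u i)"
        then have light: "(\<Sum>i. ?u i) < ennreal \<tau>" by simp
        \<comment> \<open>\<open>\<phi>\<close> admits only radii at most $1$, and a light cover has no larger ones over \<open>y\<close>\<close>
        have r1: "r i \<le> 1" if "y \<in> f ` C i" for i
        proof -
          have "ennreal (r i powr \<mu>) \<le> (\<Sum>i. ?u i)"
            using ennreal_le_suminf[of ?u i] that by simp
          also have "\<dots> \<le> ennreal 1" using light \<tau> by (meson ennreal_leI less_imp_le order_trans)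
          finally have "r i powr \<mu> \<le> 1" by (simp only: ennreal_le_iff zero_le_one)
          then show ?thesis using \<mu> C(4)[of i] by (metis less_imp_le not_le powr_less_mono2 powr_one_eq_one zero_le_one)
        qed
        have "A \<inter> f -` {y} \<subseteq> (\<Union>i. C i \<inter> f -` {y})" using C(1) by blast
        then have "\<phi> y \<le> mixed_content 0 \<mu> (\<lambda>x. x) (\<Union>i. C i \<inter> f -` {y})"
          unfolding \<phi>_def by (rule mixed_content_mono)
        also have "\<dots> \<le> (\<Sum>i. mixed_content 0 \<mu> (\<lambda>x. x) (C i \<inter> f -` {y}))" by (rule mixed_content_UN_le)
        also have "\<dots> \<le> (\<Sum>i. ?u i)"
        proof (rule suminf_le)
          fix i
          show "mixed_content 0 \<mu> (\<lambda>x. x) (C i \<inter> f -` {y}) \<le> ?u i"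
          proof (cases "y \<in> f ` C i")
            case True
            have "mixed_content 0 \<mu> (\<lambda>x. x) (C i \<inter> f -` {y}) \<le> ennreal (r i powr 0 * r i powr \<mu>)"
              using \<mu> C(4,5) r1[OF True] by (intro mixed_content_single) auto
            then show ?thesis using True C(4)[of i] by simp
          next
            case False
            then have "C i \<inter> f -` {y} = {}" by auto
            then show ?thesis using \<mu> by simp
          qed
        qed auto
        finally show False using light y by (meson less_le_trans not_less order_less_imp_le)
      qed
      have "ennreal \<tau> * mixed_content 0 q (\<lambda>x. x) {y. ennreal \<tau> < \<phi> y}
        \<le> ennreal Mq * (\<Sum>i. ennreal (r i powr \<mu> * \<rho> i powr q))"
        unfolding Mq_def
      proof (rule weighted_cover_content_le[OF q \<tau>(1)])
        show "ennreal \<tau> \<le> (\<Sum>i. if y \<in> f ` C i then ennreal (r i powr \<mu>) else 0)"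
          if "y \<in> {y. ennreal \<tau> < \<phi> y}" for y using heavy that by simp
        show "dist x y \<le> \<rho> i" if "x \<in> f ` C i" "y \<in> f ` C i" for i x y
        proof -
          obtain x' y' where "x' \<in> C i" "x = f x'" "y' \<in> C i" "y = f y'" using \<open>x \<in> f ` C i\<close> \<open>y \<in> f ` C i\<close> by blast
          then show ?thesis using C(6) by blast
        qed
      qed (use C in auto)
      also have "\<dots> \<le> ennreal Mq * ennreal (e * \<tau> / Mq)" using less by (intro mult_left_mono) auto
      also have "\<dots> = ennreal \<tau> * ennreal e"
        using Mq \<tau> e by (simp add: ennreal_mult'[symmetric] mult.commute)
      finally show ?thesis using \<tau> by (simp add: ennreal_mult_le_mult_iff)
    qed
    then have "mixed_content 0 q (\<lambda>x. x) {y. ennreal \<tau> < \<phi> y} \<le> 0" by (rule ennreal_le_epsilon)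
    then show ?thesis by simp
  qed
  have "{y. hausdorff \<mu> (A \<inter> f -` {y}) \<noteq> 0} \<subseteq> (\<Union>N. {y. ennreal (1 / real (Suc N)) < \<phi> y})"
  proof
    fix y assume "y \<in> {y. hausdorff \<mu> (A \<inter> f -` {y}) \<noteq> 0}"
    then have "\<phi> y \<noteq> 0" using hausdorff_null_of_mixed_content[OF \<mu>] unfolding \<phi>_def by blast
    then have "0 < \<phi> y" by (simp add: zero_less_iff_neq_zero)
    then obtain x where x: "0 < x" "ennreal x < \<phi> y"
      by (metis ennreal_less_zero_iff dense ennreal_cases ennreal_lessI less_top not_less_zero top.not_eq_extremum)
    obtain N where "1 / real (Suc N) < x" using x(1) nat_approx_posE by blast
    then have "ennreal (1 / real (Suc N)) < \<phi> y" using x(2) by (meson ennreal_leI less_imp_le order_le_less_trans)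
    then show "y \<in> (\<Union>N. {y. ennreal (1 / real (Suc N)) < \<phi> y})" by blast
  qed
  moreover have "mixed_content 0 q (\<lambda>x. x) (\<Union>N. {y. ennreal (1 / real (Suc N)) < \<phi> y}) = 0"
    by (intro mixed_content_null_UN q level) auto
  ultimately show ?thesis by (metis mixed_content_mono le_zero_eq)
qed

section \<open>The critical set\<close>

lemma partial_deriv_eq:
  assumes "(v has_derivative v') (at x)"
  shows "partial_deriv i v x = v' (axis i 1)"
proof -
  have lin: "linear v'" using assms by (rule has_derivative_linear)
  have line: "((\<lambda>t::real. x + t *\<^sub>R axis i 1) has_derivative (\<lambda>t. t *\<^sub>R axis i 1)) (at 0)"
    by (auto intro!: derivative_eq_intros)
  have "((\<lambda>t. v (x + t *\<^sub>R axis i 1)) has_derivative (\<lambda>t. v' (t *\<^sub>R axis i 1))) (at 0)"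
    using has_derivative_compose[OF line, of v v'] assms by simp
  then have "((\<lambda>t. v (x + t *\<^sub>R axis i 1)) has_vector_derivative v' (axis i 1)) (at 0)"
    unfolding has_vector_derivative_def by (simp add: linear_scale[OF lin])
  then show ?thesis unfolding partial_deriv_def by (rule vector_derivative_at)
qed

lemma has_gradient_component:
  fixes v :: "real^'n \<Rightarrow> real^'d"
  assumes "v differentiable (at x)"
  shows "has_gradient (\<lambda>x. v x $ c) (\<lambda>i. partial_deriv i v x $ c) x"
proof -
  obtain v' where v': "(v has_derivative v') (at x)" using assms by (auto simp: differentiable_def)
  have lin: "linear v'" using v' by (rule has_derivative_linear)
  have "v' h $ c = (\<Sum>i\<in>UNIV. h $ i * partial_deriv i v x $ c)" for h
  proof -
    have "h = (\<Sum>i\<in>UNIV. h $ i *\<^sub>R axis i 1)"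
      using basis_expansion[of h] by (simp add: scalar_mult_eq_scaleR)
    then have "v' h = v' (\<Sum>i\<in>UNIV. h $ i *\<^sub>R axis i 1)" by (rule arg_cong)
    also have "\<dots> = (\<Sum>i\<in>UNIV. h $ i *\<^sub>R partial_deriv i v x)"
      by (simp add: linear_sum[OF lin] linear_scale[OF lin] partial_deriv_eq[OF v'])
    finally show ?thesis by simp
  qed
  then have "(\<lambda>h. v' h $ c) = (\<lambda>h. \<Sum>i\<in>UNIV. h $ i * partial_deriv i v x $ c)" by auto
  then show ?thesis
    using bounded_linear.has_derivative[OF bounded_linear_vec_nth v', of c] by (simp add: has_gradient_def)
qed

text \<open>
The lists of directions are consumed from the right: the $k$-th order derivatives of
\<open>partial_deriv i v\<close> with directions \<open>is\<close> are the derivatives of \<open>v\<close> with directions \<open>is @ [i]\<close>.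
\<close>
lemma C_loc_of_C_k:
  fixes v :: "real^'n \<Rightarrow> real^'d"
  assumes \<alpha>: "0 \<le> \<alpha>"
  shows "C_k k v \<Longrightarrow> (\<And>is. length is = k \<Longrightarrow> 0 < \<alpha> \<Longrightarrow>
      \<exists>L\<ge>0. \<forall>x y. norm (iter_partial is v x - iter_partial is v y) \<le> L * norm (x - y) powr \<alpha>) \<Longrightarrow>
    C_loc k \<alpha> UNIV (\<lambda>x. v x $ c)"
proof (induction k arbitrary: v)
  case 0
  then have cont: "continuous_on UNIV (\<lambda>x. v x $ c)" by (auto intro: continuous_intros)
  have "\<exists>r>0. \<exists>L\<ge>0. \<forall>y\<in>ball x r \<inter> UNIV. \<forall>z\<in>ball x r \<inter> UNIV. \<bar>v y $ c - v z $ c\<bar> \<le> L * dist y z powr \<alpha>" for x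
  proof (cases "\<alpha> = 0")
    case True
    obtain r M where r: "r > 0" "M > 0" "\<forall>y\<in>ball x r \<inter> UNIV. \<bar>v y $ c\<bar> \<le> M"
      using continuous_on_locally_bounded[OF cont, of x] by auto
    have "\<bar>v y $ c - v z $ c\<bar> \<le> 2 * M * dist y z powr \<alpha>" if "y \<in> ball x r" "z \<in> ball x r" for y z
    proof (cases "y = z")
      case False
      have "\<bar>v y $ c\<bar> \<le> M" "\<bar>v z $ c\<bar> \<le> M" using r(3) that by auto
      then have "\<bar>v y $ c - v z $ c\<bar> \<le> 2 * M" by linarith
      then show ?thesis using True False by simp
    qed simp
    moreover have "2 * M \<ge> 0" using r by simp
    ultimately show ?thesis using r(1) by blast
  next
    case False
    then have "0 < \<alpha>" using \<alpha> by simp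
    then obtain L where L: "L \<ge> 0" "\<And>x y. norm (v x - v y) \<le> L * norm (x - y) powr \<alpha>"
      using 0(2)[of "[]"] by (auto simp: iter_partial_def)
    have "\<bar>v y $ c - v z $ c\<bar> \<le> L * dist y z powr \<alpha>" for y z
      using component_le_norm_cart[of "v y - v z" c] L(2)[of y z] by (simp add: dist_norm)
    then show ?thesis using L(1) by (intro exI[of _ 1]) auto
  qed
  then show ?case using cont by simp
next
  case (Suc k)
  have diff: "v differentiable (at x)" for x
    using Suc.prems(1) by (simp add: differentiable_on_def)
  have "C_loc k \<alpha> UNIV (\<lambda>x. partial_deriv i v x $ c)" for i
  proof (rule Suc.IH)
    show "C_k k (partial_deriv i v)" using Suc.prems(1) by simp
    show "\<exists>L\<ge>0. \<forall>x y. norm (iter_partial is (partial_deriv i v) x - iter_partial is (partial_deriv i v) y)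
        \<le> L * norm (x - y) powr \<alpha>" if "length is = k" "0 < \<alpha>" for "is"
      using Suc.prems(2)[of "is @ [i]"] that by (simp add: iter_partial_def)
  qed
  then show ?case unfolding C_loc.simps
    by (intro exI[of _ "\<lambda>i x. partial_deriv i v x $ c"]) (auto intro: has_gradient_component diff)
qed

lemma critical_set_low_rank:
  fixes v :: "real^'n \<Rightarrow> real^'d"
  assumes "x \<in> critical_set v m"
  shows "\<exists>v'. (v has_derivative v') (at x) \<and> dim (range v') \<le> m"
proof (intro exI conjI)
  have "v differentiable (at x)" using assms by (simp add: critical_set_def)
  then show "(v has_derivative (\<lambda>h. jacobian v (at x) *v h)) (at x)" by (simp add: jacobian_works)
  show "dim (range (\<lambda>h. jacobian v (at x) *v h)) \<le> m"
    using assms by (simp add: critical_set_def rank_dim_range)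
qed

theorem mixed_content_critical_set:
  fixes v :: "real^'n \<Rightarrow> real^'d"
  assumes \<alpha>: "0 \<le> \<alpha>" "\<alpha> \<le> 1" and k: "real k + \<alpha> \<ge> 1" and v: "C_k_alpha k \<alpha> v" and q: "q > real m"
  shows "mixed_content (real CARD('n) - real m - (real k + \<alpha>) * (q - real m)) q v (critical_set v m) = 0"
proof -
  have hol: "\<exists>L\<ge>0. \<forall>x y. norm (iter_partial is v x - iter_partial is v y) \<le> L * norm (x - y) powr \<alpha>"
    if len: "length is = k" and pos: "0 < \<alpha>" for "is"
  proof -
    obtain L where L: "L \<ge> 0" "\<And>x y. L2_set (\<lambda>is. norm (iter_partial is v x - iter_partial is v y)) {is. length is = k}
            \<le> L * norm (x - y) powr \<alpha>"
      using v pos by (auto simp: C_k_alpha_def)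
    have "finite {is :: 'n list. length is = k}" using finite_lists_length_eq[of "UNIV :: 'n set" k] by simp
    then have "norm (iter_partial is v x - iter_partial is v y)
        \<le> L2_set (\<lambda>is. norm (iter_partial is v x - iter_partial is v y)) {is. length is = k}" for x y
      using len by (intro member_le_L2_set) auto
    then show ?thesis using L by (meson order_trans)
  qed
  have rank: "\<exists>v'. (v has_derivative v') (at x) \<and> dim (range v') \<le> m" if "x \<in> critical_set v m" for x
    using that by (rule critical_set_low_rank)
  show ?thesis
  proof (cases k)
    case 0
    then have \<alpha>1: "\<alpha> = 1" using \<alpha> k by simp
    obtain L where "L \<ge> 0" "\<And>x y. dist (v x) (v y) \<le> L * dist x y"
      using hol[of "[]"] 0 \<alpha>1 by (auto simp: iter_partial_def dist_norm)
    then show ?thesis using rank q by (rule mixed_content_null_of_lipschitz) (simp_all add: 0 \<alpha>1)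
  next
    case (Suc k')
    have C: "C_loc (Suc k') \<alpha> UNIV (\<lambda>x. v x $ c)" for c
      using C_loc_of_C_k[OF \<alpha>(1), of k v c] v hol unfolding C_k_alpha_def Suc by blast
    show ?thesis
      by (rule mixed_content_null_of_low_rank[OF \<alpha> q, where U = UNIV and P = "{}" and k = k'])
         (use C rank Suc in auto)
  qed
qed

theorem theorem1p1:
  fixes v :: "real^'n \<Rightarrow> real^'d" and m k :: nat and \<alpha> q :: real
  assumes "m < CARD('n)" and "m < CARD('d)"
    and "0 \<le> \<alpha>" and "\<alpha> \<le> 1" and "real k + \<alpha> \<ge> 1"
    and "C_k_alpha k \<alpha> v"
    and "q > real m"
  shows "let \<mu> = real CARD('n) - real m - (real k + \<alpha>) * (q - real m)
         in hausdorff q {y. hausdorff \<mu> (critical_set v m \<inter> v -` {y}) \<noteq> 0} = 0"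
proof -
  define \<mu> where "\<mu> = real CARD('n) - real m - (real k + \<alpha>) * (q - real m)"
  define Z where "Z = critical_set v m"
  have q0: "q > 0" using assms(7) by linarith
  have "mixed_content 0 q (\<lambda>x. x) {y. hausdorff \<mu> (Z \<inter> v -` {y}) \<noteq> 0} = 0"
  proof (cases "\<mu> > 0")
    case True
    have "mixed_content \<mu> q v Z = 0"
      unfolding \<mu>_def Z_def using assms by (intro mixed_content_critical_set)
    then show ?thesis by (rule hausdorff_fibres_null[OF True q0])
  next
    case False
    \<comment> \<open>the exponent at which the counting measure would just be reached, i.e. $\mu_{q'} = 0$\<close>
    define q' where "q' = real m + (real CARD('n) - real m) / (real k + \<alpha>)"
    have s: "real k + \<alpha> > 0" using assms(5) by linarith
    have q': "q' > real m" using assms(1) s by (simp add: q'_def)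
    have "(real k + \<alpha>) * (q' - real m) = real CARD('n) - real m" using s by (simp add: q'_def)
    then have "real CARD('n) - real m - (real k + \<alpha>) * (q' - real m) = 0" by simp
    then have "mixed_content 0 q' v Z = 0"
      using mixed_content_critical_set[OF assms(3-6) q'] by (simp add: Z_def)
    then have "mixed_content 0 q' (\<lambda>x. x) (v ` Z) = 0" by (rule mixed_content_null_range)
    moreover have "q' \<le> q"
    proof -
      have "real CARD('n) - real m \<le> (real k + \<alpha>) * (q - real m)" using False by (simp add: \<mu>_def)
      then have "(real CARD('n) - real m) / (real k + \<alpha>) \<le> q - real m" using s by (simp add: field_simps)
      then show ?thesis by (simp add: q'_def)
    qed
    ultimately have null: "mixed_content 0 q (\<lambda>x. x) (v ` Z) = 0"
      using q' by (elim mixed_content_mono_exponent) auto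
    have "{y. hausdorff \<mu> (Z \<inter> v -` {y}) \<noteq> 0} \<subseteq> v ` Z"
    proof
      fix y assume "y \<in> {y. hausdorff \<mu> (Z \<inter> v -` {y}) \<noteq> 0}"
      then have "Z \<inter> v -` {y} \<noteq> {}" using False by (auto simp: hausdorff_def)
      then show "y \<in> v ` Z" by auto
    qed
    then show ?thesis using null by (metis mixed_content_mono le_zero_eq)
  qed
  then have "hausdorff q {y. hausdorff \<mu> (Z \<inter> v -` {y}) \<noteq> 0} = 0"
    by (rule hausdorff_null_of_mixed_content[OF q0])
  then show ?thesis by (simp add: Let_def \<mu>_def Z_def)
qed

end
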